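(* Let $(\mathsf{Encrypt},\mathsf{Decrypt})$ be an $\varepsilon$-QCA-R-authenticating scheme, with key recycling function $f(k_0,k)=k_0$, obtained from the canonical encode-encrypt construction using a strong-purity-testing code $\{V_{k_0}\}_{k_0\in\mathcal{K}_0}$. Let $M_1,M_2$ be the plaintext registers of two messages, $C_1=M_1T_1$ and $C_2=M_2T_2$ the corresponding ciphertext registers, and $R$ a side-information register. Let $\mathcal{A}_1$ (acting on $C_1C_2R$) and $\mathcal{A}_2$ (acting on $M_1C_2R$) be arbitrary adversarial quantum channels. For keys $k_0\in\mathcal{K}_0$ and one-time-pad keys $k_1,k_2$, define $$\mathrm{Real}_{k_0,k_1,k_2}=\mathsf{Decrypt}^{C_2\to M_2}_{k_0,k_2}\circ\mathcal{A}_2^{M_1,C_2,R}\circ\mathsf{Decrypt}^{C_1\to M_1}_{k_0,k_1}\circ\mathcal{A}_1^{C_1,C_2,R}\circ\left(\mathsf{Encrypt}^{M_1\to C_1}_{k_0,k_1}\otimes\mathsf{Encrypt}^{M_2\to C_2}_{k_0,k_2}\right).$$ Then there exists a simulator $\mathcal{S}_{\mathsf{rej}}$ such that the key-recycling real channel $$\mathfrak{R}:\rho^{M_1M_2R}\mapsto\mathbb{E}_{k_0,k_1,k_2}\Big[\big(\mathrm{Proj}^{M_2}_{acc}\circ\mathrm{Real}_{k_0,k_1,k_2}(\rho)\big)\otimes|k_0,k_2\rangle\langle k_0,k_2|+\big(\mathrm{Proj}^{M_2}_{rej}\circ\mathrm{Real}_{k_0,k_1,k_2}(\rho)\big)\otimes|k_0\rangle\langle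 k_0|\Big]$$ is $2\varepsilon$-close in diamond-norm distance to the ideal channel $$\mathfrak{I}=\mathbb{I}^{M_2}\otimes\mathcal{S}_{\mathsf{acc}}\otimes\mathbb{E}_{k_0,k_2}\big[|k_0,k_2\rangle\langle k_0,k_2|\big]+|\bot\rangle\langle\bot|^{M_2}\mathrm{Tr}_{M_2}\otimes\mathcal{S}_{\mathsf{rej}}\otimes\mathbb{E}_{k_0}\big[|k_0\rangle\langle k_0|\big].$$ Here $\mathcal{S}_{\mathsf{acc}}$ is as in the definition of QCA-R, i.e. it is an accepting simulator of the form $\mathcal{S}_{\mathsf{acc}}[\mathcal{A}]$ given there, taken for the second message (message register $M_2$, tag register $T_2$, side-information register $M_1R$).
   Context: **Paulis and norms.** $\mathbb{P}_n$ is the $n$-qubit Pauli group modulo phases, with elements $P_\ell$ indexed by $\ell\in\{0,1\}^{2n}$. The diamond norm is $\|\Psi\|_\diamond=\sup_\rho\|(\mathbb{I}\otimes\Psi)(\rho)\|_{\mathrm{tr}}$ (supremum over density matrices, with arbitrary ancilla); the diamond-norm distance of $\Psi,\Psi'$ is $\frac12\|\Psi-\Psi'\|_\diamond$. All keys are independent and uniformly random; $\mathbb{E}$ is the corresponding average. Maps act as the identity on registers not mentioned. $|\bot\rangle$ is a dummy reject state orthogonal to all messages; output message registers are enlarged to contain it. **Codes.** An $[[m+t,m]]$ code is given by a unitary $V$ encoding an $m$-qubit state $\rho$ as $V(\rho\otimes|0^t\rangle\langle0^t|)V^\dagger$, such that for every $P_\ell\in\mathbb{P}_{m+t}$ there are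 $P_{\ell'}\in\mathbb{P}_{m+t}$ and $\theta\in\mathbb{R}$ with $P_\ell V=e^{i\theta}VP_{\ell'}$. A set $\{V_{k}\}_{k\in\mathcal{K}_0}$ is strong purity testing with error $\eta$ if for every non-identity $P_\ell\in\mathbb{P}_{m+t}$, $\Pr_k[V_k^\dagger P_\ell V_k\in\mathbb{P}_m\otimes\{\mathsf{I},\mathsf{Z}\}^{\otimes t}]\le\eta$ (membership up to phase). **Canonical construction.** Key $\kappa=(k_0,k)$ with code key $k_0\in\mathcal{K}_0$ and one-time-pad key $k\in\{0,1\}^{2(m+t)}$; put $U_\kappa=P_kV_{k_0}$. With message register $M$ and tag register $T$, $\mathsf{Encrypt}_{k_0,k}(\rho)=U_\kappa(\rho\otimes|0^t\rangle\langle0^t|)U_\kappa^\dagger$ and $$\mathsf{Decrypt}_{k_0,k}(\rho)=\langle0^t|U_\kappa^\dagger\rho U_\kappa|0^t\rangle+|\bot\rangle\langle\bot|^M\otimes\mathrm{Tr}_M\Big[\sum_{i\ne0^t}\langle i|U_\kappa^\dagger\rho U_\kappa|i\rangle\Big],$$ bras and kets acting on $T$. **Projections.** $\mathrm{Proj}^M_{acc}:\rho\mapsto(\mathbb{I}-|\bot\rangle\langle\bot|)^M\rho(\mathbb{I}-|\bot\rangle\langle\bot|)^M$ and $\mathrm{Proj}^M_{rej}:\rho\mapsto|\bot\rangle\langle\bot|^M\rho|\bot\rangle\langle\bot|^M$, the operations induced by projecting on the accepting and rejecting outcomes of decryption. **QCA-R (for such schemes).** Given a completely positive trace-preserving map $\mathcal{A}$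 (the adversary) on $M,T$ and a side-information register $S$, put $$\mathcal{S}_{\mathsf{acc}}[\mathcal{A}]:\rho^S\mapsto\mathbb{E}_{\kappa'}\Big[\langle0^t|^T\langle\Phi^+|^{MM'}\,U_{\kappa'}^\dagger\,\mathcal{A}^{MTS}\big(U_{\kappa'}^{MT}(\rho^S\otimes|\Phi^+\rangle\langle\Phi^+|^{MM'}\otimes|0^t\rangle\langle0^t|^T)U_{\kappa'}^\dagger\big)U_{\kappa'}\,|0^t\rangle|\Phi^+\rangle\Big],$$ where $M'$ is a copy of $M$ and $|\Phi^+\rangle$ is the maximally entangled state (EPR pairs) of $MM'$. The scheme is $\varepsilon$-QCA-R with recycling function $f$ if for every such $\mathcal{A}$ there is a completely positive (CP) map $\mathcal{S}_{\mathsf{rej}}$ on $S$ (the rejecting simulator) with $\mathcal{S}_{\mathsf{acc}}[\mathcal{A}]+\mathcal{S}_{\mathsf{rej}}$ trace preserving, such that the channel $$\rho^{MS}\mapsto\mathbb{E}_\kappa\Big[\mathrm{Proj}^M_{acc}\big(\mathsf{Decrypt}_\kappa\circ\mathcal{A}\circ\mathsf{Encrypt}_\kappa(\rho)\big)\otimes|\kappa\rangle\langle\kappa|+\mathrm{Proj}^M_{rej}\big(\mathsf{Decrypt}_\kappa\circ\mathcal{A}\circ\mathsf{Encrypt}_\kappa(\rho)\big)\otimes|f(\kappa)\rangle\langle f(\kappa)|\Big]$$ is within diamond-norm distance $\varepsilon$ of $$\rho^{MS}\mapsto(\mathbb{I}^M\otimes\mathcal{S}_{\mathsf{acc}}[\mathcal{A}])(\rho)\otimes\mathbb{E}_\kappa[|\kappa\rangle\langle\kappa|]+|\bot\rangle\langle\bot|^M\otimes\mathcal{S}_{\mathsf{rej}}(\mathrm{Tr}_M\rho)\otimes\mathbb{E}_\kappa[|f(\kappa)\rangle\langle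 f(\kappa)|].$$ In the claim, a simulator $\mathcal{S}_{\mathsf{rej}}$ is likewise a CP map on the side-information register $M_1R$ with $\mathcal{S}_{\mathsf{acc}}+\mathcal{S}_{\mathsf{rej}}$ trace preserving. *)

theory Defs
  imports Complex_Main "HOL-Library.Function_Algebras" "HOL-Library.Extended_Real"
begin

text \<open>
  A register is a finite nonempty set of computational basis labels, and a composite register is the
  Cartesian product of its components. Matrices are indexed by labels, not by numbers, so that tensor
  products and maps acting on a single component need no arithmetic on indices. A matrix on the
  register \<open>A\<close> vanishes outside \<open>A \<times> A\<close>. Label types may be infinite, so that the dimension
  of a side-information or ancilla register can be quantified over. Sums and differences of
  matrices, and of maps between matrices, are pointwise.
\<close>

type_synonym ('a, 'b) cmat = "'a \<Rightarrow> 'b \<Rightarrow> complex"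
type_synonym 'a oper = "('a, 'a) cmat"
type_synonym ('a, 'b) omap = "'a oper \<Rightarrow> 'b oper"

definition ops :: "'a set \<Rightarrow> 'a oper set" where
  "ops A = {X. \<forall>a b. X a b \<noteq> 0 \<longrightarrow> a \<in> A \<and> b \<in> A}"

definition scale :: "complex \<Rightarrow> ('a, 'b) cmat \<Rightarrow> ('a, 'b) cmat" where
  "scale c X = (\<lambda>a b. c * X a b)"

definition mmul :: "'b set \<Rightarrow> ('a, 'b) cmat \<Rightarrow> ('b, 'c) cmat \<Rightarrow> ('a, 'c) cmat" where
  "mmul B X Y = (\<lambda>a c. \<Sum>b\<in>B. X a b * Y b c)"

definition adj :: "('a, 'b) cmat \<Rightarrow> ('b, 'a) cmat" where
  "adj X = (\<lambda>b a. cnj (X a b))"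

definition id_op :: "'a set \<Rightarrow> 'a oper" where
  "id_op A = (\<lambda>a b. if a \<in> A \<and> a = b then 1 else 0)"

definition trace :: "'a set \<Rightarrow> 'a oper \<Rightarrow> complex" where
  "trace A X = (\<Sum>a\<in>A. X a a)"

definition unitary_op :: "'a set \<Rightarrow> 'a oper \<Rightarrow> bool" where
  "unitary_op A U \<longleftrightarrow>
     U \<in> ops A \<and> mmul A (adj U) U = id_op A \<and> mmul A U (adj U) = id_op A"

definition ketbra :: "'a \<Rightarrow> 'a oper" where
  "ketbra x = (\<lambda>a b. if a = x \<and> b = x then 1 else 0)"

definition tensor :: "'a oper \<Rightarrow> 'b oper \<Rightarrow> ('a \<times> 'b) oper" where
  "tensor X Y = (\<lambda>(a, b) (a', b'). X a a' * Y b b')"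

definition tr_fst :: "'a set \<Rightarrow> ('a \<times> 'b) oper \<Rightarrow> 'b oper" where
  "tr_fst A X = (\<lambda>b b'. \<Sum>a\<in>A. X (a, b) (a, b'))"

text \<open>\<open>sandwich A U X\<close> is \<open>U X U\<^sup>\<dagger>\<close> for \<open>X\<close> on \<open>A\<close>.\<close>

definition sandwich :: "'a set \<Rightarrow> ('b, 'a) cmat \<Rightarrow> ('a, 'b) omap" where
  "sandwich A U X = mmul A (mmul A U X) (adj U)"

definition avg :: "'k set \<Rightarrow> ('k \<Rightarrow> 'a oper) \<Rightarrow> 'a oper" where
  "avg K F = scale (1 / of_nat (card K)) (\<Sum>\<kappa>\<in>K. F \<kappa>)"

text \<open>
  For linear \<open>\<Phi>\<close> these are \<open>\<Phi> \<otimes> \<I>\<close> and \<open>\<I> \<otimes> \<Phi>\<close>: \<open>\<Phi>\<close> is applied to every block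
  obtained by fixing a pair of labels of the other register.
\<close>

definition on_fst :: "('a, 'b) omap \<Rightarrow> ('a \<times> 'c, 'b \<times> 'c) omap" where
  "on_fst \<Phi> X = (\<lambda>(b, c) (b', c'). \<Phi> (\<lambda>a a'. X (a, c) (a', c')) b b')"

definition on_snd :: "('a, 'b) omap \<Rightarrow> ('c \<times> 'a, 'c \<times> 'b) omap" where
  "on_snd \<Phi> X = (\<lambda>(c, b) (c', b'). \<Phi> (\<lambda>a a'. X (c, a) (c', a')) b b')"

definition psd :: "'a set \<Rightarrow> 'a oper \<Rightarrow> bool" where
  "psd A X \<longleftrightarrow> X \<in> ops A \<and>
     (\<forall>v :: 'a \<Rightarrow> complex.
        (\<Sum>a\<in>A. \<Sum>b\<in>A. cnj (v a) * X a b * v b) \<in> \<real> \<and>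
        0 \<le> Re (\<Sum>a\<in>A. \<Sum>b\<in>A. cnj (v a) * X a b * v b))"

definition density :: "'a set \<Rightarrow> 'a oper \<Rightarrow> bool" where
  "density A \<rho> \<longleftrightarrow> psd A \<rho> \<and> trace A \<rho> = 1"

definition psd_sqrt :: "'a set \<Rightarrow> 'a oper \<Rightarrow> 'a oper" where
  "psd_sqrt A Y = (THE P. psd A P \<and> mmul A P P = Y)"

definition trace_norm :: "'a set \<Rightarrow> 'a oper \<Rightarrow> real" where
  "trace_norm A X = Re (trace A (psd_sqrt A (mmul A (adj X) X)))"

definition linear_omap :: "'a set \<Rightarrow> 'b set \<Rightarrow> ('a, 'b) omap \<Rightarrow> bool" where
  "linear_omap A B \<Phi> \<longleftrightarrow>
     (\<forall>X\<in>ops A. \<Phi> X \<in> ops B) \<and>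
     (\<forall>X\<in>ops A. \<forall>Y\<in>ops A. \<Phi> (X + Y) = \<Phi> X + \<Phi> Y) \<and>
     (\<forall>c. \<forall>X\<in>ops A. \<Phi> (scale c X) = scale c (\<Phi> X))"

definition cp_map :: "'a set \<Rightarrow> 'b set \<Rightarrow> ('a, 'b) omap \<Rightarrow> bool" where
  "cp_map A B \<Phi> \<longleftrightarrow> linear_omap A B \<Phi> \<and>
     (\<forall>d :: nat. \<forall>X. psd ({..<d} \<times> A) X \<longrightarrow> psd ({..<d} \<times> B) (on_snd \<Phi> X))"

definition trace_preserving :: "'a set \<Rightarrow> 'b set \<Rightarrow> ('a, 'b) omap \<Rightarrow> bool" where
  "trace_preserving A B \<Phi> \<longleftrightarrow> (\<forall>X\<in>ops A. trace B (\<Phi> X) = trace A X)"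

definition cptp :: "'a set \<Rightarrow> 'b set \<Rightarrow> ('a, 'b) omap \<Rightarrow> bool" where
  "cptp A B \<Phi> \<longleftrightarrow> cp_map A B \<Phi> \<and> trace_preserving A B \<Phi>"

text \<open>
  The supremum runs over ancillas of every dimension \<open>d \<ge> 1\<close>. It is taken in the extended reals,
  where it exists unconditionally.
\<close>

definition diamond_norm :: "'a set \<Rightarrow> 'b set \<Rightarrow> ('a, 'b) omap \<Rightarrow> ereal" where
  "diamond_norm A B \<Psi> =
     Sup {ereal (trace_norm ({..<d} \<times> B) (on_snd \<Psi> \<rho>)) | (d :: nat) \<rho>.
            1 \<le> d \<and> density ({..<d} \<times> A) \<rho>}"

definition diamond_dist :: "'a set \<Rightarrow> 'b set \<Rightarrow> ('a, 'b) omap \<Rightarrow> ('a, 'b) omap \<Rightarrow> ereal" where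
  "diamond_dist A B \<Psi> \<Psi>' = diamond_norm A B (\<Psi> - \<Psi>') / 2"

type_synonym bits = "bool list"

definition bitstr :: "nat \<Rightarrow> bits set" where
  "bitstr n = {l. length l = n}"

abbreviation zeros :: "nat \<Rightarrow> bits" where
  "zeros n \<equiv> replicate n False"

text \<open>
  The entry in row \<open>a\<close> and column \<open>b\<close> of \<open>\<i>\<^sup>x\<^sup>z X\<^sup>x Z\<^sup>z\<close>, which is
  \<open>I\<close>, \<open>X\<close>, \<open>Z\<close> or \<open>Y\<close>.
\<close>

definition pauli1 :: "bool \<Rightarrow> bool \<Rightarrow> bool oper" where
  "pauli1 x z = (\<lambda>a b.
     if a = (b \<noteq> x) then (if x \<and> z then \<i> else 1) * (if z \<and> b then - 1 else 1) else 0)"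

text \<open>
  The index \<open>l\<close> has length \<open>2 * n\<close>; its first half holds the \<open>X\<close>-exponents and its second
  half the \<open>Z\<close>-exponents of the tensor factors.
\<close>

definition pauli :: "nat \<Rightarrow> bits \<Rightarrow> bits oper" where
  "pauli n l = (\<lambda>a b.
     if a \<in> bitstr n \<and> b \<in> bitstr n
     then \<Prod>j<n. pauli1 (l ! j) (l ! (n + j)) (a ! j) (b ! j) else 0)"

abbreviation cipher :: "nat \<Rightarrow> nat \<Rightarrow> (bits \<times> bits) set" where
  "cipher m t \<equiv> bitstr m \<times> bitstr t"

definition pauli_MT :: "nat \<Rightarrow> nat \<Rightarrow> bits \<Rightarrow> (bits \<times> bits) oper" where
  "pauli_MT m t l = (\<lambda>(a, c) (b, d).
     if (a, c) \<in> cipher m t \<and> (b, d) \<in> cipher m t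
     then pauli (m + t) l (a @ c) (b @ d) else 0)"

definition code_unitary :: "nat \<Rightarrow> nat \<Rightarrow> (bits \<times> bits) oper \<Rightarrow> bool" where
  "code_unitary m t V \<longleftrightarrow> unitary_op (cipher m t) V \<and>
     (\<forall>l\<in>bitstr (2 * (m + t)). \<exists>l'\<in>bitstr (2 * (m + t)). \<exists>\<theta> :: real.
        mmul (cipher m t) (pauli_MT m t l) V
          = scale (cis \<theta>) (mmul (cipher m t) V (pauli_MT m t l')))"

text \<open>Membership, up to a phase, in \<open>\<P>\<^sub>m \<otimes> {I, Z}\<^sup>\<otimes>\<^sup>t\<close>.\<close>

definition undetected :: "nat \<Rightarrow> nat \<Rightarrow> (bits \<times> bits) oper \<Rightarrow> bool" where
  "undetected m t Q \<longleftrightarrow> (\<exists>\<theta> :: real. \<exists>l\<in>bitstr (2 * m). \<exists>z\<in>bitstr t.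
     Q = scale (cis \<theta>) (tensor (pauli m l) (pauli t (zeros t @ z))))"

definition strong_purity_testing ::
    "nat \<Rightarrow> nat \<Rightarrow> 'k set \<Rightarrow> ('k \<Rightarrow> (bits \<times> bits) oper) \<Rightarrow> real \<Rightarrow> bool" where
  "strong_purity_testing m t K0 V \<eta> \<longleftrightarrow>
     (\<forall>k\<in>K0. code_unitary m t (V k)) \<and>
     (\<forall>l\<in>bitstr (2 * (m + t)). pauli_MT m t l \<noteq> id_op (cipher m t) \<longrightarrow>
        real (card {k\<in>K0. undetected m t
            (mmul (cipher m t) (mmul (cipher m t) (adj (V k)) (pauli_MT m t l)) (V k))})
          / real (card K0) \<le> \<eta>)"

type_synonym 'k key = "'k \<times> bits"

abbreviation pads :: "nat \<Rightarrow> nat \<Rightarrow> bits set" where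
  "pads m t \<equiv> bitstr (2 * (m + t))"

definition enc_unitary ::
    "nat \<Rightarrow> nat \<Rightarrow> ('k \<Rightarrow> (bits \<times> bits) oper) \<Rightarrow> 'k key \<Rightarrow> (bits \<times> bits) oper" where
  "enc_unitary m t V \<kappa> = mmul (cipher m t) (pauli_MT m t (snd \<kappa>)) (V (fst \<kappa>))"

definition encrypt ::
    "nat \<Rightarrow> nat \<Rightarrow> ('k \<Rightarrow> (bits \<times> bits) oper) \<Rightarrow> 'k key \<Rightarrow> (bits, bits \<times> bits) omap" where
  "encrypt m t V \<kappa> \<rho> =
     sandwich (cipher m t) (enc_unitary m t V \<kappa>) (tensor \<rho> (ketbra (zeros t)))"

text \<open>Decrypted message register; the label \<open>None\<close> is the reject state.\<close>

definition msg_bot :: "nat \<Rightarrow> bits option set" where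
  "msg_bot m = insert None (Some ` bitstr m)"

definition embed :: "('a, 'a option) omap" where
  "embed X = (\<lambda>a b. case (a, b) of (Some a', Some b') \<Rightarrow> X a' b' | _ \<Rightarrow> 0)"

text \<open>\<open>\<langle>i| X |i\<rangle>\<close>, with the bra and ket on the second register.\<close>

definition bra_ket :: "'t \<Rightarrow> ('a \<times> 't, 'a) omap" where
  "bra_ket i X = (\<lambda>a b. X (a, i) (b, i))"

definition decrypt ::
    "nat \<Rightarrow> nat \<Rightarrow> ('k \<Rightarrow> (bits \<times> bits) oper) \<Rightarrow> 'k key \<Rightarrow> (bits \<times> bits, bits option) omap" where
  "decrypt m t V \<kappa> \<rho> =
     (let \<sigma> = sandwich (cipher m t) (adj (enc_unitary m t V \<kappa>)) \<rho>
      in embed (bra_ket (zeros t) \<sigma>)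
         + scale (trace (bitstr m) (\<Sum>i\<in>bitstr t - {zeros t}. bra_ket i \<sigma>)) (ketbra None))"

definition proj_acc :: "nat \<Rightarrow> (bits option, bits option) omap" where
  "proj_acc m = sandwich (msg_bot m) (id_op (msg_bot m) - ketbra None)"

definition proj_rej :: "nat \<Rightarrow> (bits option, bits option) omap" where
  "proj_rej m = sandwich (msg_bot m) (ketbra None)"

definition max_ent :: "nat \<Rightarrow> bits \<Rightarrow> bits \<Rightarrow> complex" where
  "max_ent m a' a = (if a \<in> bitstr m \<and> a' = a then complex_of_real (1 / sqrt (2 ^ m)) else 0)"

text \<open>
  Registers are ordered as \<open>M' ((M T) S)\<close>. The first map sends \<open>\<rho>\<close> on \<open>S\<close> to
  \<open>|\<Phi>\<^sup>+\<rangle>\<langle>\<Phi>\<^sup>+| \<otimes> |0\<^sup>t\<rangle>\<langle>0\<^sup>t| \<otimes> \<rho>\<close>; the second one sends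
  \<open>X\<close> to \<open>\<langle>0\<^sup>t| \<langle>\<Phi>\<^sup>+| X |0\<^sup>t\<rangle> |\<Phi>\<^sup>+\<rangle>\<close>.
\<close>

definition attach_ent :: "nat \<Rightarrow> nat \<Rightarrow> ('s, bits \<times> ((bits \<times> bits) \<times> 's)) omap" where
  "attach_ent m t \<rho> = (\<lambda>(a', (a, c), s) (b', (b, d), s').
     max_ent m a' a * cnj (max_ent m b' b) * ketbra (zeros t) c d * \<rho> s s')"

definition project_ent :: "nat \<Rightarrow> nat \<Rightarrow> (bits \<times> ((bits \<times> bits) \<times> 's), 's) omap" where
  "project_ent m t X = (\<lambda>s s'.
     \<Sum>a'\<in>bitstr m. \<Sum>a\<in>bitstr m. \<Sum>b'\<in>bitstr m. \<Sum>b\<in>bitstr m.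
       cnj (max_ent m a' a) * X (a', (a, zeros t), s) (b', (b, zeros t), s') * max_ent m b' b)"

text \<open>
  The side-information register may be changed by the adversary from one with labels in
  \<^typ>\<open>'s\<close> to one with labels in \<^typ>\<open>'u\<close>: this is needed when it contains a message register
  that is enlarged by the reject state during decryption.
\<close>

definition acc_sim ::
    "nat \<Rightarrow> nat \<Rightarrow> 'k set \<Rightarrow> ('k \<Rightarrow> (bits \<times> bits) oper) \<Rightarrow>
     ((bits \<times> bits) \<times> 's, (bits \<times> bits) \<times> 'u) omap \<Rightarrow> ('s, 'u) omap" where
  "acc_sim m t K0 V \<A> \<rho> = avg (K0 \<times> pads m t) (\<lambda>\<kappa>.
     let U = enc_unitary m t V \<kappa>;
         \<sigma> = on_snd (on_fst (sandwich (cipher m t) U)) (attach_ent m t \<rho>);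
         \<tau> = on_snd \<A> \<sigma>
     in project_ent m t (on_snd (on_fst (sandwich (cipher m t) (adj U))) \<tau>))"

text \<open>
  The classical key register holds either a full key (\<open>Inl\<close>) or a recycled one (\<open>Inr\<close>).
\<close>

definition reveal_key ::
    "nat \<Rightarrow> ('k key \<Rightarrow> 'f) \<Rightarrow> 'k key \<Rightarrow>
     (bits option \<times> 's, (bits option \<times> 's) \<times> ('k key + 'f)) omap" where
  "reveal_key m f \<kappa> \<sigma> =
     tensor (on_fst (proj_acc m) \<sigma>) (ketbra (Inl \<kappa>))
     + tensor (on_fst (proj_rej m) \<sigma>) (ketbra (Inr (f \<kappa>)))"

definition real_channel ::
    "nat \<Rightarrow> nat \<Rightarrow> 'k set \<Rightarrow> ('k \<Rightarrow> (bits \<times> bits) oper) \<Rightarrow> ('k key \<Rightarrow> 'f) \<Rightarrow>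
     ((bits \<times> bits) \<times> 's, (bits \<times> bits) \<times> 's) omap \<Rightarrow>
     (bits \<times> 's, (bits option \<times> 's) \<times> ('k key + 'f)) omap" where
  "real_channel m t K0 V f \<A> \<rho> = avg (K0 \<times> pads m t) (\<lambda>\<kappa>.
     reveal_key m f \<kappa> (on_fst (decrypt m t V \<kappa>) (\<A> (on_fst (encrypt m t V \<kappa>) \<rho>))))"

definition ideal_channel ::
    "nat \<Rightarrow> ('s, 'u) omap \<Rightarrow> ('s, 'u) omap \<Rightarrow> 'q oper \<Rightarrow> 'q oper \<Rightarrow>
     (bits \<times> 's, (bits option \<times> 'u) \<times> 'q) omap" where
  "ideal_channel m S\<^sub>a\<^sub>c\<^sub>c S\<^sub>r\<^sub>e\<^sub>j key\<^sub>a\<^sub>c\<^sub>c key\<^sub>r\<^sub>e\<^sub>j \<rho> =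
     tensor (on_fst embed (on_snd S\<^sub>a\<^sub>c\<^sub>c \<rho>)) key\<^sub>a\<^sub>c\<^sub>c
     + tensor (tensor (ketbra None) (S\<^sub>r\<^sub>e\<^sub>j (tr_fst (bitstr m) \<rho>))) key\<^sub>r\<^sub>e\<^sub>j"

text \<open>
  Up to relabelling, every finite-dimensional side-information register is a finite nonempty set of
  natural numbers.
\<close>

definition qca_r ::
    "nat \<Rightarrow> nat \<Rightarrow> 'k set \<Rightarrow> ('k \<Rightarrow> (bits \<times> bits) oper) \<Rightarrow> real \<Rightarrow> ('k key \<Rightarrow> 'f) \<Rightarrow> bool" where
  "qca_r m t K0 V \<epsilon> f \<longleftrightarrow>
     (\<forall>S :: nat set. finite S \<longrightarrow> S \<noteq> {} \<longrightarrow>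
       (\<forall>\<A>. cptp (cipher m t \<times> S) (cipher m t \<times> S) \<A> \<longrightarrow>
         (\<exists>S\<^sub>r\<^sub>e\<^sub>j. cp_map S S S\<^sub>r\<^sub>e\<^sub>j \<and>
            trace_preserving S S (acc_sim m t K0 V \<A> + S\<^sub>r\<^sub>e\<^sub>j) \<and>
            diamond_dist (bitstr m \<times> S)
              ((msg_bot m \<times> S) \<times> ((K0 \<times> pads m t) <+> f ` (K0 \<times> pads m t)))
              (real_channel m t K0 V f \<A>)
              (ideal_channel m (acc_sim m t K0 V \<A>) S\<^sub>r\<^sub>e\<^sub>j
                (avg (K0 \<times> pads m t) (\<lambda>\<kappa>. ketbra (Inl \<kappa>)))
                (avg (K0 \<times> pads m t) (\<lambda>\<kappa>. ketbra (Inr (f \<kappa>)))))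
            \<le> ereal \<epsilon>)))"

text \<open>
  Registers are ordered as \<open>M\<^sub>2 (M\<^sub>1 R)\<close>, so that \<open>M\<^sub>1 R\<close> takes the place of the
  side-information register of the second message.
\<close>

definition two_real ::
    "nat \<Rightarrow> nat \<Rightarrow> ('k \<Rightarrow> (bits \<times> bits) oper) \<Rightarrow>
     ((bits \<times> bits) \<times> (bits \<times> bits) \<times> 'r, (bits \<times> bits) \<times> (bits \<times> bits) \<times> 'r) omap \<Rightarrow>
     ((bits \<times> bits) \<times> bits option \<times> 'r, (bits \<times> bits) \<times> bits option \<times> 'r) omap \<Rightarrow>
     'k \<Rightarrow> bits \<Rightarrow> bits \<Rightarrow> (bits \<times> bits \<times> 'r, bits option \<times> bits option \<times> 'r) omap" where
  "two_real m t V \<A>\<^sub>1 \<A>\<^sub>2 k\<^sub>0 k\<^sub>1 k\<^sub>2 =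
     on_fst (decrypt m t V (k\<^sub>0, k\<^sub>2))
     \<circ> \<A>\<^sub>2
     \<circ> on_snd (on_fst (decrypt m t V (k\<^sub>0, k\<^sub>1)))
     \<circ> \<A>\<^sub>1
     \<circ> (on_snd (on_fst (encrypt m t V (k\<^sub>0, k\<^sub>1))) \<circ> on_fst (encrypt m t V (k\<^sub>0, k\<^sub>2)))"

definition two_real_channel ::
    "nat \<Rightarrow> nat \<Rightarrow> 'k set \<Rightarrow> ('k \<Rightarrow> (bits \<times> bits) oper) \<Rightarrow>
     ((bits \<times> bits) \<times> (bits \<times> bits) \<times> 'r, (bits \<times> bits) \<times> (bits \<times> bits) \<times> 'r) omap \<Rightarrow>
     ((bits \<times> bits) \<times> bits option \<times> 'r, (bits \<times> bits) \<times> bits option \<times> 'r) omap \<Rightarrow>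
     (bits \<times> bits \<times> 'r, (bits option \<times> bits option \<times> 'r) \<times> ('k key + 'k)) omap" where
  "two_real_channel m t K0 V \<A>\<^sub>1 \<A>\<^sub>2 \<rho> =
     avg (K0 \<times> pads m t \<times> pads m t) (\<lambda>(k\<^sub>0, k\<^sub>1, k\<^sub>2).
       reveal_key m fst (k\<^sub>0, k\<^sub>2) (two_real m t V \<A>\<^sub>1 \<A>\<^sub>2 k\<^sub>0 k\<^sub>1 k\<^sub>2 \<rho>))"

definition two_ideal_channel ::
    "nat \<Rightarrow> nat \<Rightarrow> 'k set \<Rightarrow>
     (bits \<times> 'r, bits option \<times> 'r) omap \<Rightarrow> (bits \<times> 'r, bits option \<times> 'r) omap \<Rightarrow>
     (bits \<times> bits \<times> 'r, (bits option \<times> bits option \<times> 'r) \<times> ('k key + 'k)) omap" where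
  "two_ideal_channel m t K0 S\<^sub>a\<^sub>c\<^sub>c S\<^sub>r\<^sub>e\<^sub>j =
     ideal_channel m S\<^sub>a\<^sub>c\<^sub>c S\<^sub>r\<^sub>e\<^sub>j
       (avg (K0 \<times> pads m t) (\<lambda>(k\<^sub>0, k\<^sub>2). ketbra (Inl (k\<^sub>0, k\<^sub>2))))
       (avg K0 (\<lambda>k\<^sub>0. ketbra (Inr k\<^sub>0)))"

end

theory Submission
  imports "Jordan_Normal_Form.Spectral_Radius" Defs
begin

text \<open>
  The second ciphertext depends on the recycled code key \<open>k\<^sub>0\<close>, so the security of the first message
  cannot be applied directly with \<open>C\<^sub>2 R\<close> as side information. Encryption of the second message under a
  uniform one-time pad is therefore simulated by teleportation: \<open>C\<^sub>2\<close> becomes half of a maximally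
  entangled pair \<open>C' C\<^sub>2\<close>, and only after the first decryption is \<open>M\<^sub>2 C'\<close> measured in the
  basis of the vectors with coefficients \<open>U\<^sub>\<kappa>(c, (m\<^sub>2, 0))\<close>; the outcome is the pad \<open>k\<^sub>2\<close>.
  Completeness of the Pauli operators makes this a channel that needs nothing but the key revealed after the
  first message. Since the trace norm does not increase under channels, the first real stage may be replaced,
  at the cost \<open>\<epsilon>\<close>, by its ideal version, which passes the first message on or outputs \<open>\<bottom>\<close>.
  Undoing the teleportation leaves a single-message real channel for the second message against the adversary
  that follows the ideal first stage by \<open>\<A>\<^sub>2\<close>, with side information \<open>M\<^sub>1 R\<close>; QCA-R, applied again,
  costs another \<open>\<epsilon>\<close>.
\<close>

section \<open>Spectral decomposition of Hermitian operators\<close>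

text \<open>What lets the argument close is that the recycling function reveals the code key on
  acceptance as well as on rejection, and that in the ideal channel this key is uniform and
  independent of everything else. It can therefore act as a fresh code key for the second message.
  The full diamond norm is needed: in the first application of QCA-R the registers
  \<open>M\<^sub>2 C'\<close> belong to the ancilla, and they are entangled with the adversary's
  \<open>C\<^sub>2\<close>. The constants match without loss: the entangled pair and the measurement
  contribute a factor 1/D each, with D the ciphertext dimension, and there are exactly D^2 pads. For
  a nonempty tag these are more outcomes than dimensions, so the measurement is a generalised one.
  The second adversary returns \<open>M\<^sub>1\<close> enlarged by the reject label, while QCA-R
  speaks of one numbered register, so all constructions must be shown to be natural under padding.
  Finally, the trace norm is given by a definite description of a square root; only a spectral
  theorem makes its monotonicity and triangle inequality available.\<close>

lemma eigenvector_exists: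
  fixes X :: "'a oper"
  assumes A: "finite A" "A \<noteq> {}"
  shows "\<exists>v \<mu>. (\<exists>a\<in>A. v a \<noteq> 0) \<and> (\<forall>a\<in>A. (\<Sum>b\<in>A. X a b * v b) = \<mu> * v a)"
proof -
  define n where "n = card A"
  have n: "n > 0" using A by (simp add: n_def card_gt_0_iff)
  \<comment> \<open>Numbering the labels turns \<open>X\<close> into a matrix of
    \<open>Jordan_Normal_Form\<close>, where a complex matrix of positive dimension has nonempty
    spectrum.\<close>
  obtain e where e: "bij_betw e {..<n} A"
    using ex_bij_betw_nat_finite[OF A(1)] by (auto simp: n_def lessThan_atLeast0)
  define M where "M = mat n n (\<lambda>(i, j). X (e i) (e j))"
  have M: "M \<in> carrier_mat n n" by (simp add: M_def)
  obtain \<mu> w where w: "eigenvector M w \<mu>"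
    using spectrum_non_empty[OF M n] by (auto simp: spectrum_def eigenvalue_def)
  define v where "v = (\<lambda>a. w $ (inv_into {..<n} e a))"
  have ve: "v (e i) = w $ i" if "i < n" for i
    using that e by (simp add: v_def bij_betw_def inv_into_f_f)
  have dw: "dim_vec w = n" using w M by (auto simp: eigenvector_def)
  have "\<exists>i<n. w $ i \<noteq> 0"
    using w M dw by (auto simp: eigenvector_def vec_eq_iff)
  then obtain i where i: "i < n" "w $ i \<noteq> 0" by auto
  have ei: "e i \<in> A" using e i by (auto simp: bij_betw_def)
  have 1: "(\<Sum>b\<in>A. X a b * v b) = \<mu> * v a" if a: "a \<in> A" for a
  proof -
    obtain j where j: "j < n" "a = e j" using a e by (auto simp: bij_betw_def)
    have "(\<Sum>b\<in>A. X a b * v b) = (\<Sum>i<n. X a (e i) * v (e i))"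
      by (rule sum.reindex_bij_betw[OF e, symmetric])
    also have "\<dots> = (M *\<^sub>v w) $ j"
      using j dw by (auto simp: M_def scalar_prod_def ve lessThan_atLeast0)
    also have "\<dots> = \<mu> * v a"
      using w j ve[OF j(1)] dw by (simp add: eigenvector_def)
    finally show ?thesis .
  qed
  show ?thesis
    using ei i ve[of i] 1 by (intro exI[of _ v] exI[of _ \<mu>] conjI bexI[of _ "e i"]) auto
qed

section \<open>Algebra of matrices supported on a label set\<close>

lemma opsD: "X \<in> ops A \<Longrightarrow> a \<notin> A \<or> b \<notin> A \<Longrightarrow> X a b = 0"
  by (auto simp: ops_def)

lemma mmul_assoc: "mmul A (mmul B X Y) Z = mmul B X (mmul A Y Z)"
  by (auto simp: mmul_def fun_eq_iff sum_distrib_left sum_distrib_right mult.assoc intro: sum.swap)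

lemma adj_mmul: "adj (mmul A X Y) = mmul A (adj Y) (adj X)"
  by (auto simp: adj_def mmul_def fun_eq_iff mult.commute)

lemma adj_adj [simp]: "adj (adj X) = X"
  by (simp add: adj_def)

lemma adj_id_op [simp]: "adj (id_op A) = id_op A"
  by (auto simp: adj_def id_op_def fun_eq_iff)

lemma sum_id_op:
  "finite A \<Longrightarrow> (\<Sum>b\<in>A. id_op A a b * f b) = (if a \<in> A then f a else 0)"
  "finite A \<Longrightarrow> (\<Sum>b\<in>A. f b * id_op A b a) = (if a \<in> A then f a else 0)"
  by (cases "a \<in> A"; simp add: id_op_def if_distrib[of "\<lambda>x. x * _"] if_distrib[of "\<lambda>x. _ * x"]
      cong: if_cong conj_cong sum.cong)+

lemma id_op_mmul: "finite A \<Longrightarrow> X \<in> ops A \<Longrightarrow> mmul A (id_op A) X = X"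
  by (auto simp: mmul_def sum_id_op opsD fun_eq_iff)

lemma mmul_id_op: "finite A \<Longrightarrow> X \<in> ops A \<Longrightarrow> mmul A X (id_op A) = X"
  by (auto simp: mmul_def sum_id_op opsD fun_eq_iff)

lemma id_op_ops [simp]: "id_op A \<in> ops A"
  by (auto simp: ops_def id_op_def)

lemma ops_mmul: "X \<in> ops A \<Longrightarrow> Y \<in> ops A \<Longrightarrow> mmul B X Y \<in> ops A"
  by (fastforce simp: mmul_def ops_def elim: sum.not_neutral_contains_not_neutral)

lemma ops_adj: "X \<in> ops A \<Longrightarrow> adj X \<in> ops A"
  by (auto simp: ops_def adj_def)

lemma unitary_op_adj: "unitary_op A U \<Longrightarrow> unitary_op A (adj U)"
  by (auto simp: unitary_op_def ops_adj)

lemma unitary_op_mmul: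
  assumes "finite A" "unitary_op A U" "unitary_op A W"
  shows "unitary_op A (mmul A U W)"
proof -
  have "mmul A (mmul A U W) (adj (mmul A U W)) = mmul A U (mmul A (mmul A W (adj W)) (adj U))"
    by (simp add: adj_mmul mmul_assoc)
  moreover have "mmul A (adj (mmul A U W)) (mmul A U W) = mmul A (adj W) (mmul A (mmul A (adj U) U) W)"
    by (simp add: adj_mmul mmul_assoc)
  ultimately show ?thesis
    using assms by (auto simp: unitary_op_def id_op_mmul mmul_id_op ops_mmul ops_adj)
qed

text \<open>This is the Householder reflection \<open>I - 2 w w* / <w, w>\<close> with
  \<open>w = v - e_a\<close>, which exchanges the unit vector \<open>v\<close> and the basis vector
  of \<open>a\<close>. It does so only when \<open>v a\<close> is real, whence that hypothesis;
  being Hermitian, it is its own inverse.\<close>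

lemma unitary_with_column:
  fixes v :: "'a \<Rightarrow> complex"
  assumes B: "finite B" "a \<in> B" and v: "\<forall>b. b \<notin> B \<longrightarrow> v b = 0"
    and n1: "(\<Sum>b\<in>B. v b * cnj (v b)) = 1" and va: "cnj (v a) = v a"
  shows "\<exists>H. unitary_op B H \<and> adj H = H \<and> (\<forall>b. H b a = v b)"
proof (cases "v a = 1")
  \<comment> \<open>Here \<open>w\<close> would vanish: a unit vector with entry 1 at
    \<open>a\<close> is the basis vector of \<open>a\<close>, and the identity serves.\<close>
  case True
  have "(\<Sum>b\<in>B - {a}. v b * cnj (v b)) = 0"
    using n1 True B by (simp add: sum.remove)
  moreover have "(\<Sum>b\<in>B - {a}. v b * cnj (v b)) = complex_of_real (\<Sum>b\<in>B - {a}. (cmod (v b))\<^sup>2)"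
    by (simp add: complex_norm_square flip: of_real_power)
  ultimately have "(\<Sum>b\<in>B - {a}. (cmod (v b))\<^sup>2) = 0" by (metis of_real_eq_0_iff)
  then have "\<forall>b\<in>B - {a}. v b = 0" using B by (subst (asm) sum_nonneg_eq_0_iff) auto
  then have "id_op B b a = v b" for b using v True B by (auto simp: id_op_def)
  moreover have "unitary_op B (id_op B)"
    using B by (simp add: unitary_op_def id_op_mmul)
  ultimately show ?thesis by (intro exI[of _ "id_op B"]) auto
next
  case False
  define w where "w b = v b - (if b = a then 1 else 0)" for b
  \<comment> \<open>This is \<open>2 / <w, w>\<close>, by the value of \<open><w, w>\<close> found
    below.\<close>
  define c where "c = 1 / (1 - v a)"
  have c: "cnj c = c" "c * (1 - v a) = 1" using False va by (auto simp: c_def)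
  have wB: "w b = 0" if "b \<notin> B" for b using that v B by (auto simp: w_def)
  have ww: "(\<Sum>b\<in>B. w b * cnj (w b)) = 2 * (1 - v a)"
  proof -
    have "(\<Sum>b\<in>B. w b * cnj (w b)) =
        (\<Sum>b\<in>B. v b * cnj (v b) + (if b = a then 1 - 2 * v a else 0))"
      using va by (intro sum.cong) (auto simp: w_def algebra_simps)
    then show ?thesis using n1 B by (simp add: sum.distrib)
  qed
  define H where "H b d = id_op B b d - c * w b * cnj (w d)" for b d
  have HB: "H \<in> ops B" using wB by (auto simp: ops_def H_def id_op_def split: if_splits)
  have aH: "adj H = H" by (auto simp: adj_def H_def fun_eq_iff c id_op_def)
  have HH: "mmul B H H = id_op B"
  proof (intro ext)
    fix x y
    have "mmul B H H x y = (\<Sum>b\<in>B. id_op B x b * id_op B b y) - c * w x * (\<Sum>b\<in>B. cnj (w b) * id_op B b y)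
        - (\<Sum>b\<in>B. id_op B x b * w b) * c * cnj (w y)
        + c * w x * c * cnj (w y) * (\<Sum>b\<in>B. w b * cnj (w b))"
      by (simp add: mmul_def H_def algebra_simps sum.distrib sum_subtractf sum_distrib_left)
    also have "(\<Sum>b\<in>B. id_op B x b * id_op B b y) = id_op B x y"
      using B by (auto simp: sum_id_op) (auto simp: id_op_def)
    also have "(\<Sum>b\<in>B. cnj (w b) * id_op B b y) = cnj (w y)"
      using B wB by (auto simp: sum_id_op)
    also have "(\<Sum>b\<in>B. id_op B x b * w b) = w x"
      using B wB by (auto simp: sum_id_op)
    also have "c * w x * c * cnj (w y) * (\<Sum>b\<in>B. w b * cnj (w b)) = 2 * (c * (1 - v a)) * (c * w x * cnj (w y))"
      unfolding ww by (simp add: algebra_simps)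
    finally show "mmul B H H x y = id_op B x y" by (simp add: c)
  qed
  have Ha: "H b a = v b" for b
  proof -
    have "H b a = id_op B b a + w b * (c * (1 - v a))"
      by (simp add: H_def w_def va algebra_simps)
    then show ?thesis using B by (auto simp: c id_op_def w_def)
  qed
  show ?thesis using HB aH HH Ha by (auto simp: unitary_op_def intro!: exI[of _ H])
qed

definition diag_op :: "'a set \<Rightarrow> ('a \<Rightarrow> real) \<Rightarrow> 'a oper" where
  "diag_op A d = (\<lambda>a b. if a = b \<and> a \<in> A then complex_of_real (d a) else 0)"

lemma mmul_insert:
  "finite A \<Longrightarrow> a \<notin> A \<Longrightarrow> mmul (insert a A) X Y b c = X b a * Y a c + mmul A X Y b c"
  by (simp add: mmul_def)

text \<open>Deflation, by induction on the label set: a reflection \<open>H\<close> moves an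
  eigenvector to the new label \<open>a\<close>, Hermiticity then clears both row and column
  \<open>a\<close> of \<open>H X H\<close> off the diagonal, and the remaining block is diagonalised
  by the induction hypothesis.\<close>

lemma hermitian_spectral:
  fixes X :: "'a oper"
  assumes "finite A" "X \<in> ops A" "adj X = X"
  shows "\<exists>U d. unitary_op A U \<and> X = mmul A (mmul A U (diag_op A d)) (adj U)"
  using assms
proof (induction A arbitrary: X)
  case empty
  then have "X = (\<lambda>_ _. 0)" by (auto simp: ops_def fun_eq_iff)
  moreover have "unitary_op {} (\<lambda>_ _. 0)"
    by (auto simp: unitary_op_def ops_def mmul_def id_op_def)
  ultimately show ?case by (auto simp: mmul_def)
next
  case (insert a A)
  let ?B = "insert a A"
  have fB: "finite ?B" using insert by simp
  obtain v0 \<mu> where v0: "\<exists>b\<in>?B. v0 b \<noteq> 0" "\<forall>b\<in>?B. (\<Sum>c\<in>?B. X b c * v0 c) = \<mu> * v0 b"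
    using eigenvector_exists[of ?B X] fB by auto
  define r where "r = sqrt (\<Sum>b\<in>?B. (cmod (v0 b))\<^sup>2)"
  obtain b0 where b0: "b0 \<in> ?B" "v0 b0 \<noteq> 0" using v0 by auto
  have "(\<Sum>b\<in>?B. (cmod (v0 b))\<^sup>2) > 0"
    using b0 fB by (intro sum_pos2[of _ b0]) auto
  then have r: "r > 0" "r\<^sup>2 = (\<Sum>b\<in>?B. (cmod (v0 b))\<^sup>2)" by (auto simp: r_def)
  \<comment> \<open>A phase that makes the entry of the eigenvector at \<open>a\<close> real, as
    \<open>unitary_with_column\<close> requires.\<close>
  define p where "p = (if v0 a = 0 then 1 else cnj (v0 a) / cmod (v0 a))"
  have p: "p * cnj p = 1"
  proof (cases "v0 a = 0")
    case False
    then have "cmod p = 1" by (simp add: p_def norm_divide)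
    then show ?thesis by (simp flip: complex_norm_square)
  qed (simp add: p_def)
  define v where "v b = (if b \<in> ?B then p * v0 b / r else 0)" for b
  have v1: "(\<Sum>b\<in>?B. v b * cnj (v b)) = 1"
  proof -
    have "(\<Sum>b\<in>?B. v b * cnj (v b)) = (\<Sum>b\<in>?B. (p * cnj p) * (v0 b * cnj (v0 b)) / r\<^sup>2)"
      using r(1) by (intro sum.cong) (auto simp: v_def field_simps power2_eq_square)
    also have "\<dots> = complex_of_real ((\<Sum>b\<in>?B. (cmod (v0 b))\<^sup>2) / r\<^sup>2)"
      unfolding p by (simp add: sum_divide_distrib flip: complex_norm_square)
    also have "\<dots> = 1" using r(1) unfolding r(2)[symmetric] by simp
    finally show ?thesis .
  qed
  have va: "cnj (v a) = v a"
    by (auto simp: v_def p_def mult.commute)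
  have Xv: "(\<Sum>c\<in>?B. X b c * v c) = \<mu> * v b" if "b \<in> ?B" for b
  proof -
    have "(\<Sum>c\<in>?B. X b c * v c) = (\<Sum>c\<in>?B. (X b c * v0 c) * (p / r))"
      by (intro sum.cong) (auto simp: v_def)
    also have "\<dots> = (\<Sum>c\<in>?B. X b c * v0 c) * (p / r)"
      by (rule sum_distrib_right[symmetric])
    also have "\<dots> = \<mu> * v b"
      using that v0(2) by (auto simp: v_def)
    finally show ?thesis .
  qed
  obtain H where H: "unitary_op ?B H" "adj H = H" "\<And>b. H b a = v b"
    using unitary_with_column[OF fB _ _ v1 va] by (auto simp: v_def)
  have HB: "H \<in> ops ?B" and HH: "mmul ?B H H = id_op ?B" using H by (auto simp: unitary_op_def)
  define Y where "Y = mmul ?B H (mmul ?B X H)"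
  have YB: "Y \<in> ops ?B" using HB insert by (auto simp: Y_def intro!: ops_mmul)
  have aY: "adj Y = Y" using insert H by (simp add: Y_def adj_mmul mmul_assoc)
  have Yba: "Y b a = \<mu> * id_op ?B b a" for b
  proof -
    have "Y b a = (\<Sum>c\<in>?B. H b c * (\<Sum>d\<in>?B. X c d * v d))"
      by (simp only: Y_def mmul_def H(3))
    also have "\<dots> = (\<Sum>c\<in>?B. H b c * (\<mu> * H c a))"
      by (intro sum.cong) (auto simp only: Xv H)
    also have "\<dots> = \<mu> * mmul ?B H H b a"
      by (simp only: mmul_def sum_distrib_left mult.left_commute)
    finally show ?thesis by (simp add: HH)
  qed
  have Yab: "Y a b = cnj \<mu> * id_op ?B b a" for b
    using Yba[of b] aY by (metis adj_def complex_cnj_mult id_op_def complex_cnj_one complex_cnj_zero)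
  \<comment> \<open>The corner entry is \<mu> when read from the column and its conjugate when read
    from the row, so \<mu> may enter a real diagonal.\<close>
  have mu: "cnj \<mu> = \<mu>" using Yba[of a] Yab[of a] by (simp add: id_op_def)
  define Y' where "Y' b c = (if b \<in> A \<and> c \<in> A then Y b c else 0)" for b c
  have "Y' \<in> ops A" "adj Y' = Y'"
    using aY by (auto simp: Y'_def ops_def adj_def fun_eq_iff)
  then obtain U' d' where U': "unitary_op A U'" "Y' = mmul A (mmul A U' (diag_op A d')) (adj U')"
    using insert.IH by blast
  have U'A: "U' \<in> ops A" using U' by (simp add: unitary_op_def)
  \<comment> \<open>The direct sum of \<open>U'\<close> and the identity on the label
    \<open>a\<close>.\<close>
  define W where "W = U' + ketbra a"
  define d where "d = d'(a := Re \<mu>)"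
  have W0: "W b a = (if b = a then 1 else 0)" "W a b = (if b = a then 1 else 0)" for b
    using U'A insert by (auto simp: W_def ketbra_def opsD)
  have W1: "W b c = U' b c" if "b \<noteq> a \<or> c \<noteq> a" for b c
    using that by (auto simp: W_def ketbra_def)
  have aW0: "adj W b a = (if b = a then 1 else 0)" "adj W a b = (if b = a then 1 else 0)" for b
    by (auto simp: adj_def W0)
  have WB: "W \<in> ops ?B" using U'A by (auto simp: W_def ops_def ketbra_def split: if_splits)
  have aA: "a \<notin> A" "finite A" using insert by auto
  have uW: "unitary_op ?B W"
    unfolding unitary_op_def
  proof (intro conjI WB ext)
    fix b c
    have "mmul A (adj W) W b c = mmul A (adj U') U' b c" if "b \<noteq> a" "c \<noteq> a"
      using that unfolding mmul_def by (intro sum.cong) (auto simp: adj_def W1)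
    moreover have "mmul A (adj W) W b c = 0" if "b = a \<or> c = a"
      using that aA by (auto simp: mmul_def W0 aW0 intro!: sum.neutral)
    ultimately show "mmul ?B (adj W) W b c = id_op ?B b c"
      using aA U'(1) by (cases "b = a \<or> c = a"; simp add: mmul_insert W0 aW0 unitary_op_def) (auto simp: id_op_def)
  next
    fix b c
    have "mmul A W (adj W) b c = mmul A U' (adj U') b c" if "b \<noteq> a" "c \<noteq> a"
      using that unfolding mmul_def by (intro sum.cong) (auto simp: adj_def W1)
    moreover have "mmul A W (adj W) b c = 0" if "b = a \<or> c = a"
      using that aA by (auto simp: mmul_def W0 aW0 intro!: sum.neutral)
    ultimately show "mmul ?B W (adj W) b c = id_op ?B b c"
      using aA U'(1) by (cases "b = a \<or> c = a"; simp add: mmul_insert W0 aW0 unitary_op_def) (auto simp: id_op_def)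
  qed
  have sum_diag: "mmul C (mmul C Z (diag_op C g)) Z' b c = (\<Sum>i\<in>C. Z b i * g i * Z' i c)"
    if "finite C" for C :: "'a set" and Z Z' g b c
    using that by (simp add: mmul_def diag_op_def if_distrib[of "\<lambda>x. _ * x"] cong: if_cong)
  have YW: "Y = mmul ?B (mmul ?B W (diag_op ?B d)) (adj W)"
  proof (intro ext)
    fix b c
    have *: "mmul ?B (mmul ?B W (diag_op ?B d)) (adj W) b c
       = W b a * \<mu> * adj W a c + (\<Sum>i\<in>A. W b i * d' i * adj W i c)"
    proof -
      have "complex_of_real (d a) = \<mu>" using mu by (simp add: d_def complex_eq_iff)
      moreover have "(\<Sum>i\<in>A. W b i * d i * adj W i c) = (\<Sum>i\<in>A. W b i * d' i * adj W i c)"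
        using aA by (intro sum.cong) (auto simp: d_def)
      ultimately show ?thesis unfolding sum_diag[OF fB] using aA by simp
    qed
    show "Y b c = mmul ?B (mmul ?B W (diag_op ?B d)) (adj W) b c"
    proof (cases "b = a \<or> c = a")
      case True
      have "(\<Sum>i\<in>A. W b i * d' i * adj W i c) = 0"
        using True aA by (intro sum.neutral) (auto simp: W0 aW0 split: if_splits)
      then show ?thesis unfolding * using True by (auto simp: W0 aW0 Yab Yba id_op_def mu)
    next
      case False
      have "(\<Sum>i\<in>A. W b i * d' i * adj W i c) = Y' b c"
        unfolding U'(2) sum_diag[OF aA(2)] using False
        by (intro sum.cong) (auto simp: W1 adj_def)
      moreover have "Y' b c = Y b c" using False YB by (auto simp: Y'_def opsD)
      ultimately show ?thesis unfolding * using False by (simp add: W0)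
    qed
  qed
  have XB: "X \<in> ops ?B" using insert by simp
  have "X = mmul ?B H (mmul ?B Y H)"
  proof -
    have "mmul ?B H (mmul ?B Y H) = mmul ?B (mmul ?B H H) (mmul ?B X (mmul ?B H H))"
      by (simp only: Y_def mmul_assoc)
    then show ?thesis by (simp only: HH id_op_mmul[OF fB] mmul_id_op[OF fB] XB)
  qed
  also have "\<dots> = mmul ?B (mmul ?B (mmul ?B H W) (diag_op ?B d)) (adj (mmul ?B H W))"
    by (simp only: YW mmul_assoc adj_mmul H)
  finally show ?case using unitary_op_mmul[OF fB H(1) uW] by blast
qed

section \<open>Positive operators and the trace norm\<close>

definition qform :: "'a set \<Rightarrow> 'a oper \<Rightarrow> ('a \<Rightarrow> complex) \<Rightarrow> complex" where
  "qform A X v = (\<Sum>a\<in>A. \<Sum>b\<in>A. cnj (v a) * X a b * v b)"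

lemma psd_iff: "psd A X \<longleftrightarrow> X \<in> ops A \<and> (\<forall>v. \<exists>r\<ge>0. qform A X v = complex_of_real r)"
proof -
  have *: "z \<in> \<real> \<and> 0 \<le> Re z \<longleftrightarrow> (\<exists>r\<ge>0. z = complex_of_real r)" for z
    by (auto elim!: Reals_cases)
  show ?thesis by (simp add: psd_def * flip: qform_def)
qed

lemma psd_ops: "psd A X \<Longrightarrow> X \<in> ops A"
  by (simp add: psd_def)

lemma ops_iff: "X \<in> ops A \<longleftrightarrow> (\<forall>a b. a \<notin> A \<or> b \<notin> A \<longrightarrow> X a b = 0)"
  by (auto simp: ops_def)

lemma ops_add: "X \<in> ops A \<Longrightarrow> Y \<in> ops A \<Longrightarrow> X + Y \<in> ops A"
  by (simp add: ops_iff)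

lemma ops_diff: "X \<in> ops A \<Longrightarrow> Y \<in> ops A \<Longrightarrow> X - Y \<in> ops A"
  by (simp add: ops_iff)

lemma ops_scale: "X \<in> ops A \<Longrightarrow> scale c X \<in> ops A"
  by (simp add: ops_iff scale_def)

lemma ops_zero: "0 \<in> ops A"
  by (simp add: ops_def)

lemma ops_sum: "(\<And>i. i \<in> I \<Longrightarrow> X i \<in> ops A) \<Longrightarrow> (\<Sum>i\<in>I. X i) \<in> ops A"
  by (induction I rule: infinite_finite_induct) (auto intro: ops_add ops_zero)

lemma psd_add: "psd A X \<Longrightarrow> psd A Y \<Longrightarrow> psd A (X + Y)"
proof -
  assume *: "psd A X" "psd A Y"
  have "X + Y \<in> ops A" using * by (simp add: psd_ops ops_add)
  moreover have "qform A (X + Y) v = qform A X v + qform A Y v" for v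
    by (simp add: qform_def algebra_simps sum.distrib)
  ultimately show ?thesis using * unfolding psd_iff by (metis add_nonneg_nonneg of_real_add)
qed

lemma psd_scale: "psd A X \<Longrightarrow> c \<ge> 0 \<Longrightarrow> psd A (scale (complex_of_real c) X)"
proof -
  assume *: "psd A X" "c \<ge> 0"
  have "scale (complex_of_real c) X \<in> ops A" using * by (simp add: psd_ops ops_scale)
  moreover have "qform A (scale (complex_of_real c) X) v = complex_of_real c * qform A X v" for v
    by (simp add: qform_def scale_def sum_distrib_left mult_ac)
  ultimately show ?thesis using * unfolding psd_iff by (metis mult_nonneg_nonneg of_real_mult)
qed

lemma psd_zero: "psd A 0"
  by (auto simp: psd_def ops_def)

text \<open>The quadratic form of \<open>K X K*\<close> at \<open>v\<close> is that of
  \<open>X\<close> at \<open>K* v\<close>; the chain of equations only reorders sums.\<close>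

lemma psd_sandwich:
  assumes "psd A X" "\<And>b a. b \<notin> B \<Longrightarrow> K b a = 0"
  shows "psd B (sandwich A K X)"
proof -
  have "sandwich A K X \<in> ops B"
    using assms(2) by (auto simp: ops_iff sandwich_def mmul_def adj_def)
  moreover have "qform B (sandwich A K X) v = qform A X (\<lambda>a. \<Sum>b\<in>B. cnj (K b a) * v b)" for v
  proof -
    have "qform B (sandwich A K X) v =
        (\<Sum>b\<in>B. \<Sum>b'\<in>B. \<Sum>a'\<in>A. \<Sum>a\<in>A. cnj (v b) * K b a * X a a' * cnj (K b' a') * v b')"
      by (simp add: qform_def sandwich_def mmul_def adj_def sum_distrib_left sum_distrib_right mult_ac)
    also have "\<dots> = (\<Sum>b\<in>B. \<Sum>a'\<in>A. \<Sum>b'\<in>B. \<Sum>a\<in>A. cnj (v b) * K b a * X a a' * cnj (K b' a') * v b')"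
      by (intro sum.cong refl sum.swap)
    also have "\<dots> = (\<Sum>b\<in>B. \<Sum>a'\<in>A. \<Sum>a\<in>A. \<Sum>b'\<in>B. cnj (v b) * K b a * X a a' * cnj (K b' a') * v b')"
      by (intro sum.cong refl sum.swap)
    also have "\<dots> = (\<Sum>a'\<in>A. \<Sum>b\<in>B. \<Sum>a\<in>A. \<Sum>b'\<in>B. cnj (v b) * K b a * X a a' * cnj (K b' a') * v b')"
      by (rule sum.swap)
    also have "\<dots> = (\<Sum>a'\<in>A. \<Sum>a\<in>A. \<Sum>b\<in>B. \<Sum>b'\<in>B. cnj (v b) * K b a * X a a' * cnj (K b' a') * v b')"
      by (intro sum.cong refl sum.swap)
    also have "\<dots> = (\<Sum>a\<in>A. \<Sum>a'\<in>A. \<Sum>b\<in>B. \<Sum>b'\<in>B. cnj (v b) * K b a * X a a' * cnj (K b' a') * v b')"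
      by (rule sum.swap)
    also have "\<dots> = qform A X (\<lambda>a. \<Sum>b\<in>B. cnj (K b a) * v b)"
      by (simp add: qform_def sum_distrib_left sum_distrib_right mult_ac)
    finally show ?thesis .
  qed
  ultimately show ?thesis using assms(1) by (auto simp: psd_iff)
qed

lemma qform_two:
  assumes "finite A" "a \<in> A" "b \<in> A" "a \<noteq> b"
  shows "qform A X (\<lambda>c. if c = a then x else if c = b then y else 0)
    = cnj x * X a a * x + cnj x * X a b * y + (cnj y * X b a * x + cnj y * X b b * y)"
proof -
  let ?v = "\<lambda>c. if c = a then x else if c = b then y else 0"
  have *: "(\<Sum>c\<in>A. f c) = f a + f b" if "\<And>c. c \<noteq> a \<Longrightarrow> c \<noteq> b \<Longrightarrow> f c = 0" for f :: "'a \<Rightarrow> complex"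
  proof -
    have "(\<Sum>c\<in>A. f c) = (\<Sum>c\<in>{a, b}. f c)" using assms that by (intro sum.mono_neutral_right) auto
    then show ?thesis using assms by simp
  qed
  have "qform A X ?v = (\<Sum>d\<in>A. cnj (?v a) * X a d * ?v d) + (\<Sum>d\<in>A. cnj (?v b) * X b d * ?v d)"
    unfolding qform_def by (rule *) simp
  also have "\<dots> = cnj (?v a) * X a a * ?v a + cnj (?v a) * X a b * ?v b
      + (cnj (?v b) * X b a * ?v a + cnj (?v b) * X b b * ?v b)"
    by (intro arg_cong2[of _ _ _ _ "(+)"] *) simp_all
  finally show ?thesis using assms(4) by simp
qed

text \<open>\<open>psd\<close> merely asks for a real nonnegative quadratic form. Hermiticity is
  recovered by polarisation, which works because the scalars are complex.\<close>

lemma psd_hermitian: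
  assumes "finite A" "psd A X"
  shows "adj X = X"
proof (intro ext)
  fix b a
  have q: "Im (qform A X v) = 0" for v
    using assms by (auto simp: psd_iff) (metis Im_complex_of_real)
  have X: "X \<in> ops A" using assms by (simp add: psd_ops)
  have d: "Im (X a a) = 0" if "a \<in> A" for a
  proof -
    have "qform A X (\<lambda>c. if c = a then 1 else 0) = X a a"
      using that assms by (simp add: qform_def if_distrib[of "\<lambda>x. _ * x"] if_distrib[of "\<lambda>x. x * _"]
          if_distrib[of cnj] cong: if_cong)
    then show ?thesis using q by metis
  qed
  show "adj X b a = X b a"
  proof (cases "a \<in> A \<and> b \<in> A \<and> a \<noteq> b")
    case True
    \<comment> \<open>The vectors \<open>e_a + e_b\<close> and, next, \<open>e_a + \<i> e_b\<close>
      show that the imaginary parts of the two entries are opposite and the real parts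
      equal.\<close>
    have 1: "Im (X a b + X b a) = 0"
      using q[of "\<lambda>c. if c = a then 1 else if c = b then 1 else 0"] d[of a] d[of b] True assms
      by (subst (asm) qform_two) auto
    have 2: "Im (X a b * \<i> - \<i> * X b a) = 0"
      using q[of "\<lambda>c. if c = a then 1 else if c = b then \<i> else 0"] d[of a] d[of b] True assms
      by (subst (asm) qform_two) auto
    show ?thesis using 1 2 by (simp add: adj_def complex_eq_iff)
  next
    case False
    show ?thesis
    proof (cases "a \<in> A \<and> b \<in> A")
      case True
      then show ?thesis using False d[of a] by (simp add: adj_def complex_eq_iff)
    next
      case False
      then show ?thesis using X by (auto simp: adj_def opsD)
    qed
  qed
qed

section \<open>Trace, diagonal operators and unitary conjugation\<close>

lemma trace_cyclic: "trace A (mmul B X Y) = trace B (mmul A Y X)"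
  by (simp add: trace_def mmul_def sum.swap[of _ B A] mult.commute)

lemma mmul_diff_left: "mmul A (X - Y) Z = mmul A X Z - mmul A Y Z"
  by (simp add: mmul_def fun_eq_iff algebra_simps sum_subtractf)

lemma mmul_diff_right: "mmul A Z (X - Y) = mmul A Z X - mmul A Z Y"
  by (simp add: mmul_def fun_eq_iff algebra_simps sum_subtractf)

lemma trace_add: "trace A (X + Y) = trace A X + trace A Y"
  by (simp add: trace_def sum.distrib)

lemma trace_scale: "trace A (scale c X) = c * trace A X"
  by (simp add: trace_def scale_def sum_distrib_left)

lemma trace_sum: "trace A (\<Sum>i\<in>I. X i) = (\<Sum>i\<in>I. trace A (X i))"
  by (induction I rule: infinite_finite_induct) (auto simp: trace_add trace_def)

lemma ops_diag [simp]: "diag_op A d \<in> ops A"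
  by (auto simp: ops_def diag_op_def)

lemma mmul_diag_left: "finite A \<Longrightarrow> mmul A (diag_op A d) Z i j = (if i \<in> A then d i * Z i j else 0)"
  by (simp add: mmul_def diag_op_def if_distrib[of "\<lambda>x. x * _"] cong: if_cong conj_cong)

lemma mmul_diag_right: "finite A \<Longrightarrow> mmul A Z (diag_op A d) i j = (if j \<in> A then Z i j * d j else 0)"
  by (simp add: mmul_def diag_op_def if_distrib[of "\<lambda>x. _ * x"] cong: if_cong conj_cong)

lemma psd_diag:
  assumes "finite A" "\<And>i. i \<in> A \<Longrightarrow> d i \<ge> 0"
  shows "psd A (diag_op A d)"
proof -
  have "qform A (diag_op A d) v = complex_of_real (\<Sum>a\<in>A. d a * (cmod (v a))\<^sup>2)" for v
  proof -
    have "qform A (diag_op A d) v = (\<Sum>a\<in>A. cnj (v a) * d a * v a)"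
      using assms by (simp add: qform_def diag_op_def if_distrib[of "\<lambda>x. x * _"]
        if_distrib[of "\<lambda>x. _ * x"] cong: if_cong)
    also have "\<dots> = (\<Sum>a\<in>A. complex_of_real (d a) * (v a * cnj (v a)))"
      by (simp add: mult_ac)
    finally show ?thesis by (simp flip: complex_norm_square)
  qed
  moreover have "(\<Sum>a\<in>A. d a * (cmod (v a))\<^sup>2) \<ge> 0" for v
    using assms by (intro sum_nonneg) auto
  ultimately show ?thesis unfolding psd_iff by (metis ops_diag)
qed

abbreviation conj_diag :: "'a set \<Rightarrow> 'a oper \<Rightarrow> ('a \<Rightarrow> real) \<Rightarrow> 'a oper" where
  "conj_diag A U d \<equiv> mmul A (mmul A U (diag_op A d)) (adj U)"

lemma conj_diag_id:
  assumes "finite A" "unitary_op A U"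
  shows "mmul A (adj U) (mmul A U Z) = mmul A (id_op A) Z" "mmul A U (mmul A (adj U) Z) = mmul A (id_op A) Z"
  using assms by (simp_all add: unitary_op_def flip: mmul_assoc)

lemma unitary_ops: "unitary_op A U \<Longrightarrow> U \<in> ops A"
  by (simp add: unitary_op_def)

lemma psd_conj_diag:
  assumes "finite A" "unitary_op A U" "\<And>i. i \<in> A \<Longrightarrow> d i \<ge> 0"
  shows "psd A (conj_diag A U d)"
  using psd_sandwich[OF psd_diag[of A d], of A U] assms unitary_ops[OF assms(2)]
  by (auto simp: sandwich_def opsD)

lemma trace_conj_diag:
  assumes "finite A" "unitary_op A U"
  shows "trace A (conj_diag A U d) = (\<Sum>i\<in>A. complex_of_real (d i))"
proof -
  have "trace A (conj_diag A U d) = trace A (mmul A (adj U) (mmul A U (diag_op A d)))"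
    by (rule trace_cyclic)
  also have "\<dots> = trace A (diag_op A d)"
    using assms by (simp only: conj_diag_id id_op_mmul ops_diag)
  finally have "trace A (conj_diag A U d) = trace A (diag_op A d)" .
  then show ?thesis by (simp add: trace_def diag_op_def)
qed

lemma conj_diag_square:
  assumes "finite A" "unitary_op A U"
  shows "mmul A (conj_diag A U d) (conj_diag A U d) = conj_diag A U (\<lambda>i. d i * d i)"
proof -
  have "mmul A (conj_diag A U d) (conj_diag A U d) = mmul A U (mmul A (mmul A (diag_op A d) (diag_op A d)) (adj U))"
    using assms unitary_ops[OF assms(2)]
    by (simp add: mmul_assoc conj_diag_id) (simp add: id_op_mmul ops_adj ops_mmul)
  also have "mmul A (diag_op A d) (diag_op A d) = diag_op A (\<lambda>i. d i * d i)"
    using assms by (auto simp: fun_eq_iff mmul_diag_left) (auto simp: diag_op_def)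
  finally show ?thesis by (simp add: mmul_assoc)
qed

text \<open>The entry is the quadratic form of \<open>P\<close> at column \<open>i\<close> of
  \<open>U\<close>.\<close>

lemma diag_entry:
  assumes "finite A" "psd A P" "i \<in> A"
  shows "\<exists>r\<ge>0. mmul A (adj U) (mmul A P U) i i = complex_of_real r"
proof -
  have "mmul A (adj U) (mmul A P U) i i = qform A P (\<lambda>a. U a i)"
    by (simp add: qform_def mmul_def adj_def sum_distrib_left mult_ac)
  then show ?thesis using assms by (simp add: psd_iff)
qed

lemma conj_diag_undo:
  assumes "finite A" "unitary_op A U"
  shows "mmul A (adj U) (mmul A (conj_diag A U d) U) = diag_op A d"
  using assms unitary_ops[OF assms(2)]
  by (simp add: mmul_assoc conj_diag_id) (simp add: unitary_op_def id_op_mmul mmul_id_op ops_mmul)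

lemma psd_spectral:
  assumes "finite A" "psd A P"
  obtains U d where "unitary_op A U" "P = conj_diag A U d" "\<And>i. i \<in> A \<Longrightarrow> d i \<ge> 0"
proof -
  obtain U d where Ud: "unitary_op A U" "P = conj_diag A U d"
    using hermitian_spectral[OF assms(1) psd_ops[OF assms(2)] psd_hermitian[OF assms]] by blast
  have "d i \<ge> 0" if i: "i \<in> A" for i
  proof -
    obtain r where "r \<ge> 0" "diag_op A d i i = complex_of_real r"
      using diag_entry[OF assms i, of U] conj_diag_undo[OF assms(1) Ud(1), of d] Ud(2) by auto
    then show ?thesis using i by (simp add: diag_op_def)
  qed
  then show ?thesis using that Ud by blast
qed

text \<open>In eigenbases of \<open>P\<close> and \<open>Q\<close> with overlap matrix \<open>T\<close>, equality of the squares reads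
  \<open>p\<^sub>i\<^sup>2 T\<^sub>i\<^sub>j = T\<^sub>i\<^sub>j q\<^sub>j\<^sup>2\<close>, and the exponents can be dropped.\<close>

lemma psd_sqrt_unique:
  assumes A: "finite A" and PQ: "psd A P" "psd A Q" "mmul A P P = mmul A Q Q"
  shows "P = Q"
proof -
  obtain U p where U: "unitary_op A U" "P = conj_diag A U p" "\<And>i. i \<in> A \<Longrightarrow> p i \<ge> 0"
    using psd_spectral[OF A PQ(1)] by blast
  obtain W q where W: "unitary_op A W" "Q = conj_diag A W q" "\<And>i. i \<in> A \<Longrightarrow> q i \<ge> 0"
    using psd_spectral[OF A PQ(2)] by blast
  define T where "T = mmul A (adj U) W"
  have UW: "U \<in> ops A" "W \<in> ops A" using U W unitary_ops by auto
  have T: "T \<in> ops A" using UW by (auto simp: T_def intro!: ops_mmul ops_adj)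
  have left: "mmul A (adj U) (mmul A (conj_diag A U d) W) = mmul A (diag_op A d) T" for d
    using A U(1) by (simp add: mmul_assoc conj_diag_id) (simp add: id_op_mmul ops_mmul ops_adj UW T_def)
  have right: "mmul A (adj U) (mmul A (conj_diag A W d) W) = mmul A T (diag_op A d)" for d
    using A W(1) by (simp add: mmul_assoc T_def) (simp add: unitary_op_def mmul_id_op)
  have "mmul A (diag_op A (\<lambda>i. p i * p i)) T = mmul A T (diag_op A (\<lambda>i. q i * q i))"
    unfolding left[symmetric] right[symmetric] using PQ(3) A U(1,2) W(1,2) by (simp add: conj_diag_square)
  then have sq: "complex_of_real (p i * p i) * T i j = T i j * complex_of_real (q j * q j)"
    if "i \<in> A" "j \<in> A" for i j
    using that A by (metis (no_types, lifting) mmul_diag_left mmul_diag_right)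
  have "p i * T i j = T i j * q j" if "i \<in> A" "j \<in> A" for i j
  proof (cases "T i j = 0")
    case False
    then have "complex_of_real (p i * p i) = complex_of_real (q j * q j)"
      using sq[OF that] by simp
    then have "p i * p i = q j * q j" unfolding of_real_eq_iff .
    then have "p i = q j" using U(3)[OF that(1)] W(3)[OF that(2)]
      by (metis real_sqrt_abs2 abs_of_nonneg)
    then show ?thesis by simp
  qed simp
  then have *: "mmul A (diag_op A p) T = mmul A T (diag_op A q)"
    using T A by (auto simp: fun_eq_iff mmul_diag_left mmul_diag_right opsD)
  have "P = mmul A U (mmul A (mmul A (diag_op A p) T) (adj W))"
    using A U W(1) UW by (simp add: mmul_assoc T_def)
      (simp add: unitary_op_def mmul_id_op ops_adj ops_mmul)
  also have "\<dots> = Q"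
    unfolding * using A U(1) W(2) UW by (simp add: mmul_assoc T_def conj_diag_id)
      (simp add: id_op_mmul ops_mmul ops_adj)
  finally show ?thesis .
qed

section \<open>The trace norm of Hermitian operators\<close>

lemma psd_sqrt_eq: "finite A \<Longrightarrow> psd A P \<Longrightarrow> psd_sqrt A (mmul A P P) = P"
  unfolding psd_sqrt_def using psd_sqrt_unique by (intro the_equality) auto

text \<open>The definite description in \<open>psd_sqrt\<close> is evaluated here: replacing the
  eigenvalues by their absolute values gives a positive root of \<open>X* X\<close>, and positive
  roots are unique.\<close>

lemma trace_norm_conj_diag:
  assumes "finite A" "unitary_op A U"
  shows "trace_norm A (conj_diag A U d) = (\<Sum>i\<in>A. \<bar>d i\<bar>)"
proof -
  have "adj (conj_diag A U d) = conj_diag A U d"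
    by (simp add: adj_mmul mmul_assoc) (rule arg_cong[of _ _ "\<lambda>D. mmul A U (mmul A D (adj U))"],
        auto simp: adj_def diag_op_def fun_eq_iff)
  then have "mmul A (adj (conj_diag A U d)) (conj_diag A U d)
      = mmul A (conj_diag A U (\<lambda>i. \<bar>d i\<bar>)) (conj_diag A U (\<lambda>i. \<bar>d i\<bar>))"
    using assms by (simp add: conj_diag_square)
  then have "trace_norm A (conj_diag A U d) = Re (trace A (conj_diag A U (\<lambda>i. \<bar>d i\<bar>)))"
    unfolding trace_norm_def using assms by (simp add: psd_sqrt_eq psd_conj_diag)
  then show ?thesis using assms by (simp add: trace_conj_diag)
qed

text \<open>Positive and negative eigenvalues are separated. With \<open>trace_norm_le\<close> this
  says that the trace norm is the least \<open>tr P + tr N\<close> over all ways of writing the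
  operator as a difference of positive ones; the later properties of the norm rest on this
  description.\<close>

lemma jordan_decomposition:
  assumes "finite A" "X \<in> ops A" "adj X = X"
  obtains P N where "psd A P" "psd A N" "X = P - N"
    "trace_norm A X = Re (trace A P) + Re (trace A N)"
proof -
  obtain U d where Ud: "unitary_op A U" "X = conj_diag A U d"
    using hermitian_spectral[OF assms] by blast
  let ?p = "\<lambda>i. max (d i) 0" and ?n = "\<lambda>i. max (- d i) 0"
  have "psd A (conj_diag A U ?p)" "psd A (conj_diag A U ?n)"
    using assms Ud by (auto intro: psd_conj_diag)
  moreover have "X = conj_diag A U ?p - conj_diag A U ?n"
  proof -
    have "diag_op A d = diag_op A ?p - diag_op A ?n"
      by (auto simp: diag_op_def fun_eq_iff max_def)
    then show ?thesis unfolding Ud(2)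
      by (simp add: mmul_diff_left mmul_diff_right)
  qed
  moreover have "trace_norm A X = Re (trace A (conj_diag A U ?p)) + Re (trace A (conj_diag A U ?n))"
    unfolding Ud(2) trace_norm_conj_diag[OF assms(1) Ud(1)] trace_conj_diag[OF assms(1) Ud(1)]
  proof -
    have "\<bar>x\<bar> = max x 0 + max (- x) 0" for x :: real by simp
    then show "(\<Sum>i\<in>A. \<bar>d i\<bar>) = Re (\<Sum>i\<in>A. complex_of_real (?p i)) + Re (\<Sum>i\<in>A. complex_of_real (?n i))"
      by (simp add: sum.distrib)
  qed
  ultimately show ?thesis using that by blast
qed

text \<open>In an eigenbasis of \<open>P - N\<close> each eigenvalue is the difference of a diagonal
  entry of \<open>P\<close> and one of \<open>N\<close>, both nonnegative, so its absolute value is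
  at most their sum.\<close>

lemma trace_norm_le:
  assumes "finite A" "psd A P" "psd A N"
  shows "trace_norm A (P - N) \<le> Re (trace A P) + Re (trace A N)"
proof -
  have "P - N \<in> ops A" using assms by (simp add: psd_ops ops_diff)
  moreover have "adj (P - N) = P - N"
    using psd_hermitian[OF assms(1,2)] psd_hermitian[OF assms(1,3)] by (auto simp: adj_def fun_eq_iff)
  ultimately obtain U d where Ud: "unitary_op A U" "P - N = conj_diag A U d"
    using hermitian_spectral[OF assms(1)] by blast
  let ?e = "\<lambda>Z. mmul A (adj U) (mmul A Z U)"
  have tr: "trace A (?e Z) = trace A Z" if "psd A Z" for Z
    using assms Ud(1) psd_ops[OF that]
    by (simp add: trace_cyclic[of A A "adj U"] mmul_assoc) (simp add: unitary_op_def mmul_id_op)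
  have "\<bar>d i\<bar> \<le> Re (?e P i i) + Re (?e N i i)" if i: "i \<in> A" for i
  proof -
    obtain p n where pn: "p \<ge> 0" "?e P i i = complex_of_real p" "n \<ge> 0" "?e N i i = complex_of_real n"
      using diag_entry[OF assms(1,2) i, of U] diag_entry[OF assms(1,3) i, of U] by auto
    have "complex_of_real (d i) = ?e (P - N) i i"
      unfolding Ud(2) conj_diag_undo[OF assms(1) Ud(1)] using i by (simp add: diag_op_def)
    also have "\<dots> = ?e P i i - ?e N i i"
      by (simp add: mmul_def algebra_simps sum_subtractf)
    also have "\<dots> = complex_of_real (p - n)" by (simp add: pn)
    finally have "d i = p - n" by (simp only: of_real_eq_iff)
    then show ?thesis using pn by simp
  qed
  then have "(\<Sum>i\<in>A. \<bar>d i\<bar>) \<le> (\<Sum>i\<in>A. Re (?e P i i) + Re (?e N i i))"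
    by (rule sum_mono)
  also have "\<dots> = Re (trace A (?e P)) + Re (trace A (?e N))"
    by (simp add: trace_def sum.distrib)
  finally show ?thesis
    unfolding Ud(2) trace_norm_conj_diag[OF assms(1) Ud(1)] using assms by (simp add: tr)
qed

text \<open>Adding the Jordan decompositions of \<open>X - Y\<close> and \<open>Y - Z\<close>
  decomposes \<open>X - Z\<close>, perhaps not optimally, and \<open>trace_norm_le\<close> needs no
  more.\<close>

lemma trace_norm_triangle:
  assumes "finite A" "psd A X" "psd A Y" "psd A Z"
  shows "trace_norm A (X - Z) \<le> trace_norm A (X - Y) + trace_norm A (Y - Z)"
proof -
  have *: "W - W' \<in> ops A" "adj (W - W') = W - W'" if "psd A W" "psd A W'" for W W'
    using that psd_hermitian[OF assms(1) that(1)] psd_hermitian[OF assms(1) that(2)]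
    by (auto simp: psd_ops ops_diff) (auto simp: adj_def fun_eq_iff)
  obtain P N where 1: "psd A P" "psd A N" "X - Y = P - N"
      "trace_norm A (X - Y) = Re (trace A P) + Re (trace A N)"
    using jordan_decomposition[OF assms(1) *[OF assms(2,3)]] by blast
  obtain P' N' where 2: "psd A P'" "psd A N'" "Y - Z = P' - N'"
      "trace_norm A (Y - Z) = Re (trace A P') + Re (trace A N')"
    using jordan_decomposition[OF assms(1) *[OF assms(3,4)]] by blast
  have "X - Z = (P + P') - (N + N')" using 1(3) 2(3)
    by (metis (no_types) add_diff_add diff_add_cancel add_diff_eq)
  then have "trace_norm A (X - Z) \<le> Re (trace A (P + P')) + Re (trace A (N + N'))"
    using 1 2 assms by (auto intro!: trace_norm_le psd_add)
  then show ?thesis using 1 2 by (simp add: trace_add)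
qed

section \<open>Completely positive maps\<close>

text \<open>Conjugation by the 0/1 matrix of \<open>f\<close> restricted to \<open>B\<close>.
  Relabellings, embeddings, coordinate projections and the copying of basis labels all have this
  form, so their complete positivity is proved once.\<close>

definition pull :: "'b set \<Rightarrow> ('b \<Rightarrow> 'a) \<Rightarrow> ('a, 'b) omap" where
  "pull B f X = (\<lambda>b b'. if b \<in> B \<and> b' \<in> B then X (f b) (f b') else 0)"

lemma pull_sandwich:
  assumes "finite A" "f ` B \<subseteq> A"
  shows "pull B f X = sandwich A (\<lambda>b a. if b \<in> B \<and> a = f b then 1 else 0) X"
proof (intro ext)
  fix b b'
  show "pull B f X b b' = sandwich A (\<lambda>b a. if b \<in> B \<and> a = f b then 1 else 0) X b b'"
    using assms by (cases "b \<in> B"; cases "b' \<in> B")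
      (auto simp: pull_def sandwich_def mmul_def adj_def if_distrib[of cnj] if_distrib[of "\<lambda>x. x * _"]
        if_distrib[of "\<lambda>x. _ * x"] image_subset_iff cong: if_cong)
qed

lemma psd_pull: "finite A \<Longrightarrow> f ` B \<subseteq> A \<Longrightarrow> psd A X \<Longrightarrow> psd B (pull B f X)"
  by (simp add: pull_sandwich psd_sandwich)

lemma psd_reindex:
  assumes "finite A" "\<And>b. f b \<in> A \<longleftrightarrow> b \<in> B" "psd A X"
  shows "psd B (\<lambda>b b'. X (f b) (f b'))"
proof -
  have "pull B f X = (\<lambda>b b'. X (f b) (f b'))"
    using assms psd_ops[OF assms(3)] by (auto simp: pull_def fun_eq_iff opsD)
  then show ?thesis using psd_pull[OF assms(1) _ assms(3), of f B] assms(2) by auto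
qed

lemma linear_omapD:
  assumes "linear_omap A B \<Phi>"
  shows "X \<in> ops A \<Longrightarrow> \<Phi> X \<in> ops B"
    and "X \<in> ops A \<Longrightarrow> Y \<in> ops A \<Longrightarrow> \<Phi> (X + Y) = \<Phi> X + \<Phi> Y"
    and "X \<in> ops A \<Longrightarrow> \<Phi> (scale c X) = scale c (\<Phi> X)"
  using assms by (auto simp: linear_omap_def)

lemma scale_apply: "scale c X a b = c * X a b"
  by (simp add: scale_def)

lemma scale_add: "scale c (X + Y) = scale c X + scale c Y"
  by (simp add: scale_def fun_eq_iff algebra_simps)

lemma scale_scale: "scale c (scale d X) = scale (c * d) X"
  by (simp add: scale_def mult.assoc)

lemma scale_zero [simp]: "scale 0 X = 0"
  by (simp add: scale_def fun_eq_iff)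

lemma linear_omap_zero: "linear_omap A B \<Phi> \<Longrightarrow> \<Phi> 0 = 0"
  using linear_omapD(3)[of A B \<Phi> 0 0] by (simp add: ops_zero)

lemma linear_omap_sum:
  assumes "linear_omap A B \<Phi>" "\<And>i. i \<in> I \<Longrightarrow> X i \<in> ops A"
  shows "\<Phi> (\<Sum>i\<in>I. X i) = (\<Sum>i\<in>I. \<Phi> (X i))"
  using assms(2)
  by (induction I rule: infinite_finite_induct)
    (auto simp: linear_omap_zero[OF assms(1)] linear_omapD(2)[OF assms(1)] ops_sum)

lemma linear_omap_diff:
  assumes "linear_omap A B \<Phi>" "X \<in> ops A" "Y \<in> ops A"
  shows "\<Phi> (X - Y) = \<Phi> X - \<Phi> Y"
proof -
  have "\<Phi> (X - Y) + \<Phi> Y = \<Phi> X"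
    using assms by (simp flip: linear_omapD(2)[OF assms(1)] add: ops_diff)
  then show ?thesis by (simp add: eq_diff_eq)
qed

section \<open>Maps applied to one factor of a composite register\<close>

definition block :: "'c \<Rightarrow> 'c \<Rightarrow> ('c \<times> 'a) oper \<Rightarrow> 'a oper" where
  "block c c' X = (\<lambda>a a'. X (c, a) (c', a'))"

lemma on_snd_apply: "on_snd \<Phi> X (c, b) (c', b') = \<Phi> (block c c' X) b b'"
  by (simp add: on_snd_def block_def)

lemma on_fst_apply: "on_fst \<Phi> X (b, c) (b', c') = \<Phi> (\<lambda>a a'. X (a, c) (a', c')) b b'"
  by (simp add: on_fst_def)

lemma block_ops: "X \<in> ops (E \<times> A) \<Longrightarrow> block c c' X \<in> ops A"
  by (auto simp: block_def ops_iff)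

lemma block_zero: "X \<in> ops (E \<times> A) \<Longrightarrow> c \<notin> E \<or> c' \<notin> E \<Longrightarrow> block c c' X = 0"
  by (auto simp: block_def ops_iff fun_eq_iff)

lemma on_snd_ops:
  assumes "linear_omap A B \<Phi>" "X \<in> ops (E \<times> A)"
  shows "on_snd \<Phi> X \<in> ops (E \<times> B)"
  unfolding ops_iff
proof (intro allI impI)
  fix x y :: "'c \<times> 'b" assume *: "x \<notin> E \<times> B \<or> y \<notin> E \<times> B"
  obtain c b c' b' where [simp]: "x = (c, b)" "y = (c', b')" by (cases x; cases y)
  have "\<Phi> (block c c' X) \<in> ops B"
    by (rule linear_omapD(1)[OF assms(1) block_ops[OF assms(2)]])
  moreover have "\<Phi> (block c c' X) = 0" if "c \<notin> E \<or> c' \<notin> E"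
    using block_zero[OF assms(2) that] linear_omap_zero[OF assms(1)] by simp
  ultimately show "on_snd \<Phi> X x y = 0" using * by (auto simp: on_snd_apply opsD)
qed

lemma cp_linear: "cp_map A B \<Phi> \<Longrightarrow> linear_omap A B \<Phi>"
  by (simp add: cp_map_def)

text \<open>Complete positivity is stated for ancillas labelled by \<open>{..<d}\<close>; a bijective change of the
  ancilla labels commutes with \<open>\<I> \<otimes> \<Phi>\<close> and so transfers it to every finite ancilla.\<close>

lemma on_snd_relabel:
  assumes \<Phi>: "linear_omap A B \<Phi>" and X: "X \<in> ops (E \<times> A)"
    and eg: "\<And>c. c \<in> E \<Longrightarrow> g c \<in> D \<and> e (g c) = c"
  shows "on_snd \<Phi> X = pull (E \<times> B) (\<lambda>(c, b). (g c, b)) (on_snd \<Phi> (pull (D \<times> A) (\<lambda>(i, a). (e i, a)) X))"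
proof (intro ext)
  let ?X = "pull (D \<times> A) (\<lambda>(i, a). (e i, a)) X"
  have blk: "block (g c) (g c') ?X = block c c' X" if "c \<in> E" "c' \<in> E" for c c'
    using that eg X by (auto simp: block_def pull_def fun_eq_iff opsD)
  fix x y :: "'c \<times> 'b"
  obtain c b c' b' where [simp]: "x = (c, b)" "y = (c', b')" by (cases x; cases y)
  show "on_snd \<Phi> X x y = pull (E \<times> B) (\<lambda>(c, b). (g c, b)) (on_snd \<Phi> ?X) x y"
    using on_snd_ops[OF \<Phi> X]
    by (auto simp: pull_def[of "E \<times> B"] on_snd_apply[of _ ?X] opsD blk) (auto simp: on_snd_apply)
qed

lemma obtain_labels:
  assumes "finite E"
  obtains e g where "bij_betw e {..<card E} E" "bij_betw g E {..<card E}"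
    "\<And>c. c \<in> E \<Longrightarrow> g c \<in> {..<card E} \<and> e (g c) = c"
proof -
  obtain e where e: "bij_betw e {..<card E} E"
    using ex_bij_betw_nat_finite[OF assms] by (auto simp: lessThan_atLeast0)
  define g where "g = inv_into {..<card E} e"
  have g: "bij_betw g E {..<card E}" unfolding g_def by (rule bij_betw_inv_into[OF e])
  have "g c \<in> {..<card E} \<and> e (g c) = c" if "c \<in> E" for c
    using bij_betwE[OF g] bij_betw_inv_into_right[OF e that] that by (simp add: g_def)
  then show ?thesis using that e g by blast
qed

lemma psd_on_snd:
  assumes A: "finite A" "finite B" and E: "finite E" and \<Phi>: "cp_map A B \<Phi>" and X: "psd (E \<times> A) X"
  shows "psd (E \<times> B) (on_snd \<Phi> X)"
proof -
  obtain e g where e: "bij_betw e {..<card E} E" and g: "bij_betw g E {..<card E}"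
    and eg: "\<And>c. c \<in> E \<Longrightarrow> g c \<in> {..<card E} \<and> e (g c) = c"
    using obtain_labels[OF E] by blast
  have "psd ({..<card E} \<times> A) (pull ({..<card E} \<times> A) (\<lambda>(i, a). (e i, a)) X)"
    using A E X e by (intro psd_pull[of "E \<times> A"]) (auto simp: bij_betw_def)
  then have "psd ({..<card E} \<times> B) (on_snd \<Phi> (pull ({..<card E} \<times> A) (\<lambda>(i, a). (e i, a)) X))"
    using \<Phi> unfolding cp_map_def by blast
  then have "psd (E \<times> B) (pull (E \<times> B) (\<lambda>(c, b). (g c, b))
      (on_snd \<Phi> (pull ({..<card E} \<times> A) (\<lambda>(i, a). (e i, a)) X)))"
    by (intro psd_pull[of "{..<card E} \<times> B"]) (use A eg in auto)
  then show ?thesis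
    using on_snd_relabel[OF cp_linear[OF \<Phi>] psd_ops[OF X] eg] by simp
qed

lemma on_snd_diff: "on_snd (\<Phi> - \<Psi>) X = on_snd \<Phi> X - on_snd \<Psi> X"
  by (auto simp: on_snd_def fun_eq_iff)

lemma on_snd_comp: "on_snd \<Phi> (on_snd \<Psi> X) = on_snd (\<lambda>Z. \<Phi> (\<Psi> Z)) X"
  by (auto simp: on_snd_def fun_eq_iff)

lemma on_fst_comp: "on_fst \<Phi> (on_fst \<Psi> X) = on_fst (\<lambda>Z. \<Phi> (\<Psi> Z)) X"
  by (auto simp: on_fst_def fun_eq_iff)

text \<open>Maps are controlled only on \<open>ops A\<close> and need not be equal as functions.
  Agreement on supported matrices suffices, because all blocks of \<open>X\<close> are
  supported.\<close>

lemma on_snd_cong: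
  assumes "X \<in> ops (E \<times> A)" "\<And>Z. Z \<in> ops A \<Longrightarrow> \<Phi> Z = \<Psi> Z"
  shows "on_snd \<Phi> X = on_snd \<Psi> X"
proof (intro ext)
  fix x y :: "'a \<times> 'c"
  obtain c b c' b' where [simp]: "x = (c, b)" "y = (c', b')" by (cases x; cases y)
  show "on_snd \<Phi> X x y = on_snd \<Psi> X x y"
    using assms by (simp add: on_snd_apply block_ops)
qed

lemma block_add: "block c c' (X + Y) = block c c' X + block c c' Y"
  by (simp add: block_def fun_eq_iff)

lemma block_scale: "block c c' (scale k X) = scale k (block c c' X)"
  by (simp add: block_def scale_def fun_eq_iff)

lemma linear_on_snd:
  assumes \<Phi>: "linear_omap A B \<Phi>"
  shows "linear_omap (E \<times> A) (E \<times> B) (on_snd \<Phi>)"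
  unfolding linear_omap_def
proof (intro conjI ballI allI)
  fix X :: "('c \<times> 'a) oper" assume X: "X \<in> ops (E \<times> A)"
  then show "on_snd \<Phi> X \<in> ops (E \<times> B)" by (rule on_snd_ops[OF \<Phi>])
  fix k :: complex
  show "on_snd \<Phi> (scale k X) = scale k (on_snd \<Phi> X)"
    by (auto simp: fun_eq_iff on_snd_apply block_scale linear_omapD(3)[OF \<Phi> block_ops[OF X]] scale_apply)
  fix Y :: "('c \<times> 'a) oper" assume Y: "Y \<in> ops (E \<times> A)"
  show "on_snd \<Phi> (X + Y) = on_snd \<Phi> X + on_snd \<Phi> Y"
    by (auto simp: fun_eq_iff on_snd_apply block_add linear_omapD(2)[OF \<Phi> block_ops[OF X] block_ops[OF Y]])
qed

text \<open>The register \<open>E\<close> is absorbed into the ancilla, which may carry any finite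
  label set by \<open>psd_on_snd\<close>; what remains is a reassociation of labels.\<close>

lemma cp_on_snd:
  assumes "finite A" "finite B" "finite E" and \<Phi>: "cp_map A B \<Phi>"
  shows "cp_map (E \<times> A) (E \<times> B) (on_snd \<Phi>)"
  unfolding cp_map_def
proof (intro conjI allI impI linear_on_snd cp_linear[OF \<Phi>])
  fix d :: nat and X :: "(nat \<times> 'c \<times> 'a) oper"
  assume X: "psd ({..<d} \<times> E \<times> A) X"
  let ?f = "\<lambda>((i, e), a). (i, e, a)" and ?g = "\<lambda>(i, e, b). ((i, e), b)"
  have "psd (({..<d} \<times> E) \<times> A) (\<lambda>x y. X (?f x) (?f y))"
    using assms by (intro psd_reindex[OF _ _ X]) auto
  then have "psd (({..<d} \<times> E) \<times> B) (on_snd \<Phi> (\<lambda>x y. X (?f x) (?f y)))"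
    using assms by (intro psd_on_snd[OF _ _ _ \<Phi>]) auto
  from psd_reindex[OF _ _ this, of ?g "{..<d} \<times> E \<times> B"]
  have "psd ({..<d} \<times> E \<times> B) (\<lambda>x y. on_snd \<Phi> (\<lambda>x y. X (?f x) (?f y)) (?g x) (?g y))"
    using assms(1-3) by auto
  also have "(\<lambda>x y. on_snd \<Phi> (\<lambda>x y. X (?f x) (?f y)) (?g x) (?g y)) = on_snd (on_snd \<Phi>) X"
    by (intro ext, rename_tac x y, case_tac x rule: prod_cases3, case_tac y rule: prod_cases3) (simp add: on_snd_def)
  finally show "psd ({..<d} \<times> E \<times> B) (on_snd (on_snd \<Phi>) X)" .
qed

text \<open>Linearity and trace preservation of \<open>on_fst\<close> are inherited from
  \<open>on_snd\<close> through this conjugation by a swap.\<close>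

lemma on_fst_swap: "on_fst \<Phi> X = (\<lambda>x y. on_snd \<Phi> (\<lambda>x y. X (prod.swap x) (prod.swap y)) (prod.swap x) (prod.swap y))"
  by (intro ext) (simp add: on_snd_def on_fst_def split: prod.split)

lemma ops_swap: "X \<in> ops (A \<times> B) \<Longrightarrow> (\<lambda>x y. X (prod.swap x) (prod.swap y)) \<in> ops (B \<times> A)"
  by (auto simp: ops_iff)

lemma linear_on_fst:
  assumes \<Phi>: "linear_omap A B \<Phi>"
  shows "linear_omap (A \<times> E) (B \<times> E) (on_fst \<Phi>)"
  unfolding linear_omap_def
proof (intro conjI ballI allI)
  fix X :: "('a \<times> 'c) oper" assume X: "X \<in> ops (A \<times> E)"
  note L = linear_on_snd[OF \<Phi>, of E]
  show "on_fst \<Phi> X \<in> ops (B \<times> E)"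
    unfolding on_fst_swap by (intro ops_swap linear_omapD(1)[OF L] X)
  fix k :: complex
  show "on_fst \<Phi> (scale k X) = scale k (on_fst \<Phi> X)"
    unfolding on_fst_swap using linear_omapD(3)[OF L ops_swap[OF X], of k] by (simp add: scale_def)
  fix Y :: "('a \<times> 'c) oper" assume Y: "Y \<in> ops (A \<times> E)"
  show "on_fst \<Phi> (X + Y) = on_fst \<Phi> X + on_fst \<Phi> Y"
    unfolding on_fst_swap using linear_omapD(2)[OF L ops_swap[OF X] ops_swap[OF Y]]
    by (simp add: plus_fun_def)
qed

lemma cp_on_fst:
  assumes "finite A" "finite B" "finite E" and \<Phi>: "cp_map A B \<Phi>"
  shows "cp_map (A \<times> E) (B \<times> E) (on_fst \<Phi>)"
  unfolding cp_map_def
proof (intro conjI allI impI linear_on_fst cp_linear[OF \<Phi>])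
  fix d :: nat and X :: "(nat \<times> 'a \<times> 'c) oper"
  assume X: "psd ({..<d} \<times> A \<times> E) X"
  let ?f = "\<lambda>((i, e), a). (i, a, e)" and ?g = "\<lambda>(i, b, e). ((i, e), b)"
  have "psd (({..<d} \<times> E) \<times> A) (\<lambda>x y. X (?f x) (?f y))"
    using assms by (intro psd_reindex[OF _ _ X]) auto
  then have "psd (({..<d} \<times> E) \<times> B) (on_snd \<Phi> (\<lambda>x y. X (?f x) (?f y)))"
    using assms by (intro psd_on_snd[OF _ _ _ \<Phi>]) auto
  from psd_reindex[OF _ _ this, of ?g "{..<d} \<times> B \<times> E"]
  have "psd ({..<d} \<times> B \<times> E) (\<lambda>x y. on_snd \<Phi> (\<lambda>x y. X (?f x) (?f y)) (?g x) (?g y))"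
    using assms(1-3) by auto
  also have "(\<lambda>x y. on_snd \<Phi> (\<lambda>x y. X (?f x) (?f y)) (?g x) (?g y)) = on_snd (on_fst \<Phi>) X"
    by (intro ext, rename_tac x y, case_tac x rule: prod_cases3, case_tac y rule: prod_cases3) (simp add: on_snd_def on_fst_def)
  finally show "psd ({..<d} \<times> B \<times> E) (on_snd (on_fst \<Phi>) X)" .
qed

lemma cp_comp:
  assumes "cp_map A B \<Phi>" "cp_map B C \<Psi>"
  shows "cp_map A C (\<lambda>X. \<Psi> (\<Phi> X))"
  using assms unfolding cp_map_def linear_omap_def by (auto simp flip: on_snd_comp)

lemma cp_cong:
  assumes "cp_map A B \<Phi>" "\<And>X. X \<in> ops A \<Longrightarrow> \<Psi> X = \<Phi> X"
  shows "cp_map A B \<Psi>"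
proof -
  have "linear_omap A B \<Psi>"
    using cp_linear[OF assms(1)] assms(2) by (simp add: linear_omap_def ops_add ops_scale)
  moreover have "on_snd \<Psi> X = on_snd \<Phi> X" if "psd ({..<d} \<times> A) X" for d :: nat and X
    using on_snd_cong[OF psd_ops[OF that] assms(2)] .
  ultimately show ?thesis using assms(1) by (simp add: cp_map_def)
qed

lemma cp_add:
  assumes "cp_map A B \<Phi>" "cp_map A B \<Psi>"
  shows "cp_map A B (\<lambda>X. \<Phi> X + \<Psi> X)"
proof -
  have "linear_omap A B (\<lambda>X. \<Phi> X + \<Psi> X)"
    using assms[THEN cp_linear] by (auto simp: linear_omap_def ops_add scale_def fun_eq_iff algebra_simps)
  moreover have "on_snd (\<lambda>X. \<Phi> X + \<Psi> X) X = on_snd \<Phi> X + on_snd \<Psi> X" for X :: "(nat \<times> _) oper"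
    by (auto simp: on_snd_def fun_eq_iff)
  ultimately show ?thesis using assms by (auto simp: cp_map_def intro: psd_add)
qed

lemma cp_zero: "cp_map (A :: 'a set) (B :: 'b set) (\<lambda>X. 0)"
proof -
  have "on_snd (\<lambda>X. 0 :: 'b oper) X = 0" for X :: "(nat \<times> 'a) oper"
    by (auto simp: on_snd_def fun_eq_iff)
  moreover have "linear_omap A B (\<lambda>X. 0)"
    by (auto simp: linear_omap_def ops_zero scale_def fun_eq_iff)
  ultimately show ?thesis by (simp add: cp_map_def psd_zero)
qed

lemma cp_sum:
  "(\<And>i. i \<in> I \<Longrightarrow> cp_map A B (\<Phi> i)) \<Longrightarrow> cp_map A B (\<lambda>X. \<Sum>i\<in>I. \<Phi> i X)"
  by (induction I rule: infinite_finite_induct) (auto intro: cp_zero cp_add)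

lemma cp_scale:
  assumes "cp_map A B \<Phi>" "c \<ge> 0"
  shows "cp_map A B (\<lambda>X. scale (complex_of_real c) (\<Phi> X))"
proof -
  have "linear_omap A B (\<lambda>X. scale (complex_of_real c) (\<Phi> X))"
    using cp_linear[OF assms(1)] by (auto simp: linear_omap_def ops_scale scale_add scale_scale mult.commute)
  moreover have "on_snd (\<lambda>X. scale (complex_of_real c) (\<Phi> X)) X = scale (complex_of_real c) (on_snd \<Phi> X)"
    for X :: "(nat \<times> _) oper"
    by (auto simp: on_snd_def fun_eq_iff scale_def)
  ultimately show ?thesis using assms by (auto simp: cp_map_def intro: psd_scale)
qed

lemma cp_avg: "(\<And>i. i \<in> I \<Longrightarrow> cp_map A B (\<Phi> i)) \<Longrightarrow> cp_map A B (\<lambda>X. avg I (\<lambda>i. \<Phi> i X))"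
  using cp_scale[OF cp_sum, of I A B \<Phi> "1 / real (card I)"] by (simp add: avg_def)

section \<open>Kraus maps, channels and contraction of the trace norm\<close>

lemma sandwich_apply:
  "sandwich A K X b b' = (\<Sum>a\<in>A. \<Sum>a'\<in>A. K b a * X a a' * cnj (K b' a'))"
  by (subst sum.swap) (simp add: sandwich_def mmul_def adj_def sum_distrib_right)

lemma linear_sandwich:
  assumes "\<And>b a. b \<notin> B \<Longrightarrow> K b a = 0"
  shows "linear_omap A B (sandwich A K)"
  using assms unfolding linear_omap_def
  by (auto simp: ops_iff fun_eq_iff sandwich_apply scale_def algebra_simps sum.distrib sum_distrib_left)

lemma cp_sandwich:
  assumes "finite A" "\<And>b a. b \<notin> B \<Longrightarrow> K b a = 0"
  shows "cp_map A B (sandwich A K)"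
  unfolding cp_map_def
proof (intro conjI allI impI linear_sandwich assms)
  fix d :: nat and X :: "(nat \<times> 'a) oper"
  assume X: "psd ({..<d} \<times> A) X"
  \<comment> \<open>The matrix of \<open>I \<otimes> K\<close>: a Kraus map extended by an ancilla
    is again a Kraus map.\<close>
  let ?K = "\<lambda>(i, b) (j, a). if i = j \<and> i < d then K b a else 0"
  have "on_snd (sandwich A K) X = sandwich ({..<d} \<times> A) ?K X"
  proof (intro ext)
    fix x y :: "nat \<times> 'b"
    obtain i b j b' where [simp]: "x = (i, b)" "y = (j, b')" by (cases x; cases y)
    have "sandwich ({..<d} \<times> A) ?K X (i, b) (j, b') =
        (\<Sum>k<d. \<Sum>a\<in>A. \<Sum>l<d. \<Sum>a'\<in>A. if l = j then (if k = i then K b a * X (k, a) (l, a') * cnj (K b' a') else 0) else 0)"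
      unfolding sandwich_apply sum.cartesian_product' by (intro sum.cong refl) auto
    also have "\<dots> = (\<Sum>k<d. \<Sum>l<d. if l = j then (if k = i then \<Sum>a\<in>A. \<Sum>a'\<in>A. K b a * X (k, a) (l, a') * cnj (K b' a') else 0) else 0)"
      by (subst sum.swap[of _ "{..<d}" A], intro sum.cong refl) (simp add: sum.neutral)
    also have "\<dots> = (if i < d \<and> j < d then \<Sum>a\<in>A. \<Sum>a'\<in>A. K b a * X (i, a) (j, a') * cnj (K b' a') else 0)"
      by (cases "i < d"; cases "j < d") simp_all
    also have "\<dots> = on_snd (sandwich A K) X x y"
      using psd_ops[OF X] by (auto simp: on_snd_def sandwich_apply opsD)
    finally show "on_snd (sandwich A K) X x y = sandwich ({..<d} \<times> A) ?K X x y" by simp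
  qed
  moreover have "psd ({..<d} \<times> B) (sandwich ({..<d} \<times> A) ?K X)"
  proof (rule psd_sandwich[OF X])
    fix x y assume "x \<notin> {..<d} \<times> B"
    then show "?K x y = 0" using assms(2) by (cases x; cases y) auto
  qed
  ultimately show "psd ({..<d} \<times> B) (on_snd (sandwich A K) X)" by simp
qed

lemma cp_pull:
  assumes "finite A" "f ` C \<subseteq> A" "C \<subseteq> B"
  shows "cp_map A B (pull C f)"
proof (rule cp_cong)
  show "cp_map A B (sandwich A (\<lambda>b a. if b \<in> C \<and> a = f b then 1 else 0))"
    using assms by (intro cp_sandwich) auto
qed (simp add: pull_sandwich assms)

lemma tp_on_snd:
  assumes "trace_preserving A B \<Phi>"
  shows "trace_preserving (E \<times> A) (E \<times> B) (on_snd \<Phi>)"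
  unfolding trace_preserving_def
proof
  fix X :: "('c \<times> 'a) oper" assume X: "X \<in> ops (E \<times> A)"
  have "trace (E \<times> B) (on_snd \<Phi> X) = (\<Sum>c\<in>E. trace B (\<Phi> (block c c X)))"
    by (simp add: trace_def sum.cartesian_product' on_snd_apply)
  also have "\<dots> = (\<Sum>c\<in>E. trace A (block c c X))"
    using assms X by (simp add: trace_preserving_def block_ops)
  also have "\<dots> = trace (E \<times> A) X"
    by (simp add: trace_def sum.cartesian_product' block_def)
  finally show "trace (E \<times> B) (on_snd \<Phi> X) = trace (E \<times> A) X" .
qed

lemma trace_swap: "trace (A \<times> B) (\<lambda>x y. X (prod.swap x) (prod.swap y)) = trace (B \<times> A) X"
  by (simp add: trace_def sum.cartesian_product') (rule sum.swap)

lemma tp_on_fst: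
  assumes "trace_preserving A B \<Phi>"
  shows "trace_preserving (A \<times> E) (B \<times> E) (on_fst \<Phi>)"
  unfolding trace_preserving_def
proof
  fix X :: "('a \<times> 'c) oper" assume X: "X \<in> ops (A \<times> E)"
  then show "trace (B \<times> E) (on_fst \<Phi> X) = trace (A \<times> E) X"
    unfolding on_fst_swap trace_swap
    using tp_on_snd[OF assms, of E] ops_swap[OF X] by (simp add: trace_preserving_def trace_swap)
qed

lemma cptp_comp:
  assumes "cptp A B \<Phi>" "cptp B C \<Psi>"
  shows "cptp A C (\<lambda>X. \<Psi> (\<Phi> X))"
  using assms cp_comp[of A B \<Phi> C \<Psi>]
  by (auto simp: cptp_def trace_preserving_def cp_map_def linear_omap_def)

lemma cptp_on_snd: "finite A \<Longrightarrow> finite B \<Longrightarrow> finite E \<Longrightarrow> cptp A B \<Phi> \<Longrightarrow> cptp (E \<times> A) (E \<times> B) (on_snd \<Phi>)"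
  by (simp add: cptp_def cp_on_snd tp_on_snd)

lemma cptp_on_fst: "finite A \<Longrightarrow> finite B \<Longrightarrow> finite E \<Longrightarrow> cptp A B \<Phi> \<Longrightarrow> cptp (A \<times> E) (B \<times> E) (on_fst \<Phi>)"
  by (simp add: cptp_def cp_on_fst tp_on_fst)

lemma cptp_cong:
  assumes "cptp A B \<Phi>" "\<And>X. X \<in> ops A \<Longrightarrow> \<Psi> X = \<Phi> X"
  shows "cptp A B \<Psi>"
  using assms cp_cong[of A B \<Phi> \<Psi>] by (auto simp: cptp_def trace_preserving_def)

lemma cptp_avg:
  assumes "finite I" "I \<noteq> {}" "\<And>i. i \<in> I \<Longrightarrow> cptp A B (\<Phi> i)"
  shows "cptp A B (\<lambda>X. avg I (\<lambda>i. \<Phi> i X))"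
  using assms by (auto simp: cptp_def trace_preserving_def avg_def trace_scale trace_sum intro!: cp_avg[unfolded avg_def])

lemma cptp_reindex:
  assumes "finite A" "bij_betw f B A"
  shows "cptp A B (pull B f)"
proof -
  have "trace B (pull B f X) = trace A X" for X
    unfolding trace_def pull_def using sum.reindex_bij_betw[OF assms(2), of "\<lambda>a. X a a"] by simp
  then show ?thesis using assms by (auto simp: cptp_def trace_preserving_def bij_betw_def intro!: cp_pull)
qed

text \<open>The definition of complete positivity speaks of maps extended by an ancilla; the
  one-label ancilla \<open>{()}\<close> recovers the map itself.\<close>

lemma psd_cp_image:
  assumes "cp_map A B \<Phi>" "finite A" "finite B" "psd A X"
  shows "psd B (\<Phi> X)"
proof -
  have "psd ({()} \<times> A) (\<lambda>x y. X (snd x) (snd y))"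
    using psd_reindex[OF assms(2) _ assms(4), of snd "{()} \<times> A"] by (simp add: mem_Times_iff)
  then have "psd ({()} \<times> B) (on_snd \<Phi> (\<lambda>x y. X (snd x) (snd y)))"
    using assms by (intro psd_on_snd[of A B]) auto
  from psd_reindex[OF _ _ this, of "Pair ()" B]
  have "psd B (\<lambda>b b'. on_snd \<Phi> (\<lambda>x y. X (snd x) (snd y)) ((), b) ((), b'))"
    using assms(2,3) by auto
  then show ?thesis by (simp add: on_snd_def)
qed

text \<open>A Jordan decomposition of \<open>X - Y\<close> is sent to a difference of positive
  operators with the same traces, which bounds the norm from above. This data-processing inequality
  allows a common post-processing to be stripped from a hybrid step.\<close>

lemma trace_norm_cptp:
  assumes "cptp A B \<Phi>" "finite A" "finite B" "psd A X" "psd A Y"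
  shows "trace_norm B (\<Phi> X - \<Phi> Y) \<le> trace_norm A (X - Y)"
proof -
  have cp: "cp_map A B \<Phi>" and tp: "trace_preserving A B \<Phi>" using assms by (auto simp: cptp_def)
  note L = cp_linear[OF cp]
  have X: "X - Y \<in> ops A" "adj (X - Y) = X - Y"
    using psd_hermitian[OF assms(2,4)] psd_hermitian[OF assms(2,5)] assms(4,5)
    by (auto simp: psd_ops ops_diff) (auto simp: adj_def fun_eq_iff)
  obtain P N where PN: "psd A P" "psd A N" "X - Y = P - N"
      "trace_norm A (X - Y) = Re (trace A P) + Re (trace A N)"
    using jordan_decomposition[OF assms(2) X] by blast
  have "\<Phi> X - \<Phi> Y = \<Phi> (P - N)"
    using linear_omap_diff[OF L psd_ops[OF assms(4)] psd_ops[OF assms(5)]] PN(3) by simp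
  also have "\<dots> = \<Phi> P - \<Phi> N"
    by (rule linear_omap_diff[OF L psd_ops[OF PN(1)] psd_ops[OF PN(2)]])
  finally have "\<Phi> X - \<Phi> Y = \<Phi> P - \<Phi> N" .
  moreover have "psd B (\<Phi> P)" "psd B (\<Phi> N)" using psd_cp_image[OF cp assms(2,3)] PN by blast+
  ultimately have "trace_norm B (\<Phi> X - \<Phi> Y) \<le> Re (trace B (\<Phi> P)) + Re (trace B (\<Phi> N))"
    using assms by (simp add: trace_norm_le)
  then show ?thesis using tp PN by (simp add: trace_preserving_def psd_ops)
qed

lemma density_cptp:
  assumes "cptp A B \<Phi>" "finite A" "finite B" "density A \<rho>"
  shows "density B (\<Phi> \<rho>)"
  using assms psd_cp_image[of A B \<Phi> \<rho>] by (simp add: density_def cptp_def trace_preserving_def psd_ops)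

section \<open>Pauli operators and the encryption scheme\<close>

lemma bitstr_0 [simp]: "bitstr 0 = {[]}"
  by (auto simp: bitstr_def)

lemma bitstr_Suc: "bitstr (Suc n) = (\<lambda>(x, xs). x # xs) ` (UNIV \<times> bitstr n)"
  by (auto simp: bitstr_def length_Suc_conv)

lemma finite_bitstr [simp]: "finite (bitstr n)"
  by (induction n) (auto simp: bitstr_Suc)

lemma card_bitstr: "card (bitstr n) = 2 ^ n"
  by (induction n) (auto simp: bitstr_Suc card_image inj_on_def card_cartesian_product)

lemma zeros_bitstr [simp]: "zeros n \<in> bitstr n"
  by (simp add: bitstr_def)

lemma bitstr_nonempty [simp]: "bitstr n \<noteq> {}"
  using zeros_bitstr by blast

lemma sum_bitstr_Suc:
  "(\<Sum>l\<in>bitstr (Suc n). h l) = (\<Sum>x\<in>UNIV. \<Sum>xs\<in>bitstr n. h (x # xs))"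
  unfolding bitstr_Suc by (subst sum.reindex) (auto simp: inj_on_def sum.cartesian_product split_def)

lemma sum_bitstr_append:
  "(\<Sum>l\<in>bitstr (n + k). h l) = (\<Sum>xs\<in>bitstr n. \<Sum>ys\<in>bitstr k. h (xs @ ys))"
  by (induction n arbitrary: h) (auto simp: sum_bitstr_Suc)

text \<open>The distributive law that reduces identities for n-qubit Pauli operators to a single
  qubit.\<close>

lemma sum_bitstr_prod:
  fixes g :: "nat \<Rightarrow> bool \<Rightarrow> complex"
  shows "(\<Sum>l\<in>bitstr n. \<Prod>j<n. g j (l ! j)) = (\<Prod>j<n. \<Sum>x\<in>UNIV. g j x)"
proof (induction n arbitrary: g)
  case (Suc n)
  have "(\<Sum>l\<in>bitstr (Suc n). \<Prod>j<Suc n. g j (l ! j))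
      = (\<Sum>x\<in>UNIV. \<Sum>xs\<in>bitstr n. g 0 x * (\<Prod>j<n. g (Suc j) (xs ! j)))"
    by (simp only: sum_bitstr_Suc prod.lessThan_Suc_shift nth_Cons_0 nth_Cons_Suc)
  also have "\<dots> = (\<Sum>x\<in>UNIV. g 0 x) * (\<Prod>j<n. \<Sum>x\<in>UNIV. g (Suc j) x)"
    by (simp only: sum_distrib_left[symmetric] sum_distrib_right[symmetric] Suc[of "\<lambda>j. g (Suc j)"])
  finally show ?case by (simp only: prod.lessThan_Suc_shift)
qed simp

lemma prod_indicator:
  "(\<Prod>j<n. if P j then c else 0) = (if \<forall>j<n. P j then c ^ n else (0 :: complex))"
  by (induction n) (auto simp: less_Suc_eq)

lemma bitstr_eq_iff: "a \<in> bitstr n \<Longrightarrow> b \<in> bitstr n \<Longrightarrow> a = b \<longleftrightarrow> (\<forall>j<n. a ! j = b ! j)"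
  by (auto simp: bitstr_def list_eq_iff_nth_eq)

text \<open>The four Pauli matrices are an orthogonal basis of the 2 by 2 matrices, each of squared
  norm 2; this is the resulting resolution of the identity, checked in all sixteen cases.\<close>

lemma pauli1_complete:
  "(\<Sum>x\<in>UNIV. \<Sum>z\<in>UNIV. pauli1 x z a b * cnj (pauli1 x z a' b')) = (if a = a' \<and> b = b' then 2 else 0)"
  by (cases a; cases b; cases a'; cases b') (simp_all add: UNIV_bool pauli1_def)

lemma pauli1_unitary:
  "(\<Sum>b\<in>UNIV. pauli1 x z a b * cnj (pauli1 x z a' b)) = (if a = a' then 1 else 0)"
  "(\<Sum>b\<in>UNIV. cnj (pauli1 x z b a) * pauli1 x z b a') = (if a = a' then 1 else 0)"
  by (cases x; cases z; cases a; cases a'; simp add: UNIV_bool pauli1_def)+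

text \<open>The index string is split into its X-half and its Z-half, after which the sum factorises
  over the qubits.\<close>

lemma pauli_complete:
  assumes "a \<in> bitstr n" "b \<in> bitstr n" "a' \<in> bitstr n" "b' \<in> bitstr n"
  shows "(\<Sum>l\<in>bitstr (2 * n). pauli n l a b * cnj (pauli n l a' b'))
    = (if a = a' \<and> b = b' then 2 ^ n else 0)"
proof -
  let ?g = "\<lambda>j x z. pauli1 x z (a ! j) (b ! j) * cnj (pauli1 x z (a' ! j) (b' ! j))"
  have "(\<Sum>l\<in>bitstr (2 * n). pauli n l a b * cnj (pauli n l a' b'))
      = (\<Sum>xs\<in>bitstr n. \<Sum>zs\<in>bitstr n. \<Prod>j<n. ?g j (xs ! j) (zs ! j))"
    unfolding mult_2 sum_bitstr_append using assms
    by (intro sum.cong refl) (auto simp: pauli_def bitstr_def nth_append prod.distrib intro!: arg_cong2[of _ _ _ _ "(*)"] prod.cong)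
  also have "\<dots> = (\<Sum>xs\<in>bitstr n. \<Prod>j<n. \<Sum>z\<in>UNIV. ?g j (xs ! j) z)"
  proof (intro sum.cong refl)
    fix xs
    show "(\<Sum>zs\<in>bitstr n. \<Prod>j<n. ?g j (xs ! j) (zs ! j)) = (\<Prod>j<n. \<Sum>z\<in>UNIV. ?g j (xs ! j) z)"
      by (rule sum_bitstr_prod[of "\<lambda>j. ?g j (xs ! j)"])
  qed
  also have "\<dots> = (\<Prod>j<n. \<Sum>x\<in>UNIV. \<Sum>z\<in>UNIV. ?g j x z)"
    by (rule sum_bitstr_prod[of "\<lambda>j x. \<Sum>z\<in>UNIV. ?g j x z"])
  also have "\<dots> = (if a = a' \<and> b = b' then 2 ^ n else 0)"
    unfolding pauli1_complete prod_indicator using assms by (auto simp: bitstr_eq_iff)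
  finally show ?thesis .
qed

lemma pauli_unitary:
  assumes "a \<in> bitstr n" "a' \<in> bitstr n"
  shows "(\<Sum>b\<in>bitstr n. pauli n l a b * cnj (pauli n l a' b)) = (if a = a' then 1 else 0)"
    and "(\<Sum>b\<in>bitstr n. cnj (pauli n l b a) * pauli n l b a') = (if a = a' then 1 else 0)"
proof -
  let ?p = "\<lambda>j. pauli1 (l ! j) (l ! (n + j))"
  have "(\<Sum>b\<in>bitstr n. pauli n l a b * cnj (pauli n l a' b))
      = (\<Sum>b\<in>bitstr n. \<Prod>j<n. ?p j (a ! j) (b ! j) * cnj (?p j (a' ! j) (b ! j)))"
    using assms by (intro sum.cong refl) (auto simp: pauli_def prod.distrib)
  also have "\<dots> = (\<Prod>j<n. \<Sum>y\<in>UNIV. ?p j (a ! j) y * cnj (?p j (a' ! j) y))"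
    by (rule sum_bitstr_prod[of "\<lambda>j y. ?p j (a ! j) y * cnj (?p j (a' ! j) y)"])
  also have "\<dots> = (if a = a' then 1 else 0)"
    unfolding pauli1_unitary prod_indicator using assms by (simp add: bitstr_eq_iff)
  finally show "(\<Sum>b\<in>bitstr n. pauli n l a b * cnj (pauli n l a' b)) = (if a = a' then 1 else 0)" .
  have "(\<Sum>b\<in>bitstr n. cnj (pauli n l b a) * pauli n l b a')
      = (\<Sum>b\<in>bitstr n. \<Prod>j<n. cnj (?p j (b ! j) (a ! j)) * ?p j (b ! j) (a' ! j))"
    using assms by (intro sum.cong refl) (auto simp: pauli_def prod.distrib)
  also have "\<dots> = (\<Prod>j<n. \<Sum>y\<in>UNIV. cnj (?p j y (a ! j)) * ?p j y (a' ! j))"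
    by (rule sum_bitstr_prod[of "\<lambda>j y. cnj (?p j y (a ! j)) * ?p j y (a' ! j)"])
  also have "\<dots> = (if a = a' then 1 else 0)"
    unfolding pauli1_unitary prod_indicator using assms by (simp add: bitstr_eq_iff)
  finally show "(\<Sum>b\<in>bitstr n. cnj (pauli n l b a) * pauli n l b a') = (if a = a' then 1 else 0)" .
qed

lemma sum_cipher: "(\<Sum>(a, c)\<in>cipher m t. h (a @ c)) = (\<Sum>b\<in>bitstr (m + t). h b)"
  by (simp add: sum_bitstr_append sum.cartesian_product)

lemma append_bitstr: "a \<in> bitstr m \<Longrightarrow> c \<in> bitstr t \<Longrightarrow> a @ c \<in> bitstr (m + t)"
  by (simp add: bitstr_def)

lemma append_bitstr_eq:
  "a \<in> bitstr m \<Longrightarrow> a' \<in> bitstr m \<Longrightarrow> a @ c = a' @ c' \<longleftrightarrow> a = a' \<and> c = c'"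
  by (simp add: bitstr_def)

lemma finite_cipher: "finite (cipher m t)"
  by simp

lemma pauli_MT_unitary: "unitary_op (cipher m t) (pauli_MT m t l)"
proof -
  have 0: "pauli_MT m t l \<in> ops (cipher m t)"
    by (auto simp: ops_iff pauli_MT_def)
  have 1: "mmul (cipher m t) (adj (pauli_MT m t l)) (pauli_MT m t l) x y = id_op (cipher m t) x y" for x y
  proof (cases "x \<in> cipher m t \<and> y \<in> cipher m t")
    case True
    then obtain a c a' c' where [simp]: "x = (a, c)" "y = (a', c')"
      and m: "a \<in> bitstr m" "c \<in> bitstr t" "a' \<in> bitstr m" "c' \<in> bitstr t" by (cases x; cases y; auto)
    have "mmul (cipher m t) (adj (pauli_MT m t l)) (pauli_MT m t l) x y
        = (\<Sum>(b, d)\<in>cipher m t. cnj (pauli (m + t) l (b @ d) (a @ c)) * pauli (m + t) l (b @ d) (a' @ c'))"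
      using m by (auto simp: mmul_def adj_def pauli_MT_def intro!: sum.cong)
    also have "\<dots> = id_op (cipher m t) x y"
      unfolding sum_cipher[of "\<lambda>e. cnj (pauli (m + t) l e (a @ c)) * pauli (m + t) l e (a' @ c')"] using m by (simp add: pauli_unitary append_bitstr append_bitstr_eq id_op_def)
    finally show ?thesis .
  next
    case False
    then show ?thesis
      using opsD[OF ops_mmul[OF ops_adj[OF 0] 0], of x y] opsD[OF id_op_ops[of "cipher m t"], of x y] by auto
  qed
  have 2: "mmul (cipher m t) (pauli_MT m t l) (adj (pauli_MT m t l)) x y = id_op (cipher m t) x y" for x y
  proof (cases "x \<in> cipher m t \<and> y \<in> cipher m t")
    case True
    then obtain a c a' c' where [simp]: "x = (a, c)" "y = (a', c')"
      and m: "a \<in> bitstr m" "c \<in> bitstr t" "a' \<in> bitstr m" "c' \<in> bitstr t" by (cases x; cases y; auto)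
    have "mmul (cipher m t) (pauli_MT m t l) (adj (pauli_MT m t l)) x y
        = (\<Sum>(b, d)\<in>cipher m t. pauli (m + t) l (a @ c) (b @ d) * cnj (pauli (m + t) l (a' @ c') (b @ d)))"
      using m by (auto simp: mmul_def adj_def pauli_MT_def intro!: sum.cong)
    also have "\<dots> = id_op (cipher m t) x y"
      unfolding sum_cipher[of "\<lambda>e. pauli (m + t) l (a @ c) e * cnj (pauli (m + t) l (a' @ c') e)"] using m by (simp add: pauli_unitary append_bitstr append_bitstr_eq id_op_def)
    finally show ?thesis .
  next
    case False
    then show ?thesis
      using opsD[OF ops_mmul[OF 0 ops_adj[OF 0]], of x y] opsD[OF id_op_ops[of "cipher m t"], of x y] by auto
  qed
  show ?thesis using 0 1 2 by (auto simp: unitary_op_def fun_eq_iff)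
qed

lemma pauli_MT_complete:
  assumes "x \<in> cipher m t" "y \<in> cipher m t" "x' \<in> cipher m t" "y' \<in> cipher m t"
  shows "(\<Sum>l\<in>pads m t. pauli_MT m t l x y * cnj (pauli_MT m t l x' y'))
    = (if x = x' \<and> y = y' then 2 ^ (m + t) else 0)"
proof -
  obtain a c b d a' c' b' d' where [simp]: "x = (a, c)" "y = (b, d)" "x' = (a', c')" "y' = (b', d')"
    by (cases x; cases y; cases x'; cases y')
  show ?thesis using assms
    by (auto simp: pauli_MT_def pauli_complete append_bitstr append_bitstr_eq simp del: distrib_left_numeral)
qed

lemma enc_unitary_unitary:
  "unitary_op (cipher m t) (V (fst \<kappa>)) \<Longrightarrow> unitary_op (cipher m t) (enc_unitary m t V \<kappa>)"
  unfolding enc_unitary_def by (intro unitary_op_mmul pauli_MT_unitary finite_cipher)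

text \<open>An orthogonal operator basis multiplied by a fixed unitary is another one, so for each
  code key the encryption unitaries inherit completeness from the Pauli operators. This is what
  turns the pads into the outcomes of a measurement.\<close>

lemma enc_unitary_complete:
  assumes V: "unitary_op (cipher m t) (V k0)"
    and x: "x \<in> cipher m t" "y \<in> cipher m t" "x' \<in> cipher m t" "y' \<in> cipher m t"
  shows "(\<Sum>k\<in>pads m t. enc_unitary m t V (k0, k) x y * cnj (enc_unitary m t V (k0, k) x' y'))
    = (if x = x' \<and> y = y' then 2 ^ (m + t) else 0)"
proof -
  let ?C = "cipher m t" and ?P = "pauli_MT m t" and ?W = "V k0"
  have "(\<Sum>k\<in>pads m t. enc_unitary m t V (k0, k) x y * cnj (enc_unitary m t V (k0, k) x' y'))
      = (\<Sum>k\<in>pads m t. \<Sum>c\<in>?C. \<Sum>d\<in>?C. ?W c y * cnj (?W d y') * (?P k x c * cnj (?P k x' d)))"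
    by (simp only: enc_unitary_def mmul_def fst_conv snd_conv sum_product cnj_sum complex_cnj_mult mult_ac)
  also have "\<dots> = (\<Sum>c\<in>?C. \<Sum>k\<in>pads m t. \<Sum>d\<in>?C. ?W c y * cnj (?W d y') * (?P k x c * cnj (?P k x' d)))"
    by (rule sum.swap)
  also have "\<dots> = (\<Sum>c\<in>?C. \<Sum>d\<in>?C. \<Sum>k\<in>pads m t. ?W c y * cnj (?W d y') * (?P k x c * cnj (?P k x' d)))"
    by (intro sum.cong refl sum.swap)
  also have "\<dots> = (\<Sum>c\<in>?C. \<Sum>d\<in>?C. ?W c y * cnj (?W d y') * (if x = x' \<and> c = d then 2 ^ (m + t) else 0))"
    using x by (intro sum.cong refl) (simp add: pauli_MT_complete del: distrib_left_numeral flip: sum_distrib_left)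
  also have "\<dots> = (if x = x' then 2 ^ (m + t) * mmul ?C (adj ?W) ?W y' y else 0)"
    by (simp add: mmul_def adj_def if_distrib[of "\<lambda>x. _ * x"] sum_distrib_left mult_ac cong: if_cong)
  also have "\<dots> = (if x = x' \<and> y = y' then 2 ^ (m + t) else 0)"
    using V x by (auto simp: unitary_op_def id_op_def)
  finally show ?thesis .
qed

lemma cptp_unitary:
  assumes "finite A" "unitary_op A U"
  shows "cptp A A (sandwich A U)"
proof -
  have "trace A (sandwich A U X) = trace A X" if "X \<in> ops A" for X
  proof -
    have "trace A (sandwich A U X) = trace A (mmul A (adj U) (mmul A U X))"
      unfolding sandwich_def by (rule trace_cyclic)
    then show ?thesis using assms that by (simp add: conj_diag_id id_op_mmul)
  qed
  moreover have "U b a = 0" if "b \<notin> A" for a b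
    using that opsD[OF unitary_ops[OF assms(2)]] by simp
  ultimately show ?thesis using assms(1) by (auto simp: cptp_def trace_preserving_def intro!: cp_sandwich)
qed

lemma tensor_ketbra_pull: "X \<in> ops A \<Longrightarrow> tensor X (ketbra q) = pull (A \<times> {q}) fst X"
  by (auto simp: tensor_def ketbra_def pull_def fun_eq_iff opsD)

lemma cp_tensor_ketbra:
  assumes "finite A" "q \<in> Q"
  shows "cp_map A (A \<times> Q) (\<lambda>X. tensor X (ketbra q))"
  by (rule cp_cong[OF cp_pull[of A fst "A \<times> {q}" "A \<times> Q"]]) (use assms in \<open>auto simp: tensor_ketbra_pull\<close>)

lemma trace_tensor_ketbra:
  assumes "finite Q" "q \<in> Q"
  shows "trace (A \<times> Q) (tensor X (ketbra q)) = trace A X"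
  using assms by (simp add: trace_def sum.cartesian_product' tensor_def ketbra_def if_distrib[of "\<lambda>x. _ * x"] cong: if_cong)

section \<open>Encryption, decryption and key disclosure as channels\<close>

lemma cptp_encrypt:
  assumes "unitary_op (cipher m t) (V (fst \<kappa>))"
  shows "cptp (bitstr m) (cipher m t) (encrypt m t V \<kappa>)"
proof -
  have "cptp (bitstr m) (cipher m t) (\<lambda>\<rho>. tensor \<rho> (ketbra (zeros t)))"
    using cp_tensor_ketbra[of "bitstr m" "zeros t" "bitstr t"]
    by (simp add: cptp_def trace_preserving_def trace_tensor_ketbra)
  from cptp_comp[OF this cptp_unitary[OF finite_cipher enc_unitary_unitary[of m t V \<kappa>]]]
  show ?thesis using assms by (simp add: encrypt_def[abs_def])
qed

lemma finite_msg_bot [simp]: "finite (msg_bot m)"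
  by (simp add: msg_bot_def)

lemma embed_apply [simp]:
  "embed X (Some a) (Some b) = X a b" "embed X None y = 0" "embed X x None = 0"
  by (auto simp: embed_def split: option.split)

lemma embed_pull: "X \<in> ops A \<Longrightarrow> embed X = pull (Some ` A) the X"
proof (intro ext)
  fix x y assume "X \<in> ops A"
  then show "embed X x y = pull (Some ` A) the X x y"
    by (cases x; cases y) (auto simp: pull_def opsD image_iff)
qed

lemma cp_embed: "finite A \<Longrightarrow> cp_map A (insert None (Some ` A)) embed"
  by (rule cp_cong[OF cp_pull[of A the "Some ` A"]]) (auto simp: embed_pull)

lemma cp_embed_msg: "cp_map (bitstr m) (msg_bot m) embed"
  unfolding msg_bot_def by (intro cp_embed) simp

lemma cp_bra_ket: "finite A \<Longrightarrow> finite T \<Longrightarrow> i \<in> T \<Longrightarrow> cp_map (A \<times> T) A (bra_ket i)"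
proof (rule cp_cong[OF cp_pull[of "A \<times> T" "\<lambda>a. (a, i)" A]])
  fix X :: "('a \<times> 'b) oper" assume "X \<in> ops (A \<times> T)"
  then show "bra_ket i X = pull A (\<lambda>a. (a, i)) X"
    by (auto simp: bra_ket_def pull_def fun_eq_iff opsD)
qed auto

lemma cp_trace_ketbra:
  assumes "finite A" "q \<in> Q"
  shows "cp_map A Q (\<lambda>X. scale (trace A X) (ketbra q))"
proof (rule cp_cong[OF cp_sum])
  show "cp_map A Q (pull {q} (\<lambda>_. a))" if "a \<in> A" for a
    using assms that by (intro cp_pull) auto
  fix X
  have "(\<Sum>a\<in>A. pull {q} (\<lambda>_. a) X) x y = scale (trace A X) (ketbra q) x y" for x y
    using assms(1) by (induction A) (auto simp: pull_def scale_def ketbra_def trace_def)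
  then show "scale (trace A X) (ketbra q) = (\<Sum>a\<in>A. pull {q} (\<lambda>_. a) X)" by (simp add: fun_eq_iff)
qed

text \<open>The key-independent part of decryption, applied once the encryption unitary has been
  undone.\<close>

definition measure_tag :: "nat \<Rightarrow> nat \<Rightarrow> (bits \<times> bits, bits option) omap" where
  "measure_tag m t \<sigma> = embed (bra_ket (zeros t) \<sigma>)
     + scale (trace (bitstr m) (\<Sum>i\<in>bitstr t - {zeros t}. bra_ket i \<sigma>)) (ketbra None)"

lemma decrypt_eq: "decrypt m t V \<kappa> \<rho> = measure_tag m t (sandwich (cipher m t) (adj (enc_unitary m t V \<kappa>)) \<rho>)"
  by (simp add: decrypt_def measure_tag_def Let_def)

lemma cptp_measure_tag: "cptp (cipher m t) (msg_bot m) (measure_tag m t)"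
  unfolding cptp_def
proof
  have "cp_map (cipher m t) (bitstr m) (\<lambda>X. \<Sum>i\<in>bitstr t - {zeros t}. bra_ket i X)"
    by (intro cp_sum cp_bra_ket) auto
  from cp_comp[OF this cp_trace_ketbra[of "bitstr m" None "msg_bot m"]]
    cp_comp[OF cp_bra_ket[of "bitstr m" "bitstr t" "zeros t"] cp_embed_msg]
  show "cp_map (cipher m t) (msg_bot m) (measure_tag m t)"
    unfolding measure_tag_def[abs_def] by (intro cp_add) (auto simp: msg_bot_def)
  show "trace_preserving (cipher m t) (msg_bot m) (measure_tag m t)"
    unfolding trace_preserving_def
  proof
    fix X assume "X \<in> ops (cipher m t)"
    have "trace (msg_bot m) (measure_tag m t X)
        = trace (bitstr m) (bra_ket (zeros t) X) + trace (bitstr m) (\<Sum>i\<in>bitstr t - {zeros t}. bra_ket i X)"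
      unfolding measure_tag_def trace_add msg_bot_def
      by (simp add: trace_scale) (simp add: trace_def sum.reindex ketbra_def)
    also have "\<dots> = (\<Sum>i\<in>bitstr t. trace (bitstr m) (bra_ket i X))"
      by (simp add: trace_sum sum.remove[of "bitstr t" "zeros t"])
    also have "\<dots> = trace (cipher m t) X"
      by (simp add: trace_def bra_ket_def sum.cartesian_product' sum.swap[of _ "bitstr t" "bitstr m"])
    finally show "trace (msg_bot m) (measure_tag m t X) = trace (cipher m t) X" .
  qed
qed

lemma cptp_decrypt:
  assumes "unitary_op (cipher m t) (V (fst \<kappa>))"
  shows "cptp (cipher m t) (msg_bot m) (decrypt m t V \<kappa>)"
  unfolding decrypt_eq[abs_def]
  using assms by (intro cptp_comp[OF cptp_unitary cptp_measure_tag] unitary_op_adj enc_unitary_unitary) simp_all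

text \<open>The reject state is added incoherently, so decryption creates no coherence between
  acceptance and rejection.\<close>

lemma decrypt_diag: "decrypt m t V \<kappa> \<rho> None (Some x) = 0" "decrypt m t V \<kappa> \<rho> (Some x) None = 0"
  by (simp_all add: decrypt_eq measure_tag_def scale_def ketbra_def)

lemma proj_acc_apply: "proj_acc m X x y = (if x \<in> Some ` bitstr m \<and> y \<in> Some ` bitstr m then X x y else 0)"
proof -
  have "proj_acc m X = sandwich (msg_bot m) (\<lambda>b a. if b \<in> Some ` bitstr m \<and> a = id b then 1 else 0) X"
    unfolding proj_acc_def by (rule arg_cong[of _ _ "\<lambda>K. sandwich _ K X"])
      (auto simp: id_op_def ketbra_def msg_bot_def fun_eq_iff)
  also have "\<dots> = pull (Some ` bitstr m) id X"
    by (rule pull_sandwich[symmetric]) (auto simp: msg_bot_def)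
  finally show ?thesis by (simp add: pull_def)
qed

lemma proj_rej_apply: "proj_rej m X x y = (if x = None \<and> y = None then X x y else 0)"
proof -
  have "proj_rej m X = sandwich (msg_bot m) (\<lambda>b a. if b \<in> {None} \<and> a = id b then 1 else 0) X"
    unfolding proj_rej_def by (rule arg_cong[of _ _ "\<lambda>K. sandwich _ K X"])
      (auto simp: ketbra_def fun_eq_iff)
  also have "\<dots> = pull {None} id X"
    by (rule pull_sandwich[symmetric]) (auto simp: msg_bot_def)
  finally show ?thesis by (simp add: pull_def)
qed

lemma cp_proj: "cp_map (msg_bot m) (msg_bot m) (proj_acc m)" "cp_map (msg_bot m) (msg_bot m) (proj_rej m)"
proof -
  have "cp_map (msg_bot m) (msg_bot m) (pull (Some ` bitstr m) id)"
    by (intro cp_pull) (auto simp: msg_bot_def)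
  then show "cp_map (msg_bot m) (msg_bot m) (proj_acc m)"
    by (rule cp_cong) (auto simp: fun_eq_iff proj_acc_apply pull_def)
  have "cp_map (msg_bot m) (msg_bot m) (pull {None} id)"
    by (intro cp_pull) (auto simp: msg_bot_def)
  then show "cp_map (msg_bot m) (msg_bot m) (proj_rej m)"
    by (rule cp_cong) (auto simp: fun_eq_iff proj_rej_apply pull_def)
qed

text \<open>The two projections discard only the blocks between acceptance and rejection, and those
  do not contribute to the trace.\<close>

lemma cptp_reveal_key:
  assumes "finite S" "finite Q" "Inl \<kappa> \<in> Q" "Inr (f \<kappa>) \<in> Q"
  shows "cptp (msg_bot m \<times> S) ((msg_bot m \<times> S) \<times> Q) (reveal_key m f \<kappa>)"
  unfolding cptp_def
proof
  show "cp_map (msg_bot m \<times> S) ((msg_bot m \<times> S) \<times> Q) (reveal_key m f \<kappa>)"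
    unfolding reveal_key_def[abs_def] using assms
    by (intro cp_add cp_comp[OF cp_on_fst cp_tensor_ketbra] cp_proj) auto
  have "trace (msg_bot m \<times> S) (on_fst (proj_acc m) X) + trace (msg_bot m \<times> S) (on_fst (proj_rej m) X)
      = trace (msg_bot m \<times> S) X" for X
    unfolding trace_def sum.cartesian_product' sum.distrib[symmetric]
    by (intro sum.cong refl) (auto simp: on_fst_apply proj_acc_apply proj_rej_apply msg_bot_def)
  then show "trace_preserving (msg_bot m \<times> S) ((msg_bot m \<times> S) \<times> Q) (reveal_key m f \<kappa>)"
    using assms by (auto simp: trace_preserving_def reveal_key_def trace_add trace_tensor_ketbra)
qed

lemma cp_attach_ent:
  assumes "finite S"
  shows "cp_map S (bitstr m \<times> cipher m t \<times> S) (attach_ent m t)"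
proof (rule cp_cong)
  \<comment> \<open>The labels allowed by the entangled pair and the zero tag; two amplitudes
    \<open>1 / sqrt (2 ^ m)\<close> combine to the prefactor.\<close>
  let ?B = "{(a', (a, c), s) |a' a c s. a \<in> bitstr m \<and> a' = a \<and> c = zeros t \<and> s \<in> S}"
  show "cp_map S (bitstr m \<times> cipher m t \<times> S)
      (\<lambda>X. scale (complex_of_real (1 / 2 ^ m)) (pull ?B (\<lambda>(a', (a, c), s). s) X))"
    using assms by (intro cp_scale cp_pull) auto
  fix X :: "'a oper" assume X: "X \<in> ops S"
  have sq: "complex_of_real (1 / sqrt (2 ^ m)) * complex_of_real (1 / sqrt (2 ^ m)) = complex_of_real (1 / 2 ^ m)"
    unfolding of_real_mult[symmetric] by simp
  show "attach_ent m t X = scale (complex_of_real (1 / 2 ^ m)) (pull ?B (\<lambda>(a', (a, c), s). s) X)"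
  proof (intro ext)
    fix x y :: "bits \<times> (bits \<times> bits) \<times> 'a"
    obtain a' a c s b' b d s' where [simp]: "x = (a', (a, c), s)" "y = (b', (b, d), s')"
      by (metis prod.collapse)
    show "attach_ent m t X x y = scale (complex_of_real (1 / 2 ^ m)) (pull ?B (\<lambda>(a', (a, c), s). s) X) x y"
      using opsD[OF X, of s s'] sq by (auto simp: attach_ent_def scale_def pull_def max_ent_def ketbra_def)
  qed
qed

lemma cp_project_ent:
  assumes "finite S"
  shows "cp_map (bitstr m \<times> cipher m t \<times> S) S (project_ent m t)"
proof (rule cp_cong)
  \<comment> \<open>The single Kraus operator: the bra of the entangled pair and of the zero tag,
    with the identity on the side information.\<close>
  let ?K = "\<lambda>s (a', (a, c), s'). if s \<in> S \<and> s' = s \<and> c = zeros t then cnj (max_ent m a' a) else 0"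
  show "cp_map (bitstr m \<times> cipher m t \<times> S) S (sandwich (bitstr m \<times> cipher m t \<times> S) ?K)"
    using assms by (intro cp_sandwich) auto
  fix X :: "(bits \<times> (bits \<times> bits) \<times> 'a) oper" assume X: "X \<in> ops (bitstr m \<times> cipher m t \<times> S)"
  have *: "(\<Sum>x\<in>bitstr m \<times> cipher m t \<times> S. ?K s x * h x)
      = (if s \<in> S then \<Sum>a'\<in>bitstr m. \<Sum>a\<in>bitstr m. cnj (max_ent m a' a) * h (a', (a, zeros t), s) else 0)"
    for s h
  proof -
    have "(\<Sum>x\<in>bitstr m \<times> cipher m t \<times> S. ?K s x * h x)
      = (\<Sum>a'\<in>bitstr m. \<Sum>a\<in>bitstr m. \<Sum>c\<in>bitstr t. \<Sum>s'\<in>S. if s' = s then if c = zeros t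
            then cnj (max_ent m a' a) * h (a', (a, zeros t), s) else 0 else 0)"
      unfolding sum.cartesian_product' by (intro sum.cong refl) auto
    also have "\<dots> = (if s \<in> S then \<Sum>a'\<in>bitstr m. \<Sum>a\<in>bitstr m. cnj (max_ent m a' a) * h (a', (a, zeros t), s) else 0)"
      using assms by simp
    finally show ?thesis .
  qed
  have **: "(\<Sum>x\<in>bitstr m \<times> cipher m t \<times> S. h x * cnj (?K s x))
      = (if s \<in> S then \<Sum>a'\<in>bitstr m. \<Sum>a\<in>bitstr m. h (a', (a, zeros t), s) * max_ent m a' a else 0)"
    for s h
    using arg_cong[OF *[of s "\<lambda>x. cnj (h x)"], of cnj] by (simp add: mult.commute)
  show "project_ent m t X = sandwich (bitstr m \<times> cipher m t \<times> S) ?K X"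
  proof (intro ext)
    fix s s'
    have "sandwich (bitstr m \<times> cipher m t \<times> S) ?K X s s'
      = (\<Sum>x\<in>bitstr m \<times> cipher m t \<times> S. ?K s x * (\<Sum>y\<in>bitstr m \<times> cipher m t \<times> S. X x y * cnj (?K s' y)))"
      by (simp only: sandwich_apply sum_distrib_left mult.assoc)
    also have "\<dots> = (if s \<in> S \<and> s' \<in> S then project_ent m t X s s' else 0)"
      unfolding * ** by (simp add: project_ent_def sum_distrib_left mult.assoc)
    also have "\<dots> = project_ent m t X s s'"
      using X by (auto simp: project_ent_def opsD)
    finally show "project_ent m t X s s' = sandwich (bitstr m \<times> cipher m t \<times> S) ?K X s s'" by simp
  qed
qed

lemma cp_acc_sim:
  assumes S: "finite S" "finite U" and A: "cp_map (cipher m t \<times> S) (cipher m t \<times> U) \<A>"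
    and V: "\<And>k. k \<in> K0 \<Longrightarrow> unitary_op (cipher m t) (V k)"
  shows "cp_map S U (acc_sim m t K0 V \<A>)"
  unfolding acc_sim_def[abs_def] Let_def
proof (intro cp_avg)
  fix \<kappa> assume "\<kappa> \<in> K0 \<times> pads m t"
  then have U: "unitary_op (cipher m t) (enc_unitary m t V \<kappa>)" using V by (auto intro!: enc_unitary_unitary)
  have c: "cp_map (cipher m t) (cipher m t) (sandwich (cipher m t) W)" if "unitary_op (cipher m t) W" for W
    using cptp_unitary[OF finite_cipher that] by (simp add: cptp_def)
  note c1 = cp_on_snd[OF _ _ finite_bitstr cp_on_fst[OF finite_cipher finite_cipher _ c[OF U]], of S m]
  note c2 = cp_on_snd[OF _ _ finite_bitstr cp_on_fst[OF finite_cipher finite_cipher _ c[OF unitary_op_adj[OF U]]], of U m]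
  show "cp_map S U (\<lambda>\<rho>. project_ent m t (on_snd (on_fst (sandwich (cipher m t) (adj (enc_unitary m t V \<kappa>))))
     (on_snd \<A> (on_snd (on_fst (sandwich (cipher m t) (enc_unitary m t V \<kappa>))) (attach_ent m t \<rho>)))))"
    using S by (intro cp_comp[OF cp_comp[OF cp_comp[OF cp_comp[OF cp_attach_ent c1] cp_on_snd[OF _ _ _ A]] c2] cp_project_ent]) auto
qed

lemma cp_tr_fst: "finite A \<Longrightarrow> finite B \<Longrightarrow> cp_map (A \<times> B) B (tr_fst A)"
proof (rule cp_cong[OF cp_sum])
  assume *: "finite A" "finite B"
  show "cp_map (A \<times> B) B (pull B (Pair a))" if "a \<in> A" for a
    using * that by (intro cp_pull) auto
  fix X :: "('a \<times> 'b) oper" assume X: "X \<in> ops (A \<times> B)"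
  have "(\<Sum>a\<in>A. pull B (Pair a) X) x y = tr_fst A X x y" for x y
  proof -
    have "(\<Sum>a\<in>C. pull B (Pair a) X) x y = (\<Sum>a\<in>C. X (a, x) (a, y))" if "finite C" for C
      using that X by (induction C) (auto simp: pull_def opsD)
    then show ?thesis using * by (simp add: tr_fst_def)
  qed
  then show "tr_fst A X = (\<Sum>a\<in>A. pull B (Pair a) X)" by (simp add: fun_eq_iff)
qed

lemma cp_ketbra_tensor:
  assumes "finite U" "q \<in> Q"
  shows "cp_map U (Q \<times> U) (tensor (ketbra q))"
  by (rule cp_cong[OF cp_pull[of U snd "{q} \<times> U"]])
    (use assms in \<open>auto simp: tensor_def ketbra_def pull_def fun_eq_iff opsD\<close>)

lemma sum_apply: "(\<Sum>i\<in>I. (F i :: 'a oper)) x y = (\<Sum>i\<in>I. F i x y)"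
  by (induction I rule: infinite_finite_induct) auto

lemma avg_apply: "avg I F x y = (\<Sum>i\<in>I. F i x y) / of_nat (card I)"
  by (simp add: avg_def scale_def sum_apply)

lemma tensor_avg: "tensor X (avg I F) = avg I (\<lambda>i. tensor X (F i))"
  by (auto simp: tensor_def avg_apply fun_eq_iff sum_distrib_left sum_divide_distrib)

text \<open>The ideal channel stripped of its key register; in this form it becomes part of the
  adversary against the second message.\<close>

definition bot_or_pass :: "nat \<Rightarrow> ('s, 'u) omap \<Rightarrow> ('s, 'u) omap \<Rightarrow> (bits \<times> 's, bits option \<times> 'u) omap" where
  "bot_or_pass m Sa Sr \<rho> = on_fst embed (on_snd Sa \<rho>) + tensor (ketbra None) (Sr (tr_fst (bitstr m) \<rho>))"

lemma cp_pass:
  assumes "finite S" "finite U" "cp_map S U Sa"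
  shows "cp_map (bitstr m \<times> S) (msg_bot m \<times> U) (\<lambda>\<rho>. on_fst embed (on_snd Sa \<rho>))"
  using assms(1,2) by (intro cp_comp[OF cp_on_snd[OF _ _ _ assms(3)] cp_on_fst[OF _ _ _ cp_embed_msg]]) auto

lemma cp_bot:
  assumes "finite S" "finite U" "cp_map S U Sr"
  shows "cp_map (bitstr m \<times> S) (msg_bot m \<times> U) (\<lambda>\<rho>. tensor (ketbra None) (Sr (tr_fst (bitstr m) \<rho>)))"
  using assms(1,2)
  by (intro cp_comp[OF cp_comp[OF cp_tr_fst assms(3)] cp_ketbra_tensor]) (auto simp: msg_bot_def)

lemma trace_on_snd_tr_fst:
  assumes "linear_omap S U Sa" "X \<in> ops (A \<times> S)"
  shows "trace (A \<times> U) (on_snd Sa X) = trace U (Sa (tr_fst A X))"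
proof -
  have "tr_fst A X = (\<Sum>a\<in>A. block a a X)"
    by (simp add: tr_fst_def block_def fun_eq_iff sum_apply)
  then have "Sa (tr_fst A X) = (\<Sum>a\<in>A. Sa (block a a X))"
    using assms by (simp add: linear_omap_sum block_ops)
  then show ?thesis by (simp add: trace_sum) (simp add: trace_def sum.cartesian_product' on_snd_apply)
qed

text \<open>In either branch the output trace depends only on the reduced state on \<open>S\<close>,
  so the two branches add up to the trace of \<open>Sa + Sr\<close> on that state.\<close>

lemma cptp_bot_or_pass:
  assumes S: "finite S" "finite U" and cp: "cp_map S U Sa" "cp_map S U Sr"
    and tp: "trace_preserving S U (Sa + Sr)"
  shows "cptp (bitstr m \<times> S) (msg_bot m \<times> U) (bot_or_pass m Sa Sr)"
  unfolding cptp_def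
proof
  show "cp_map (bitstr m \<times> S) (msg_bot m \<times> U) (bot_or_pass m Sa Sr)"
    unfolding bot_or_pass_def[abs_def] by (intro cp_add cp_pass cp_bot assms)
  show "trace_preserving (bitstr m \<times> S) (msg_bot m \<times> U) (bot_or_pass m Sa Sr)"
    unfolding trace_preserving_def
  proof
    fix X :: "(bits \<times> 'a) oper" assume X: "X \<in> ops (bitstr m \<times> S)"
    let ?T = "tr_fst (bitstr m) X"
    have T: "?T \<in> ops S" using linear_omapD(1)[OF cp_linear[OF cp_tr_fst[OF finite_bitstr S(1)]] X] .
    have "trace (msg_bot m \<times> U) (on_fst embed (on_snd Sa X)) = trace (bitstr m \<times> U) (on_snd Sa X)"
      by (simp add: trace_def sum.cartesian_product' msg_bot_def sum.reindex on_fst_apply)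
    also have "\<dots> = trace U (Sa ?T)" by (rule trace_on_snd_tr_fst[OF cp_linear[OF cp(1)] X])
    finally have 1: "trace (msg_bot m \<times> U) (on_fst embed (on_snd Sa X)) = trace U (Sa ?T)" .
    have 2: "trace (msg_bot m \<times> U) (tensor (ketbra None) (Sr ?T)) = trace U (Sr ?T)"
      by (simp add: trace_def sum.cartesian_product' msg_bot_def sum.reindex tensor_def ketbra_def)
    have "trace (msg_bot m \<times> U) (bot_or_pass m Sa Sr X) = trace U ((Sa + Sr) ?T)"
      by (simp add: bot_or_pass_def trace_add 1 2)
    also have "\<dots> = trace S ?T" using tp T by (simp add: trace_preserving_def)
    also have "\<dots> = trace (bitstr m \<times> S) X"
      by (simp add: trace_def tr_fst_def sum.cartesian_product' sum.swap[of _ S])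
    finally show "trace (msg_bot m \<times> U) (bot_or_pass m Sa Sr X) = trace (bitstr m \<times> S) X" .
  qed
qed

lemma cp_ideal_channel:
  assumes S: "finite S" "finite U" "finite Q" and "cp_map S U Sa" "cp_map S U Sr"
    and "\<And>\<kappa>. \<kappa> \<in> I \<Longrightarrow> g \<kappa> \<in> Q" "\<And>\<kappa>. \<kappa> \<in> J \<Longrightarrow> h \<kappa> \<in> Q"
  shows "cp_map (bitstr m \<times> S) ((msg_bot m \<times> U) \<times> Q)
    (ideal_channel m Sa Sr (avg I (\<lambda>\<kappa>. ketbra (g \<kappa>))) (avg J (\<lambda>\<kappa>. ketbra (h \<kappa>))))"
  unfolding ideal_channel_def[abs_def] tensor_avg using assms
  by (intro cp_add cp_avg cp_comp[OF cp_pass cp_tensor_ketbra]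
      cp_comp[OF cp_bot cp_tensor_ketbra]) auto

text \<open>The body of \<open>real_channel\<close> with a freer type: there the adversary must
  return the side-information register it was given, whereas the adversary against the second
  message enlarges \<open>M\<^sub>1\<close> by the reject label.\<close>

definition gen_real ::
    "nat \<Rightarrow> nat \<Rightarrow> 'k set \<Rightarrow> ('k \<Rightarrow> (bits \<times> bits) oper) \<Rightarrow> ('k key \<Rightarrow> 'f) \<Rightarrow>
     ((bits \<times> bits) \<times> 's, (bits \<times> bits) \<times> 'u) omap \<Rightarrow>
     (bits \<times> 's, (bits option \<times> 'u) \<times> ('k key + 'f)) omap" where
  "gen_real m t K0 V f \<A> \<rho> = avg (K0 \<times> pads m t) (\<lambda>\<kappa>.
     reveal_key m f \<kappa> (on_fst (decrypt m t V \<kappa>) (\<A> (on_fst (encrypt m t V \<kappa>) \<rho>))))"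

lemma gen_real_eq: "gen_real m t K0 V f \<A> = real_channel m t K0 V f \<A>"
  by (simp add: gen_real_def real_channel_def fun_eq_iff)

lemma cptp_gen_real:
  assumes S: "finite S" "finite U" "finite K0" "K0 \<noteq> {}"
    and A: "cptp (cipher m t \<times> S) (cipher m t \<times> U) \<A>"
    and V: "\<And>k. k \<in> K0 \<Longrightarrow> unitary_op (cipher m t) (V k)"
  shows "cptp (bitstr m \<times> S) ((msg_bot m \<times> U) \<times> ((K0 \<times> pads m t) <+> f ` (K0 \<times> pads m t)))
     (gen_real m t K0 V f \<A>)"
  unfolding gen_real_def[abs_def]
proof (intro cptp_avg)
  fix \<kappa> assume \<kappa>: "\<kappa> \<in> K0 \<times> pads m t"
  then have V: "unitary_op (cipher m t) (V (fst \<kappa>))" using V by auto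
  show "cptp (bitstr m \<times> S) ((msg_bot m \<times> U) \<times> ((K0 \<times> pads m t) <+> f ` (K0 \<times> pads m t)))
     (\<lambda>\<rho>. reveal_key m f \<kappa> (on_fst (decrypt m t V \<kappa>) (\<A> (on_fst (encrypt m t V \<kappa>) \<rho>))))"
    using S \<kappa> by (intro cptp_comp[OF cptp_comp[OF cptp_comp[OF cptp_on_fst[OF _ _ _ cptp_encrypt[of m t V \<kappa>]] A]
      cptp_on_fst[OF _ _ _ cptp_decrypt[of m t V \<kappa>]]] cptp_reveal_key] V) auto
qed (use S in auto)

section \<open>QCA-R with arbitrary side-information registers\<close>

lemma cptp_linear: "cptp A B \<Phi> \<Longrightarrow> linear_omap A B \<Phi>"
  by (simp add: cptp_def cp_map_def)

text \<open>The distance carries a factor 1/2, so \<epsilon> becomes \<open>2 * \<epsilon>\<close>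
  for trace norms. The hybrid argument is run on these, outside the extended reals.\<close>

lemma diamond_distD:
  fixes d :: nat
  assumes "diamond_dist A B \<Phi> \<Psi> \<le> ereal \<epsilon>" "1 \<le> d" "density ({..<d} \<times> A) \<rho>"
  shows "trace_norm ({..<d} \<times> B) (on_snd \<Phi> \<rho> - on_snd \<Psi> \<rho>) \<le> 2 * \<epsilon>"
proof -
  let ?N = "diamond_norm A B (\<Phi> - \<Psi>)"
  have "ereal (trace_norm ({..<d} \<times> B) (on_snd (\<Phi> - \<Psi>) \<rho>)) \<le> ?N"
    unfolding diamond_norm_def using assms by (intro Sup_upper CollectI exI[of _ d] exI[of _ \<rho>]) auto
  moreover have "?N / 2 \<le> ereal \<epsilon>" using assms by (simp add: diamond_dist_def)
  then have "?N \<le> ereal (2 * \<epsilon>)" by (cases ?N) (auto simp: field_simps)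
  ultimately show ?thesis by (metis ereal_less_eq(3) on_snd_diff order_trans)
qed

lemma diamond_distI:
  assumes "\<And>(d :: nat) \<rho>. density ({..<d} \<times> A) \<rho> \<Longrightarrow>
    trace_norm ({..<d} \<times> B) (on_snd \<Phi> \<rho> - on_snd \<Psi> \<rho>) \<le> 2 * \<epsilon>"
  shows "diamond_dist A B \<Phi> \<Psi> \<le> ereal \<epsilon>"
proof -
  let ?N = "diamond_norm A B (\<Phi> - \<Psi>)"
  have "?N \<le> ereal (2 * \<epsilon>)"
    unfolding diamond_norm_def using assms by (intro Sup_least) (auto simp: on_snd_diff)
  then show ?thesis unfolding diamond_dist_def by (cases ?N) (auto simp: field_simps)
qed

lemma bij_betw_relabel:
  assumes "bij_betw e D E"
  shows "bij_betw (\<lambda>(i, a). (e i, a)) (D \<times> A) (E \<times> A)"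
proof -
  have "(\<lambda>(i, a). (e i, a)) ` (D \<times> A) = e ` D \<times> A" by force
  then show ?thesis using assms by (auto simp: bij_betw_def inj_on_def)
qed

text \<open>A bijection of labels is a channel, so a bound for numbered ancillas holds for every
  finite ancilla. The first hybrid step needs it for an ancilla containing message and ciphertext
  registers.\<close>

lemma trace_norm_on_snd_le:
  assumes "\<And>(d :: nat) \<rho>. 1 \<le> d \<Longrightarrow> density ({..<d} \<times> A) \<rho> \<Longrightarrow>
      trace_norm ({..<d} \<times> B) (on_snd \<Phi> \<rho> - on_snd \<Psi> \<rho>) \<le> r"
    and fin: "finite A" "finite B" "finite E" and cp: "cp_map A B \<Phi>" "cp_map A B \<Psi>"
    and \<rho>: "density (E \<times> A) \<rho>"
  shows "trace_norm (E \<times> B) (on_snd \<Phi> \<rho> - on_snd \<Psi> \<rho>) \<le> r"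
proof -
  obtain e g where e: "bij_betw e {..<card E} E" and g: "bij_betw g E {..<card E}"
    and eg: "\<And>c. c \<in> E \<Longrightarrow> g c \<in> {..<card E} \<and> e (g c) = c"
    using obtain_labels[OF fin(3)] by blast
  let ?n = "{..<card E}"
  let ?\<rho> = "pull (?n \<times> A) (\<lambda>(i, a). (e i, a)) \<rho>"
  have c: "cptp (E \<times> A) (?n \<times> A) (pull (?n \<times> A) (\<lambda>(i, a). (e i, a)))"
    using bij_betw_relabel[OF e] fin by (intro cptp_reindex) auto
  then have \<rho>': "density (?n \<times> A) ?\<rho>" using density_cptp[OF c _ _ \<rho>] fin by simp
  \<comment> \<open>A density operator has trace 1, so its ancilla is nonempty, as the premise
    \<open>1 \<le> d\<close> demands.\<close>
  have "E \<noteq> {}" using \<rho> by (auto simp: density_def trace_def)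
  then have n: "1 \<le> card E" using fin by (simp add: Suc_le_eq card_gt_0_iff)
  have pull: "cptp (?n \<times> B) (E \<times> B) (pull (E \<times> B) (\<lambda>(c, b). (g c, b)))"
    using bij_betw_relabel[OF g] fin by (intro cptp_reindex) auto
  have \<rho>_ops: "\<rho> \<in> ops (E \<times> A)" using \<rho> by (simp add: density_def psd_ops)
  let ?g = "pull (E \<times> B) (\<lambda>(c, b). (g c, b))"
  have 1: "on_snd \<Phi> \<rho> = ?g (on_snd \<Phi> ?\<rho>)" "on_snd \<Psi> \<rho> = ?g (on_snd \<Psi> ?\<rho>)"
    by (rule on_snd_relabel[OF cp_linear[OF cp(1)] \<rho>_ops eg] on_snd_relabel[OF cp_linear[OF cp(2)] \<rho>_ops eg], assumption)+
  have "psd (?n \<times> B) (on_snd \<Phi> ?\<rho>)" "psd (?n \<times> B) (on_snd \<Psi> ?\<rho>)"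
    using \<rho>' psd_on_snd[OF fin(1,2) _ cp(1)] psd_on_snd[OF fin(1,2) _ cp(2)] by (auto simp: density_def)
  then have "trace_norm (E \<times> B) (?g (on_snd \<Phi> ?\<rho>) - ?g (on_snd \<Psi> ?\<rho>))
      \<le> trace_norm (?n \<times> B) (on_snd \<Phi> ?\<rho> - on_snd \<Psi> ?\<rho>)"
    using fin by (intro trace_norm_cptp[OF pull]) auto
  also have "\<dots> \<le> r" by (rule assms(1)[OF n \<rho>'])
  finally show ?thesis by (simp only: 1)
qed

section \<open>Commuting maps on different registers\<close>

definition munit :: "'a \<Rightarrow> 'a \<Rightarrow> 'a oper" where
  "munit a a' = (\<lambda>x y. if x = a \<and> y = a' then 1 else 0)"

lemma linear_expand:
  assumes "finite A" "linear_omap A B \<Phi>" "X \<in> ops A"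
  shows "\<Phi> X b b' = (\<Sum>a\<in>A. \<Sum>a'\<in>A. X a a' * \<Phi> (munit a a') b b')"
proof -
  have u: "munit a a' \<in> ops A" if "a \<in> A" "a' \<in> A" for a a'
    using that by (auto simp: munit_def ops_iff)
  have "X = (\<Sum>a\<in>A. \<Sum>a'\<in>A. scale (X a a') (munit a a'))"
  proof (intro ext)
    fix x y
    have "(\<Sum>a\<in>A. \<Sum>a'\<in>A. scale (X a a') (munit a a')) x y
        = (\<Sum>a\<in>A. \<Sum>a'\<in>A. if a' = y then (if a = x then X a a' else 0) else 0)"
      unfolding sum_apply by (intro sum.cong refl) (auto simp: scale_def munit_def)
    also have "\<dots> = X x y" using assms by (cases "x \<in> A"; cases "y \<in> A") (simp_all add: opsD)
    finally show "X x y = (\<Sum>a\<in>A. \<Sum>a'\<in>A. scale (X a a') (munit a a')) x y" ..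
  qed
  then have "\<Phi> X = \<Phi> (\<Sum>a\<in>A. \<Sum>a'\<in>A. scale (X a a') (munit a a'))" by simp
  also have "\<dots> = (\<Sum>a\<in>A. \<Phi> (\<Sum>a'\<in>A. scale (X a a') (munit a a')))"
    using u by (intro linear_omap_sum[OF assms(2)] ops_sum ops_scale)
  also have "\<dots> = (\<Sum>a\<in>A. \<Sum>a'\<in>A. scale (X a a') (\<Phi> (munit a a')))"
    using u by (intro sum.cong refl) (simp add: linear_omap_sum[OF assms(2)] ops_scale linear_omapD(3)[OF assms(2)])
  finally show ?thesis by (simp add: sum_apply scale_def)
qed

lemma fst_block_ops: "X \<in> ops (A \<times> C) \<Longrightarrow> (\<lambda>a a'. X (a, c) (a', c')) \<in> ops A"
  by (auto simp: ops_iff)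

text \<open>Expanded in matrix units, both orders give the same fourfold sum. The supports of the
  intermediate matrices have to be tracked, since linearity is known only on
  \<open>ops\<close>.\<close>

lemma on_fst_on_snd:
  fixes \<Phi> :: "('a, 'b) omap" and \<Psi> :: "('c, 'd) omap"
  assumes fin: "finite A" "finite C" and L: "linear_omap A B \<Phi>" "linear_omap C D \<Psi>" and X: "X \<in> ops (A \<times> C)"
  shows "on_fst \<Phi> (on_snd \<Psi> X) = on_snd \<Psi> (on_fst \<Phi> X)"
proof (intro ext)
  fix x y :: "'b \<times> 'd"
  obtain b d b' d' where [simp]: "x = (b, d)" "y = (b', d')" by (cases x; cases y)
  have 1: "(\<lambda>a a'. \<Psi> (block a a' X) d d') \<in> ops A"
    using block_zero[OF X] linear_omap_zero[OF L(2)] by (auto simp: ops_iff)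
  have 2: "(\<lambda>c c'. \<Phi> (\<lambda>a a'. X (a, c) (a', c')) b b') \<in> ops C"
  proof -
    have "(\<lambda>a a'. X (a, c) (a', c')) = 0" if "c \<notin> C \<or> c' \<notin> C" for c c'
      using that X by (auto simp: fun_eq_iff ops_iff)
    then show ?thesis using linear_omap_zero[OF L(1)] by (auto simp: ops_iff)
  qed
  have 3: "(\<lambda>a a'. X (a, c) (a', c')) \<in> ops A" for c c' by (rule fst_block_ops[OF X])
  have "on_fst \<Phi> (on_snd \<Psi> X) x y = \<Phi> (\<lambda>a a'. \<Psi> (block a a' X) d d') b b'"
    by (simp add: on_fst_apply on_snd_apply)
  also have "\<dots> = (\<Sum>a\<in>A. \<Sum>a'\<in>A. \<Sum>c\<in>C. \<Sum>c'\<in>C.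
      X (a, c) (a', c') * \<Psi> (munit c c') d d' * \<Phi> (munit a a') b b')"
    by (subst linear_expand[OF fin(1) L(1) 1], intro sum.cong refl,
        subst linear_expand[OF fin(2) L(2) block_ops[OF X]]) (simp add: block_def sum_distrib_right)
  also have "\<dots> = (\<Sum>a\<in>A. \<Sum>c\<in>C. \<Sum>a'\<in>A. \<Sum>c'\<in>C.
      X (a, c) (a', c') * \<Psi> (munit c c') d d' * \<Phi> (munit a a') b b')"
    by (intro sum.cong refl sum.swap)
  also have "\<dots> = (\<Sum>c\<in>C. \<Sum>a\<in>A. \<Sum>a'\<in>A. \<Sum>c'\<in>C.
      X (a, c) (a', c') * \<Psi> (munit c c') d d' * \<Phi> (munit a a') b b')"
    by (rule sum.swap)
  also have "\<dots> = (\<Sum>c\<in>C. \<Sum>a\<in>A. \<Sum>c'\<in>C. \<Sum>a'\<in>A.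
      X (a, c) (a', c') * \<Psi> (munit c c') d d' * \<Phi> (munit a a') b b')"
    by (intro sum.cong refl sum.swap)
  also have "\<dots> = (\<Sum>c\<in>C. \<Sum>c'\<in>C. \<Sum>a\<in>A. \<Sum>a'\<in>A.
      X (a, c) (a', c') * \<Psi> (munit c c') d d' * \<Phi> (munit a a') b b')"
    by (intro sum.cong refl sum.swap)
  also have "\<dots> = (\<Sum>c\<in>C. \<Sum>c'\<in>C. \<Phi> (\<lambda>a a'. X (a, c) (a', c')) b b' * \<Psi> (munit c c') d d')"
    by (intro sum.cong refl, subst linear_expand[OF fin(1) L(1) 3]) (simp add: sum_distrib_left sum_distrib_right mult_ac)
  also have "\<dots> = \<Psi> (\<lambda>c c'. \<Phi> (\<lambda>a a'. X (a, c) (a', c')) b b') d d'"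
    by (rule linear_expand[OF fin(2) L(2) 2, symmetric])
  also have "\<dots> = on_snd \<Psi> (on_fst \<Phi> X) x y"
    by (simp add: on_snd_def on_fst_def)
  finally show "on_fst \<Phi> (on_snd \<Psi> X) x y = on_snd \<Psi> (on_fst \<Phi> X) x y" .
qed

lemma on_fst_tensor:
  fixes \<Phi> :: "('a, 'b) omap" and Y :: "'c oper"
  assumes "linear_omap A B \<Phi>" "X \<in> ops A"
  shows "on_fst \<Phi> (tensor X Y) = tensor (\<Phi> X) Y"
proof (intro ext)
  fix x y :: "'b \<times> 'c"
  obtain b c b' c' where [simp]: "x = (b, c)" "y = (b', c')" by (cases x; cases y)
  have "(\<lambda>a a'. tensor X Y (a, c) (a', c')) = scale (Y c c') X"
    by (simp add: tensor_def scale_def mult.commute)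
  then show "on_fst \<Phi> (tensor X Y) x y = tensor (\<Phi> X) Y x y"
    by (simp add: on_fst_apply linear_omapD(3)[OF assms] scale_apply) (simp add: tensor_def)
qed

lemma on_snd_tensor:
  fixes \<Phi> :: "('a, 'b) omap" and Y :: "'c oper"
  assumes "linear_omap A B \<Phi>" "X \<in> ops A"
  shows "on_snd \<Phi> (tensor Y X) = tensor Y (\<Phi> X)"
proof (intro ext)
  fix x y :: "'c \<times> 'b"
  obtain b c b' c' where [simp]: "x = (c, b)" "y = (c', b')" by (cases x; cases y)
  have "block c c' (tensor Y X) = scale (Y c c') X"
    by (simp add: tensor_def scale_def block_def)
  then show "on_snd \<Phi> (tensor Y X) x y = tensor Y (\<Phi> X) x y"
    by (simp add: on_snd_apply linear_omapD(3)[OF assms] scale_apply) (simp add: tensor_def)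
qed

lemma linear_avg:
  assumes "linear_omap A B \<Phi>" "\<And>i. i \<in> I \<Longrightarrow> X i \<in> ops A"
  shows "\<Phi> (avg I X) = avg I (\<lambda>i. \<Phi> (X i))"
  unfolding avg_def using assms by (simp add: linear_omapD(3)[OF assms(1)] ops_sum linear_omap_sum)

lemma tr_fst_block: "tr_fst A X = (\<Sum>a\<in>A. block a a X)"
  by (simp add: tr_fst_def block_def fun_eq_iff sum_apply)

lemma block_on_snd: "block a a' (on_snd I X) = I (block a a' X)"
  by (simp add: block_def on_snd_def)

lemma tr_fst_on_snd:
  assumes "linear_omap S U I" "X \<in> ops (A \<times> S)"
  shows "tr_fst A (on_snd I X) = I (tr_fst A X)"
  using assms by (simp add: tr_fst_block block_on_snd linear_omap_sum block_ops)

text \<open>The left inverse dumps the part outside the image of the injection on a fixed label.\<close>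

lemma embed_register:
  assumes fin: "finite S" "S \<noteq> {}" "finite N" "card S \<le> card N"
  obtains I J where "cptp S N I" "cptp N S J" "\<And>X. X \<in> ops S \<Longrightarrow> J (I X) = X"
proof -
  obtain s0 where s0: "s0 \<in> S" using fin by blast
  obtain f where f: "inj_on f S" "f ` S \<subseteq> N"
    using card_le_inj[OF fin(1,3,4)] by blast
  define g where "g = inv_into S f"
  have g: "g (f s) = s" if "s \<in> S" for s using f that by (simp add: g_def inv_into_f_f)
  have bij: "bij_betw f S (f ` S)" using f by (simp add: bij_betw_def)
  define I where "I = (pull (f ` S) g :: 'a oper \<Rightarrow> 'b oper)"
  define J where "J = (\<lambda>X. pull S f X + (\<Sum>n\<in>N - f ` S. pull {s0} (\<lambda>_. n) X))"
  have cpI: "cp_map S N I" unfolding I_def using fin f g by (intro cp_pull) auto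
  have trI: "trace N (I X) = trace S X" for X
  proof -
    have "trace N (I X) = (\<Sum>n\<in>f ` S. X (g n) (g n))"
      unfolding trace_def I_def pull_def using f fin by (intro sum.mono_neutral_cong_right) auto
    also have "\<dots> = trace S X" using f g by (simp add: sum.reindex trace_def)
    finally show ?thesis .
  qed
  have cpJ: "cp_map N S J" unfolding J_def using fin f s0 by (intro cp_add cp_sum cp_pull) auto
  have trJ: "trace S (J X) = trace N X" for X
  proof -
    have "trace S (pull {s0} (\<lambda>_. n) X) = X n n" for n
      using s0 fin by (simp add: trace_def pull_def)
    then have "trace S (J X) = (\<Sum>s\<in>S. X (f s) (f s)) + (\<Sum>n\<in>N - f ` S. X n n)"
      by (simp add: J_def trace_add trace_sum) (simp add: trace_def pull_def)
    also have "(\<Sum>s\<in>S. X (f s) (f s)) = (\<Sum>n\<in>f ` S. X n n)" using f by (simp add: sum.reindex)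
    finally show ?thesis using f fin by (simp add: trace_def sum.subset_diff[of "f ` S" N] add.commute)
  qed
  have "J (I X) = X" if "X \<in> ops S" for X
  proof (intro ext)
    fix x y
    have "pull {s0} (\<lambda>_. n) (I X) = 0" if "n \<notin> f ` S" for n
      using that by (simp add: pull_def I_def fun_eq_iff)
    then have "J (I X) = pull S f (I X)" by (simp add: J_def)
    then show "J (I X) x y = X x y" using that g by (auto simp: pull_def I_def opsD)
  qed
  moreover have "cptp S N I" "cptp N S J"
    using cpI cpJ trI trJ by (auto simp: cptp_def trace_preserving_def)
  ultimately show ?thesis using that by blast
qed

section \<open>Naturality in the side-information register\<close>

lemma attach_ent_on_snd:
  assumes "linear_omap S N I" "\<rho> \<in> ops S"
  shows "attach_ent m t (I \<rho>) = on_snd (on_snd I) (attach_ent m t \<rho>)"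
proof (intro ext)
  fix x y :: "bits \<times> (bits \<times> bits) \<times> 'b"
  obtain a' a c s b' b d s' where [simp]: "x = (a', (a, c), s)" "y = (b', (b, d), s')"
    by (metis prod.collapse)
  let ?k = "max_ent m a' a * cnj (max_ent m b' b) * ketbra (zeros t) c d"
  have "block (a, c) (b, d) (block a' b' (attach_ent m t \<rho>)) = scale ?k \<rho>"
    by (simp add: block_def attach_ent_def scale_def)
  then show "attach_ent m t (I \<rho>) x y = on_snd (on_snd I) (attach_ent m t \<rho>) x y"
    using linear_omapD(3)[OF assms, of ?k] by (simp add: on_snd_apply attach_ent_def scale_def)
qed

text \<open>The projection is a linear combination of blocks of \<open>X\<close>, and a linear map
  on the side information passes through it.\<close>

lemma project_ent_on_snd:
  assumes "linear_omap S N I" "X \<in> ops (bitstr m \<times> cipher m t \<times> S)"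
  shows "project_ent m t (on_snd (on_snd I) X) = I (project_ent m t X)"
proof -
  let ?B = "\<lambda>a' a b' b. block (a, zeros t) (b, zeros t) (block a' b' X)"
  let ?k = "\<lambda>a' a b' b. cnj (max_ent m a' a) * max_ent m b' b"
  let ?S = "\<lambda>F. \<Sum>a'\<in>bitstr m. \<Sum>a\<in>bitstr m. \<Sum>b'\<in>bitstr m. \<Sum>b\<in>bitstr m. F a' a b' b"
  have B: "?B a' a b' b \<in> ops S" for a' a b' b
    using block_ops[OF block_ops[OF assms(2)]] .
  have "project_ent m t X = ?S (\<lambda>a' a b' b. scale (?k a' a b' b) (?B a' a b' b))"
    by (intro ext) (simp only: project_ent_def sum_apply scale_apply block_def mult_ac)
  then have "I (project_ent m t X) = ?S (\<lambda>a' a b' b. scale (?k a' a b' b) (I (?B a' a b' b)))"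
    using B by (simp add: linear_omap_sum[OF assms(1)] ops_sum ops_scale linear_omapD(3)[OF assms(1)])
  also have "\<dots> = project_ent m t (on_snd (on_snd I) X)"
    by (intro ext) (simp only: project_ent_def sum_apply scale_apply on_snd_apply mult_ac)
  finally show ?thesis ..
qed

lemma reveal_key_on_snd:
  fixes f :: "'k key \<Rightarrow> 'f"
  assumes S: "finite S" and I: "linear_omap S N I" and X: "X \<in> ops (msg_bot m \<times> S)"
  shows "reveal_key m f \<kappa> (on_snd I X) = on_fst (on_snd I) (reveal_key m f \<kappa> X)"
proof -
  note P = linear_on_fst[OF cp_linear[OF cp_proj(1)[of m]], of S] linear_on_fst[OF cp_linear[OF cp_proj(2)[of m]], of S]
  note L = linear_on_snd[OF I, of "msg_bot m"]
  have 1: "on_fst (proj_acc m) (on_snd I X) = on_snd I (on_fst (proj_acc m) X)"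
    by (rule on_fst_on_snd[OF finite_msg_bot S cp_linear[OF cp_proj(1)] I X])
  have 2: "on_fst (proj_rej m) (on_snd I X) = on_snd I (on_fst (proj_rej m) X)"
    by (rule on_fst_on_snd[OF finite_msg_bot S cp_linear[OF cp_proj(2)] I X])
  have t: "tensor Y Z \<in> ops ((msg_bot m \<times> S) \<times> UNIV)"
    if "Y \<in> ops (msg_bot m \<times> S)" for Y and Z :: "('k key + 'f) oper"
    using that by (auto simp: ops_iff tensor_def)
  show ?thesis
    unfolding reveal_key_def 1 2
    by (simp only: linear_omapD(2)[OF linear_on_fst[OF L] t[OF linear_omapD(1)[OF P(1) X]] t[OF linear_omapD(1)[OF P(2) X]]]
        on_fst_tensor[OF L linear_omapD(1)[OF P(1) X]] on_fst_tensor[OF L linear_omapD(1)[OF P(2) X]])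
qed

text \<open>Encryption, decryption and disclosure of the key leave the side information alone, so an
  intertwining relation between two adversaries passes to their real channels.\<close>

lemma gen_real_on_snd:
  assumes S: "finite S" "finite N" "finite U"
    and I: "linear_omap S N I" and J: "linear_omap U N' J"
    and A: "linear_omap (cipher m t \<times> S) (cipher m t \<times> U) \<A>"
    and A': "\<And>X. X \<in> ops (cipher m t \<times> S) \<Longrightarrow> \<A>' (on_snd I X) = on_snd J (\<A> X)"
    and V: "\<And>k. k \<in> K0 \<Longrightarrow> unitary_op (cipher m t) (V k)"
    and \<rho>: "\<rho> \<in> ops (bitstr m \<times> S)"
  shows "gen_real m t K0 V f \<A>' (on_snd I \<rho>) = on_fst (on_snd J) (gen_real m t K0 V f \<A> \<rho>)"
proof -
  let ?K = "K0 \<times> pads m t"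
  let ?X = "\<lambda>\<kappa>. on_fst (decrypt m t V \<kappa>) (\<A> (on_fst (encrypt m t V \<kappa>) \<rho>))"
  have 1: "reveal_key m f \<kappa> (on_fst (decrypt m t V \<kappa>) (\<A>' (on_fst (encrypt m t V \<kappa>) (on_snd I \<rho>))))
      = on_fst (on_snd J) (reveal_key m f \<kappa> (?X \<kappa>))
      \<and> reveal_key m f \<kappa> (?X \<kappa>) \<in> ops ((msg_bot m \<times> U) \<times> UNIV)"
    if \<kappa>: "\<kappa> \<in> ?K" for \<kappa>
  proof -
    have U: "unitary_op (cipher m t) (V (fst \<kappa>))" using V \<kappa> by auto
    have Le: "linear_omap (bitstr m) (cipher m t) (encrypt m t V \<kappa>)"
      using cptp_encrypt[of m t V \<kappa>] U by (simp add: cptp_def cp_linear)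
    have Ld: "linear_omap (cipher m t) (msg_bot m) (decrypt m t V \<kappa>)"
      using cptp_decrypt[of m t V \<kappa>] U by (simp add: cptp_def cp_linear)
    have Y: "on_fst (encrypt m t V \<kappa>) \<rho> \<in> ops (cipher m t \<times> S)"
      by (rule linear_omapD(1)[OF linear_on_fst[OF Le] \<rho>])
    have Z: "\<A> (on_fst (encrypt m t V \<kappa>) \<rho>) \<in> ops (cipher m t \<times> U)"
      by (rule linear_omapD(1)[OF A Y])
    have W: "?X \<kappa> \<in> ops (msg_bot m \<times> U)"
      by (rule linear_omapD(1)[OF linear_on_fst[OF Ld] Z])
    have "on_fst (encrypt m t V \<kappa>) (on_snd I \<rho>) = on_snd I (on_fst (encrypt m t V \<kappa>) \<rho>)"
      by (rule on_fst_on_snd[OF finite_bitstr S(1) Le I \<rho>])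
    moreover have "on_fst (decrypt m t V \<kappa>) (on_snd J (\<A> (on_fst (encrypt m t V \<kappa>) \<rho>))) = on_snd J (?X \<kappa>)"
      by (rule on_fst_on_snd[OF finite_cipher S(3) Ld J Z])
    ultimately have "reveal_key m f \<kappa> (on_fst (decrypt m t V \<kappa>) (\<A>' (on_fst (encrypt m t V \<kappa>) (on_snd I \<rho>))))
      = on_fst (on_snd J) (reveal_key m f \<kappa> (?X \<kappa>))"
      by (simp only: A'[OF Y] reveal_key_on_snd[OF S(3) J W])
    moreover have "reveal_key m f \<kappa> (?X \<kappa>) \<in> ops ((msg_bot m \<times> U) \<times> UNIV)"
      using linear_omapD(1)[OF linear_on_fst[OF cp_linear[OF cp_proj(1)]] W]
        linear_omapD(1)[OF linear_on_fst[OF cp_linear[OF cp_proj(2)]] W]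
      unfolding reveal_key_def by (intro ops_add) (auto simp: ops_iff tensor_def)
    ultimately show ?thesis ..
  qed
  have "gen_real m t K0 V f \<A>' (on_snd I \<rho>) = avg ?K (\<lambda>\<kappa>. on_fst (on_snd J) (reveal_key m f \<kappa> (?X \<kappa>)))"
    unfolding gen_real_def avg_def using 1 by (intro arg_cong[of _ _ "scale _"] sum.cong) auto
  also have "\<dots> = on_fst (on_snd J) (gen_real m t K0 V f \<A> \<rho>)"
    unfolding gen_real_def using 1
    by (intro linear_avg[OF linear_on_fst[OF linear_on_snd[OF J]], symmetric]) auto
  finally show ?thesis .
qed

text \<open>The accepting simulator is a fixed expression in the adversary and not merely claimed to
  exist, so padding the side information has to commute with it exactly.\<close>

lemma acc_sim_on_snd:
  assumes S: "finite S" "finite U" and I: "linear_omap S N I" and J: "linear_omap U N' J"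
    and A: "linear_omap (cipher m t \<times> S) (cipher m t \<times> U) \<A>"
    and A': "\<And>X. X \<in> ops (cipher m t \<times> S) \<Longrightarrow> \<A>' (on_snd I X) = on_snd J (\<A> X)"
    and V: "\<And>k. k \<in> K0 \<Longrightarrow> unitary_op (cipher m t) (V k)"
    and \<rho>: "\<rho> \<in> ops S"
  shows "acc_sim m t K0 V \<A>' (I \<rho>) = J (acc_sim m t K0 V \<A> \<rho>)"
proof -
  let ?C = "cipher m t" and ?M = "bitstr m" and ?K = "K0 \<times> pads m t"
  let ?W = "\<lambda>\<kappa>. on_snd (on_fst (sandwich ?C (enc_unitary m t V \<kappa>)))"
  let ?W' = "\<lambda>\<kappa>. on_snd (on_fst (sandwich ?C (adj (enc_unitary m t V \<kappa>))))"
  let ?F = "\<lambda>\<kappa>. project_ent m t (?W' \<kappa> (on_snd \<A> (?W \<kappa> (attach_ent m t \<rho>))))"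
  have conv: "on_snd (on_fst (sandwich ?C Z)) (on_snd (on_snd L) X) = on_snd (on_snd L) (on_snd (on_fst (sandwich ?C Z)) X)
      \<and> on_snd (on_fst (sandwich ?C Z)) X \<in> ops (?M \<times> ?C \<times> T)"
    if "unitary_op ?C Z" "linear_omap T T' L" "finite T" "X \<in> ops (?M \<times> ?C \<times> T)"
    for Z X and T :: "'z set" and T' :: "'w set" and L
  proof -
    have LZ: "linear_omap ?C ?C (sandwich ?C Z)"
      using cptp_unitary[OF finite_cipher that(1)] by (simp add: cptp_def cp_linear)
    have "on_snd (\<lambda>Y. on_fst (sandwich ?C Z) (on_snd L Y)) X = on_snd (\<lambda>Y. on_snd L (on_fst (sandwich ?C Z) Y)) X"
      by (rule on_snd_cong[OF that(4)]) (rule on_fst_on_snd[OF finite_cipher that(3) LZ that(2)])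
    moreover have "on_snd (on_fst (sandwich ?C Z)) X \<in> ops (?M \<times> ?C \<times> T)"
      by (rule linear_omapD(1)[OF linear_on_snd[OF linear_on_fst[OF LZ]] that(4)])
    ultimately show ?thesis unfolding on_snd_comp by blast
  qed
  have 1: "project_ent m t (?W' \<kappa> (on_snd \<A>' (?W \<kappa> (attach_ent m t (I \<rho>))))) = J (?F \<kappa>) \<and> ?F \<kappa> \<in> ops U"
    if \<kappa>: "\<kappa> \<in> ?K" for \<kappa>
  proof -
    have "unitary_op ?C (V (fst \<kappa>))" using V \<kappa> by auto
    then have E: "unitary_op ?C (enc_unitary m t V \<kappa>)" by (rule enc_unitary_unitary)
    have X0: "attach_ent m t \<rho> \<in> ops (?M \<times> ?C \<times> S)"
      by (rule linear_omapD(1)[OF cp_linear[OF cp_attach_ent[OF S(1)]] \<rho>])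
    note X1 = conv[OF E I S(1) X0]
    have X2: "on_snd \<A> (?W \<kappa> (attach_ent m t \<rho>)) \<in> ops (?M \<times> ?C \<times> U)"
      using linear_omapD(1)[OF linear_on_snd[OF A]] X1 by blast
    note X3 = conv[OF unitary_op_adj[OF E] J S(2) X2]
    have "on_snd (\<lambda>Y. \<A>' (on_snd I Y)) (?W \<kappa> (attach_ent m t \<rho>)) = on_snd (\<lambda>Y. on_snd J (\<A> Y)) (?W \<kappa> (attach_ent m t \<rho>))"
      by (rule on_snd_cong[of _ ?M "?C \<times> S"]) (use X1 A' in auto)
    then have "on_snd \<A>' (on_snd (on_snd I) (?W \<kappa> (attach_ent m t \<rho>))) = on_snd (on_snd J) (on_snd \<A> (?W \<kappa> (attach_ent m t \<rho>)))"
      by (simp only: on_snd_comp)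
    then have "?W' \<kappa> (on_snd \<A>' (?W \<kappa> (attach_ent m t (I \<rho>)))) = on_snd (on_snd J) (?W' \<kappa> (on_snd \<A> (?W \<kappa> (attach_ent m t \<rho>))))"
      using X1 X3 by (simp only: attach_ent_on_snd[OF I \<rho>])
    moreover have "?F \<kappa> \<in> ops U"
      using linear_omapD(1)[OF cp_linear[OF cp_project_ent[OF S(2)]]] X3 by blast
    ultimately show ?thesis using project_ent_on_snd[OF J] X3 by simp
  qed
  have "acc_sim m t K0 V \<A>' (I \<rho>) = avg ?K (\<lambda>\<kappa>. J (?F \<kappa>))"
    unfolding acc_sim_def avg_def Let_def using 1 by (intro arg_cong[of _ _ "scale _"] sum.cong) auto
  also have "\<dots> = J (acc_sim m t K0 V \<A> \<rho>)"
    unfolding acc_sim_def Let_def using 1 by (intro linear_avg[OF J, symmetric]) auto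
  finally show ?thesis .
qed

lemma linear_embed: "linear_omap (bitstr m) (msg_bot m) embed"
  by (rule cp_linear[OF cp_embed_msg])

text \<open>The rejecting simulator in the definition of QCA-R is obtained for numbered side-information
  registers; padding both \<open>S\<close> and \<open>U\<close> to one such register covers a rectangular adversary.\<close>

lemma qca_r_general:
  fixes f :: "'k key \<Rightarrow> 'f" and S :: "'s set" and U :: "'u set"
  assumes K: "finite K0" "K0 \<noteq> {}" and V: "\<And>k. k \<in> K0 \<Longrightarrow> unitary_op (cipher m t) (V k)"
    and q: "qca_r m t K0 V \<epsilon> f"
    and S: "finite S" "S \<noteq> {}" and U: "finite U" "U \<noteq> {}"
    and A: "cptp (cipher m t \<times> S) (cipher m t \<times> U) \<A>"
  shows "\<exists>Sr. cp_map S U Sr \<and> trace_preserving S U (acc_sim m t K0 V \<A> + Sr) \<and>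
    (\<forall>(E :: 'e set) \<rho>. finite E \<longrightarrow> density (E \<times> bitstr m \<times> S) \<rho> \<longrightarrow>
      trace_norm (E \<times> (msg_bot m \<times> U) \<times> ((K0 \<times> pads m t) <+> f ` (K0 \<times> pads m t)))
        (on_snd (gen_real m t K0 V f \<A>) \<rho>
         - on_snd (ideal_channel m (acc_sim m t K0 V \<A>) Sr
             (avg (K0 \<times> pads m t) (\<lambda>\<kappa>. ketbra (Inl \<kappa>)))
             (avg (K0 \<times> pads m t) (\<lambda>\<kappa>. ketbra (Inr (f \<kappa>))))) \<rho>) \<le> 2 * \<epsilon>)"
proof -
  let ?C = "cipher m t" and ?M = "bitstr m" and ?K = "K0 \<times> pads m t"
  let ?Q = "?K <+> f ` ?K"
  let ?k1 = "avg ?K (\<lambda>\<kappa>. ketbra (Inl \<kappa>)) :: ('k key + 'f) oper"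
    and ?k2 = "avg ?K (\<lambda>\<kappa>. ketbra (Inr (f \<kappa>))) :: ('k key + 'f) oper"
  let ?N = "{..<max (card S) (card U)}"
  have "0 \<in> ?N" using S by (simp add: card_gt_0_iff less_max_iff_disj)
  then have N: "finite ?N" "?N \<noteq> {}" "card S \<le> card ?N" "card U \<le> card ?N"
    by (simp_all del: lessThan_iff) blast
  obtain I I' where I: "cptp S ?N I" "cptp ?N S I'" "\<And>X. X \<in> ops S \<Longrightarrow> I' (I X) = X"
    using embed_register[OF S N(1,3)] by blast
  obtain J J' where J: "cptp U ?N J" "cptp ?N U J'" "\<And>X. X \<in> ops U \<Longrightarrow> J' (J X) = X"
    using embed_register[OF U N(1,4)] by blast
  note lin = I(1)[THEN cptp_linear] J(1)[THEN cptp_linear] J(2)[THEN cptp_linear] A[THEN cptp_linear]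
  \<comment> \<open>Drops the padding, runs \<open>\<A>\<close> and pads again, hence agrees with
    \<open>\<A>\<close> on padded inputs.\<close>
  define \<A>' where "\<A>' = (\<lambda>X. on_snd J (\<A> (on_snd I' X)))"
  have cA': "cptp (?C \<times> ?N) (?C \<times> ?N) \<A>'"
    unfolding \<A>'_def using S U
    by (intro cptp_comp[OF cptp_comp[OF cptp_on_snd[OF _ _ _ I(2)] A] cptp_on_snd[OF _ _ _ J(1)]]) auto
  have A': "\<A>' (on_snd I X) = on_snd J (\<A> X)" if "X \<in> ops (?C \<times> S)" for X
  proof -
    have "on_snd (\<lambda>Y. I' (I Y)) X = on_snd (\<lambda>Y. Y) X"
      by (rule on_snd_cong[OF that]) (rule I(3))
    also have "\<dots> = X" by (auto simp: on_snd_def fun_eq_iff)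
    finally show ?thesis by (simp add: \<A>'_def on_snd_comp)
  qed
  obtain Sr' where Sr': "cp_map ?N ?N Sr'" "trace_preserving ?N ?N (acc_sim m t K0 V \<A>' + Sr')"
    "diamond_dist (?M \<times> ?N) ((msg_bot m \<times> ?N) \<times> ?Q) (real_channel m t K0 V f \<A>')
       (ideal_channel m (acc_sim m t K0 V \<A>') Sr' ?k1 ?k2) \<le> ereal \<epsilon>"
    using q[unfolded qca_r_def, rule_format, OF N(1,2) cA'] by blast
  let ?Sa = "acc_sim m t K0 V \<A>" and ?Sa' = "acc_sim m t K0 V \<A>'"
  \<comment> \<open>\<open>Sr'\<close> may produce output outside the image of \<open>J\<close>,
    which is why \<open>J'\<close> must preserve the trace everywhere.\<close>
  define Sr where "Sr = (\<lambda>X. J' (Sr' (I X)))"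
  have sim: "?Sa' (I X) = J (?Sa X)" if "X \<in> ops S" for X
    by (rule acc_sim_on_snd[OF S(1) U(1) lin(1,2,4) A' V that])
  have cSa: "cp_map S U ?Sa"
    using A by (intro cp_acc_sim S U V) (simp_all add: cptp_def)
  have cSa': "cp_map ?N ?N ?Sa'"
    using cA' by (intro cp_acc_sim V) (simp_all add: cptp_def)
  have cSr: "cp_map S U Sr"
    unfolding Sr_def using I(1) J(2) by (intro cp_comp[OF cp_comp[OF _ Sr'(1)]]) (auto simp: cptp_def)
  have tp: "trace_preserving S U (?Sa + Sr)"
    unfolding trace_preserving_def
  proof
    fix X assume X: "X \<in> ops S"
    have IX: "I X \<in> ops ?N" by (rule linear_omapD(1)[OF lin(1) X])
    have "trace U (?Sa X) = trace ?N (?Sa' (I X))"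
      using J(1) linear_omapD(1)[OF cp_linear[OF cSa] X] by (simp add: sim[OF X] cptp_def trace_preserving_def)
    moreover have "trace U (Sr X) = trace ?N (Sr' (I X))"
      using J(2) linear_omapD(1)[OF cp_linear[OF Sr'(1)] IX] by (simp add: Sr_def cptp_def trace_preserving_def)
    moreover have "trace ?N (?Sa' (I X)) + trace ?N (Sr' (I X)) = trace ?N (I X)"
      using Sr'(2) IX by (simp add: trace_preserving_def trace_add)
    moreover have "trace ?N (I X) = trace S X" using I(1) X by (simp add: cptp_def trace_preserving_def)
    ultimately show "trace U ((?Sa + Sr) X) = trace S X" by (simp add: trace_add)
  qed
  let ?R = "gen_real m t K0 V f \<A>" and ?R' = "gen_real m t K0 V f \<A>'"
  let ?D = "ideal_channel m ?Sa Sr ?k1 ?k2" and ?D' = "ideal_channel m ?Sa' Sr' ?k1 ?k2"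
  have fQ: "finite ?Q" using K by simp
  have cR: "cptp (?M \<times> S) ((msg_bot m \<times> U) \<times> ?Q) ?R" by (rule cptp_gen_real[OF S(1) U(1) K A V])
  have cR': "cptp (?M \<times> ?N) ((msg_bot m \<times> ?N) \<times> ?Q) ?R'" by (rule cptp_gen_real[OF N(1) N(1) K cA' V])
  have cD: "cp_map (?M \<times> S) ((msg_bot m \<times> U) \<times> ?Q) ?D"
    by (rule cp_ideal_channel[OF S(1) U(1) fQ cSa cSr]) auto
  have cD': "cp_map (?M \<times> ?N) ((msg_bot m \<times> ?N) \<times> ?Q) ?D'"
    by (rule cp_ideal_channel[OF N(1) N(1) fQ cSa' Sr'(1)]) auto
  have JJ: "on_fst (on_snd J') (on_fst (on_snd J) X) = X" if "X \<in> ops ((msg_bot m \<times> U) \<times> ?Q)" for X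
  proof -
    have "on_snd (\<lambda>Y. J' (J Y)) Y = Y" if "Y \<in> ops (msg_bot m \<times> U)" for Y :: "(bits option \<times> 'u) oper"
    proof -
      have "on_snd (\<lambda>Y. J' (J Y)) Y = on_snd (\<lambda>Y. Y) Y"
        by (rule on_snd_cong[OF that]) (rule J(3))
      then show ?thesis by (auto simp: on_snd_def fun_eq_iff)
    qed
    then have *: "on_snd J' (on_snd J Y) = Y" if "Y \<in> ops (msg_bot m \<times> U)" for Y :: "(bits option \<times> 'u) oper"
      using that by (simp add: on_snd_comp)
    have "(\<lambda>a a'. X (a, c) (a', c')) \<in> ops (msg_bot m \<times> U)" for c c'
      by (rule fst_block_ops[OF that])
    then show ?thesis unfolding on_fst_comp by (auto simp: on_fst_def fun_eq_iff *)
  qed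
  have R: "?R \<rho> = on_fst (on_snd J') (?R' (on_snd I \<rho>))" if "\<rho> \<in> ops (?M \<times> S)" for \<rho>
  proof -
    have "?R' (on_snd I \<rho>) = on_fst (on_snd J) (?R \<rho>)"
      by (rule gen_real_on_snd[OF S(1) N(1) U(1) lin(1,2,4) A' V that])
    moreover have "?R \<rho> \<in> ops ((msg_bot m \<times> U) \<times> ?Q)"
      by (rule linear_omapD(1)[OF cptp_linear[OF cR] that])
    ultimately show ?thesis by (simp only: JJ)
  qed
  have D: "?D \<rho> = on_fst (on_snd J') (?D' (on_snd I \<rho>))" if \<rho>: "\<rho> \<in> ops (?M \<times> S)" for \<rho>
  proof -
    note LJ = linear_on_snd[OF lin(3), of "msg_bot m"]
    have X: "on_snd ?Sa \<rho> \<in> ops (?M \<times> U)" by (rule on_snd_ops[OF cp_linear[OF cSa] \<rho>])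
    have eX: "on_fst embed (on_snd ?Sa \<rho>) \<in> ops (msg_bot m \<times> U)"
      by (rule linear_omapD(1)[OF linear_on_fst[OF linear_embed] X])
    have "on_snd (\<lambda>Y. ?Sa' (I Y)) \<rho> = on_snd (\<lambda>Y. J (?Sa Y)) \<rho>"
      by (rule on_snd_cong[OF \<rho>]) (rule sim)
    then have "on_snd ?Sa' (on_snd I \<rho>) = on_snd J (on_snd ?Sa \<rho>)" by (simp add: on_snd_comp)
    then have e1: "on_fst embed (on_snd ?Sa' (on_snd I \<rho>)) = on_snd J (on_fst embed (on_snd ?Sa \<rho>))"
      using on_fst_on_snd[OF finite_bitstr U(1) linear_embed lin(2) X] by simp
    have T: "tr_fst ?M \<rho> \<in> ops S"
      by (rule linear_omapD(1)[OF cp_linear[OF cp_tr_fst[OF finite_bitstr S(1)]] \<rho>])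
    have T': "Sr' (I (tr_fst ?M \<rho>)) \<in> ops ?N"
      by (rule linear_omapD(1)[OF cp_linear[OF Sr'(1)] linear_omapD(1)[OF lin(1) T]])
    have e2: "tr_fst ?M (on_snd I \<rho>) = I (tr_fst ?M \<rho>)" by (rule tr_fst_on_snd[OF lin(1) \<rho>])
    have Y1: "on_snd J (on_fst embed (on_snd ?Sa \<rho>)) \<in> ops (msg_bot m \<times> ?N)"
      by (rule on_snd_ops[OF lin(2) eX])
    have Y2: "tensor (ketbra None) (Sr' (I (tr_fst ?M \<rho>))) \<in> ops (msg_bot m \<times> ?N)"
      using T' by (auto simp: ops_iff tensor_def ketbra_def msg_bot_def)
    have t: "tensor Y Z \<in> ops ((msg_bot m \<times> ?N) \<times> UNIV)"
      if "Y \<in> ops (msg_bot m \<times> ?N)" for Y and Z :: "('k key + 'f) oper"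
      using that by (auto simp: ops_iff tensor_def)
    have e3: "on_snd J' (on_snd J (on_fst embed (on_snd ?Sa \<rho>))) = on_fst embed (on_snd ?Sa \<rho>)"
      unfolding on_snd_comp[of J'] using on_snd_cong[OF eX, of "\<lambda>Y. J' (J Y)" "\<lambda>Y. Y"] J(3)
      by (auto simp: on_snd_def fun_eq_iff)
    show ?thesis
      unfolding ideal_channel_def e1 e2
      by (simp only: linear_omapD(2)[OF linear_on_fst[OF LJ] t[OF Y1] t[OF Y2]]
          on_fst_tensor[OF LJ Y1] on_fst_tensor[OF LJ Y2] e3 on_snd_tensor[OF lin(3) T'] Sr_def)
  qed
  have "trace_norm (E \<times> (msg_bot m \<times> U) \<times> ?Q) (on_snd ?R \<rho> - on_snd ?D \<rho>) \<le> 2 * \<epsilon>"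
    if E: "finite E" and \<rho>: "density (E \<times> ?M \<times> S) \<rho>" for E :: "'e set" and \<rho>
  proof (rule trace_norm_on_snd_le[OF _ _ _ E _ cD \<rho>])
    show "finite (?M \<times> S)" "finite ((msg_bot m \<times> U) \<times> ?Q)" using S U fQ by auto
    show "cp_map (?M \<times> S) ((msg_bot m \<times> U) \<times> ?Q) ?R" using cR by (simp add: cptp_def)
    fix d :: nat and \<rho>
    assume d: "1 \<le> d" and \<rho>: "density ({..<d} \<times> ?M \<times> S) \<rho>"
    have o: "\<rho> \<in> ops ({..<d} \<times> ?M \<times> S)" using \<rho> by (simp add: density_def psd_ops)
    let ?\<rho> = "on_snd (on_snd I) \<rho>"
    let ?G = "on_snd (on_fst (on_snd J'))"
    have \<rho>': "density ({..<d} \<times> ?M \<times> ?N) ?\<rho>"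
      using S by (intro density_cptp[OF _ _ _ \<rho>] cptp_on_snd I) auto
    have 1: "on_snd ?R \<rho> = ?G (on_snd ?R' ?\<rho>)"
      unfolding on_snd_comp by (rule on_snd_cong[OF o]) (rule R)
    have 2: "on_snd ?D \<rho> = ?G (on_snd ?D' ?\<rho>)"
      unfolding on_snd_comp by (rule on_snd_cong[OF o]) (rule D)
    \<comment> \<open>Unpadding is a channel, so it cannot increase the distance granted for
      \<open>\<A>'\<close>.\<close>
    have "trace_norm ({..<d} \<times> (msg_bot m \<times> U) \<times> ?Q) (?G (on_snd ?R' ?\<rho>) - ?G (on_snd ?D' ?\<rho>))
        \<le> trace_norm ({..<d} \<times> (msg_bot m \<times> ?N) \<times> ?Q) (on_snd ?R' ?\<rho> - on_snd ?D' ?\<rho>)"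
    proof (rule trace_norm_cptp)
      show "cptp ({..<d} \<times> (msg_bot m \<times> ?N) \<times> ?Q) ({..<d} \<times> (msg_bot m \<times> U) \<times> ?Q) ?G"
        using U fQ by (intro cptp_on_snd cptp_on_fst J) auto
      show "psd ({..<d} \<times> (msg_bot m \<times> ?N) \<times> ?Q) (on_snd ?R' ?\<rho>)"
        using cR' \<rho>' fQ by (intro psd_on_snd[of "?M \<times> ?N"]) (auto simp: density_def cptp_def)
      show "psd ({..<d} \<times> (msg_bot m \<times> ?N) \<times> ?Q) (on_snd ?D' ?\<rho>)"
        using cD' \<rho>' fQ by (intro psd_on_snd[of "?M \<times> ?N"]) (auto simp: density_def)
    qed (use U fQ in auto)
    also have "\<dots> \<le> 2 * \<epsilon>"
      using diamond_distD[OF Sr'(3) d \<rho>'] by (simp add: gen_real_eq)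
    finally show "trace_norm ({..<d} \<times> (msg_bot m \<times> U) \<times> ?Q) (on_snd ?R \<rho> - on_snd ?D \<rho>) \<le> 2 * \<epsilon>"
      by (simp only: 1 2)
  qed
  then show ?thesis using cSr tp by blast
qed

section \<open>Teleporting the second message\<close>

text \<open>Encryption and decryption are lifted to the leading register. Swapping lets the two
  messages take turns there, with the other one counted as side information.\<close>

definition swap_reg :: "('a \<times> 'b \<times> 'r, 'b \<times> 'a \<times> 'r) omap" where
  "swap_reg X = (\<lambda>(b, a, r) (b', a', r'). X (a, b, r) (a', b', r'))"

lemma cptp_swap_reg:
  assumes "finite A" "finite B" "finite R"
  shows "cptp (A \<times> B \<times> R) (B \<times> A \<times> R) swap_reg"
proof (rule cptp_cong)
  let ?s = "\<lambda>(b, a, r). (a, b, r)"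
  have "?s ` (B \<times> A \<times> R) = A \<times> B \<times> R" by force
  then show "cptp (A \<times> B \<times> R) (B \<times> A \<times> R) (pull (B \<times> A \<times> R) ?s)"
    using assms by (intro cptp_reindex) (auto simp: bij_betw_def inj_on_def)
qed (auto simp: swap_reg_def pull_def fun_eq_iff opsD)

lemma on_snd_on_fst_swap: "on_snd (on_fst \<Phi>) X = swap_reg (on_fst \<Phi> (swap_reg X))"
  by (intro ext) (simp add: swap_reg_def on_snd_def on_fst_def split: prod.split)

lemma scale_sum: "scale c (\<Sum>i\<in>I. (X i :: 'a oper)) = (\<Sum>i\<in>I. scale c (X i))"
  by (simp add: scale_def fun_eq_iff sum_apply sum_distrib_left)

lemma on_snd_scale_fun: "on_snd (\<lambda>Y. scale c (\<Phi> Y)) X = scale c (on_snd \<Phi> X)"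
  by (auto simp: on_snd_def scale_def fun_eq_iff)

lemma on_snd_avg_fun: "on_snd (\<lambda>Y. avg I (\<lambda>i. F i Y)) X = avg I (\<lambda>i. on_snd (F i) X)"
  by (auto simp: on_snd_def avg_apply fun_eq_iff)

lemma trace_on_snd: "trace (F \<times> B) (on_snd \<Phi> X) = (\<Sum>f\<in>F. trace B (\<Phi> (block f f X)))"
  by (simp add: trace_def sum.cartesian_product' on_snd_apply)

text \<open>The key of the second message becomes the outer index and the pad of the first the inner
  one, so that for a fixed code key the first stage enters averaged over its pad.\<close>

lemma avg_case_triple:
  fixes F :: "'k \<Rightarrow> bits \<Rightarrow> bits \<Rightarrow> 'a oper"
  shows "avg (A \<times> B \<times> B) (\<lambda>(a, b, c). F a b c) = avg (A \<times> B) (\<lambda>\<kappa>. avg B (\<lambda>b. F (fst \<kappa>) b (snd \<kappa>)))"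
proof (intro ext)
  fix x y
  have "(\<Sum>(a, b, c)\<in>A \<times> B \<times> B. F a b c x y) = (\<Sum>a\<in>A. \<Sum>c\<in>B. \<Sum>b\<in>B. F a b c x y)"
    unfolding sum.cartesian_product' by (simp, intro sum.cong refl sum.swap)
  then show "avg (A \<times> B \<times> B) (\<lambda>(a, b, c). F a b c) x y = avg (A \<times> B) (\<lambda>\<kappa>. avg B (\<lambda>b. F (fst \<kappa>) b (snd \<kappa>))) x y"
    by (simp add: avg_apply card_cartesian_product sum.cartesian_product' split_def flip: sum_divide_distrib)
qed

section \<open>Reading the code key from the revealed key\<close>

locale teleported_message =
  fixes m t :: nat and K0 :: "'k set" and V :: "'k \<Rightarrow> (bits \<times> bits) oper"
  assumes K0: "finite K0" "K0 \<noteq> {}"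
    and V: "\<And>k. k \<in> K0 \<Longrightarrow> unitary_op (cipher m t) (V k)"
begin

abbreviation "C \<equiv> cipher m t"
abbreviation "M \<equiv> bitstr m"
abbreviation "MB \<equiv> msg_bot m"
abbreviation "K \<equiv> K0 \<times> pads m t"
abbreviation "Q \<equiv> K <+> K0"
abbreviation "D \<equiv> (2 ^ (m + t) :: real)"

text \<open>With the recycling function \<open>fst\<close> the code key can be read off in both
  branches: it is part of a full key and all of a recycled one.\<close>

definition key0 :: "'k key + 'k \<Rightarrow> 'k" where
  "key0 q = (case q of Inl \<kappa> \<Rightarrow> fst \<kappa> | Inr k \<Rightarrow> k)"

lemma key0_simps [simp]: "key0 (Inl \<kappa>) = fst \<kappa>" "key0 (Inr k) = k"
  by (simp_all add: key0_def)

lemma finite_K [simp]: "finite K" "finite Q"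
  using K0 by simp_all

lemma card_pads: "card (pads m t) = 2 ^ (m + t) * 2 ^ (m + t)"
  by (simp only: card_bitstr mult_2 power_add)

text \<open>Unnormalised post-selection on the code key \<open>k\<close>; whatever else the key
  register holds is discarded.\<close>

definition select_key :: "'k \<Rightarrow> ('o \<times> ('k key + 'k), 'o) omap" where
  "select_key k X = (\<Sum>q\<in>{q \<in> Q. key0 q = k}. bra_ket q X)"

lemma cp_select_key: "finite O' \<Longrightarrow> cp_map (O' \<times> Q) O' (select_key k)"
  unfolding select_key_def[abs_def] using K0(1) by (intro cp_sum cp_bra_ket) auto

lemma trace_select_key: "(\<Sum>k\<in>K0. trace O' (select_key k X)) = trace (O' \<times> Q) X"
proof -
  have "(\<Sum>k\<in>K0. trace O' (select_key k X)) = (\<Sum>k\<in>K0. \<Sum>q\<in>{q \<in> Q. key0 q = k}. trace O' (bra_ket q X))"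
    by (simp add: select_key_def trace_sum)
  also have "\<dots> = (\<Sum>q\<in>Q. trace O' (bra_ket q X))"
    by (rule sum.group) (use K0 in auto)
  also have "\<dots> = trace (O' \<times> Q) X"
    by (simp add: trace_def bra_ket_def sum.cartesian_product') (rule sum.swap)
  finally show ?thesis .
qed

text \<open>Averages of full keys and of recycled keys both have a uniform code key, which explains
  the weight; \<open>g\<close> covers the two cases at once.\<close>

lemma select_key_tensor_avg:
  assumes k: "k \<in> K0" and g: "\<And>\<kappa>. \<kappa> \<in> K \<Longrightarrow> g \<kappa> \<in> Q \<and> key0 (g \<kappa>) = fst \<kappa>"
  shows "select_key k (tensor X (avg K (\<lambda>\<kappa>. ketbra (g \<kappa>)))) = scale (1 / of_nat (card K0)) X"
proof (intro ext)
  fix x y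
  let ?Q = "{q \<in> Q. key0 q = k}"
  have p: "real (card (pads m t)) \<noteq> 0" by (simp add: card_bitstr)
  have "(\<Sum>q\<in>?Q. avg K (\<lambda>\<kappa>. ketbra (g \<kappa>)) q q)
      = (\<Sum>q\<in>?Q. \<Sum>\<kappa>\<in>K. if q = g \<kappa> then 1 else 0) / of_nat (card K)"
    unfolding avg_apply by (simp add: ketbra_def sum_divide_distrib[symmetric])
  also have "(\<Sum>q\<in>?Q. \<Sum>\<kappa>\<in>K. if q = g \<kappa> then 1 else 0 :: complex) = (\<Sum>\<kappa>\<in>K. \<Sum>q\<in>?Q. if q = g \<kappa> then 1 else 0)"
    by (rule sum.swap)
  also have "(\<Sum>\<kappa>\<in>K. \<Sum>q\<in>?Q. if q = g \<kappa> then 1 else 0 :: complex) = (\<Sum>\<kappa>\<in>K. if fst \<kappa> = k then 1 else 0)"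
  proof (intro sum.cong refl)
    fix \<kappa> assume "\<kappa> \<in> K"
    moreover have "finite ?Q" by (rule finite_subset[OF _ finite_K(2)]) auto
    ultimately show "(\<Sum>q\<in>?Q. if q = g \<kappa> then 1 else 0 :: complex) = (if fst \<kappa> = k then 1 else 0)"
      using g[of \<kappa>] by (simp del: distrib_left_numeral)
  qed
  also have "\<dots> = (\<Sum>k'\<in>K0. if k' = k then of_nat (card (pads m t)) else 0)"
    unfolding sum.cartesian_product' by (intro sum.cong refl) simp
  also have "\<dots> = of_nat (card (pads m t))" using k K0 by simp
  finally have *: "(\<Sum>q\<in>?Q. avg K (\<lambda>\<kappa>. ketbra (g \<kappa>)) q q) = 1 / of_nat (card K0)"
    using p by (simp add: card_cartesian_product)
  have "select_key k (tensor X (avg K (\<lambda>\<kappa>. ketbra (g \<kappa>)))) x y = X x y * (\<Sum>q\<in>?Q. avg K (\<lambda>\<kappa>. ketbra (g \<kappa>)) q q)"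
    by (simp add: select_key_def sum_apply bra_ket_def tensor_def sum_distrib_left)
  then show "select_key k (tensor X (avg K (\<lambda>\<kappa>. ketbra (g \<kappa>)))) x y = scale (1 / of_nat (card K0)) X x y"
    unfolding * by (simp add: scale_def)
qed

lemma select_key_add: "select_key k (X + Y) = select_key k X + select_key k Y"
  by (simp add: select_key_def fun_eq_iff sum_apply bra_ket_def sum.distrib)

text \<open>The conditional output is the same for every \<open>k\<close>: after the ideal first
  stage the code key is still uniform and independent of all other registers.\<close>

lemma select_key_ideal:
  fixes Sa Sr :: "('s, 'u) omap"
  assumes "k \<in> K0"
  shows "select_key k (ideal_channel m Sa Sr (avg K (\<lambda>\<kappa>. ketbra (Inl \<kappa>))) (avg K (\<lambda>\<kappa>. ketbra (Inr (fst \<kappa>)))) \<sigma>)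
    = scale (1 / of_nat (card K0)) (bot_or_pass m Sa Sr \<sigma>)"
proof -
  have "select_key k (tensor X (avg K (\<lambda>\<kappa>. ketbra (Inl \<kappa>)))) = scale (1 / of_nat (card K0)) X"
    "select_key k (tensor X (avg K (\<lambda>\<kappa>. ketbra (Inr (fst \<kappa>))))) = scale (1 / of_nat (card K0)) X" for X :: "(bits option \<times> 'u) oper"
    by (rule select_key_tensor_avg[OF assms]; auto)+
  then show ?thesis by (simp only: ideal_channel_def select_key_add bot_or_pass_def scale_add)
qed

definition first_stage :: "((bits \<times> bits) \<times> 's, (bits \<times> bits) \<times> 'u) omap \<Rightarrow> 'k key \<Rightarrow> (bits \<times> 's, bits option \<times> 'u) omap" where
  "first_stage \<A> \<kappa> \<rho> = on_fst (decrypt m t V \<kappa>) (\<A> (on_fst (encrypt m t V \<kappa>) \<rho>))"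

lemma cptp_first_stage:
  assumes "finite S" "finite U" "cptp (C \<times> S) (C \<times> U) \<A>" "fst \<kappa> \<in> K0"
  shows "cptp (M \<times> S) (MB \<times> U) (first_stage \<A> \<kappa>)"
  unfolding first_stage_def[abs_def] using assms
  by (intro cptp_comp[OF cptp_comp[OF cptp_on_fst[OF _ _ _ cptp_encrypt[of m t V \<kappa>]] assms(3)]
      cptp_on_fst[OF _ _ _ cptp_decrypt[of m t V \<kappa>]]] V) auto

text \<open>The projections can only delete coherences between acceptance and rejection, and by
  \<open>decrypt_diag\<close> there are none.\<close>

lemma acc_rej_decrypt:
  fixes Z :: "((bits \<times> bits) \<times> 'u) oper"
  assumes "on_fst (decrypt m t V \<kappa>) Z \<in> ops (MB \<times> U)"
  shows "on_fst (proj_acc m) (on_fst (decrypt m t V \<kappa>) Z) + on_fst (proj_rej m) (on_fst (decrypt m t V \<kappa>) Z)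
    = on_fst (decrypt m t V \<kappa>) Z"
proof (intro ext)
  fix x y :: "bits option \<times> 'u"
  obtain a c b d where [simp]: "x = (a, c)" "y = (b, d)" by (cases x; cases y)
  have "on_fst (decrypt m t V \<kappa>) Z (a, c) (b, d) = 0" if "a \<notin> MB \<or> b \<notin> MB"
    using opsD[OF assms, of "(a, c)" "(b, d)"] that by auto
  moreover have "on_fst (decrypt m t V \<kappa>) Z (None, c) (Some b', d) = 0"
    "on_fst (decrypt m t V \<kappa>) Z (Some b', c) (None, d) = 0" for b'
    by (simp_all add: on_fst_apply decrypt_diag)
  ultimately show "(on_fst (proj_acc m) (on_fst (decrypt m t V \<kappa>) Z) + on_fst (proj_rej m) (on_fst (decrypt m t V \<kappa>) Z)) x y
      = on_fst (decrypt m t V \<kappa>) Z x y"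
    by (cases a; cases b) (auto simp: on_fst_apply[of "proj_acc m"] on_fst_apply[of "proj_rej m"]
        proj_acc_apply proj_rej_apply msg_bot_def)
qed

text \<open>The accepting and the rejecting branch each sit at one value of the key register, and
  both values have the same code key. Post-selection therefore reunites them into the undivided
  output, averaged over the pads that accompany \<open>k\<close>.\<close>

lemma select_key_real:
  assumes fin: "finite S" "finite U" and A: "cptp (C \<times> S) (C \<times> U) \<A>" and k: "k \<in> K0" and \<sigma>: "\<sigma> \<in> ops (M \<times> S)"
  shows "select_key k (gen_real m t K0 V fst \<A> \<sigma>)
    = scale (1 / of_nat (card K0)) (avg (pads m t) (\<lambda>k1. first_stage \<A> (k, k1) \<sigma>))"
proof (intro ext)
  fix x y
  let ?Q = "{q \<in> Q. key0 q = k}"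
  have fQ: "finite ?Q" by (rule finite_subset[OF _ finite_K(2)]) auto
  have 1: "(\<Sum>q\<in>?Q. reveal_key m fst \<kappa> (first_stage \<A> \<kappa> \<sigma>) (x, q) (y, q))
      = (if fst \<kappa> = k then first_stage \<A> \<kappa> \<sigma> x y else 0)" if \<kappa>: "\<kappa> \<in> K" for \<kappa>
  proof -
    let ?Y = "first_stage \<A> \<kappa> \<sigma>"
    have kk: "fst \<kappa> \<in> K0" using \<kappa> by auto
    have "?Y \<in> ops (MB \<times> U)"
      by (rule linear_omapD(1)[OF cptp_linear[OF cptp_first_stage[OF fin A kk]] \<sigma>])
    then have Y: "on_fst (proj_acc m) ?Y x y + on_fst (proj_rej m) ?Y x y = ?Y x y"
      using acc_rej_decrypt[of \<kappa> "\<A> (on_fst (encrypt m t V \<kappa>) \<sigma>)" U]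
      by (metis (no_types) first_stage_def plus_fun_apply)
    have "(\<Sum>q\<in>?Q. reveal_key m fst \<kappa> ?Y (x, q) (y, q))
        = (\<Sum>q\<in>?Q. if q = Inl \<kappa> then on_fst (proj_acc m) ?Y x y else 0)
        + (\<Sum>q\<in>?Q. if q = Inr (fst \<kappa>) then on_fst (proj_rej m) ?Y x y else 0)"
      unfolding sum.distrib[symmetric]
      by (intro sum.cong refl) (simp add: reveal_key_def tensor_def ketbra_def)
    also have "\<dots> = (if fst \<kappa> = k then ?Y x y else 0)"
      using fQ \<kappa> kk Y by (auto simp: sum.delta simp del: distrib_left_numeral)
    finally show ?thesis .
  qed
  have "select_key k (gen_real m t K0 V fst \<A> \<sigma>) x y
      = (\<Sum>q\<in>?Q. \<Sum>\<kappa>\<in>K. reveal_key m fst \<kappa> (first_stage \<A> \<kappa> \<sigma>) (x, q) (y, q)) / of_nat (card K)"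
    by (simp add: select_key_def sum_apply bra_ket_def gen_real_def avg_apply first_stage_def
        sum_divide_distrib[symmetric])
  also have "(\<Sum>q\<in>?Q. \<Sum>\<kappa>\<in>K. reveal_key m fst \<kappa> (first_stage \<A> \<kappa> \<sigma>) (x, q) (y, q))
      = (\<Sum>\<kappa>\<in>K. \<Sum>q\<in>?Q. reveal_key m fst \<kappa> (first_stage \<A> \<kappa> \<sigma>) (x, q) (y, q))"
    by (rule sum.swap)
  also have "\<dots> = (\<Sum>\<kappa>\<in>K. if fst \<kappa> = k then first_stage \<A> \<kappa> \<sigma> x y else 0)"
    by (intro sum.cong refl 1)
  also have "(\<Sum>\<kappa>\<in>K. if fst \<kappa> = k then first_stage \<A> \<kappa> \<sigma> x y else 0)
      = (\<Sum>k'\<in>K0. if k' = k then \<Sum>k1\<in>pads m t. first_stage \<A> (k, k1) \<sigma> x y else 0)"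
    unfolding sum.cartesian_product' by (intro sum.cong refl) simp
  also have "\<dots> = (\<Sum>k1\<in>pads m t. first_stage \<A> (k, k1) \<sigma> x y)" using k K0 by simp
  finally show "select_key k (gen_real m t K0 V fst \<A> \<sigma>) x y
      = scale (1 / of_nat (card K0)) (avg (pads m t) (\<lambda>k1. first_stage \<A> (k, k1) \<sigma>)) x y"
    by (simp add: scale_def avg_apply card_cartesian_product)
qed

text \<open>\<open>tele_in\<close> supplies a maximally entangled pair on \<open>C' C\<^sub>2\<close>, whose second half replaces the second
  ciphertext; \<open>tele_out \<kappa>\<close> is the (unnormalised) measurement outcome on \<open>M\<^sub>2 C'\<close> that teleports
  the encryption of the second message under \<open>\<kappa>\<close> into \<open>C\<^sub>2\<close>.\<close>

definition tele_in ::
    "'e set \<Rightarrow> 'r set \<Rightarrow> ('e \<times> bits \<times> bits \<times> 'r, ('e \<times> bits \<times> bits \<times> bits) \<times> bits \<times> (bits \<times> bits) \<times> 'r) omap" where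
  "tele_in E R \<rho> = scale (complex_of_real (1 / D))
     (pull {((e, m2, c), (m1, (c', r))) |e m2 c m1 c' r. e \<in> E \<and> m2 \<in> M \<and> c \<in> C \<and> c' = c \<and> m1 \<in> M \<and> r \<in> R}
        (\<lambda>((e, m2, c), (m1, (c', r))). (e, (m2, (m1, r)))) \<rho>)"

definition tele_out :: "'e set \<Rightarrow> 'k key \<Rightarrow> ('e \<times> bits \<times> bits \<times> bits, 'e) omap" where
  "tele_out E \<kappa> = sandwich (E \<times> M \<times> C)
     (\<lambda>e (e', m2, c). if e = e' \<and> e \<in> E then enc_unitary m t V \<kappa> c (m2, zeros t) else 0)"

lemma tele_out_apply:
  assumes "finite E" "Z \<in> ops (E \<times> M \<times> C)"
  shows "tele_out E \<kappa> Z e e' = (\<Sum>m2\<in>M. \<Sum>c\<in>C. \<Sum>m2'\<in>M. \<Sum>c'\<in>C.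
      enc_unitary m t V \<kappa> c (m2, zeros t) * Z (e, m2, c) (e', m2', c') * cnj (enc_unitary m t V \<kappa> c' (m2', zeros t)))"
proof -
  let ?U = "\<lambda>m2 c. enc_unitary m t V \<kappa> c (m2, zeros t)"
  have "tele_out E \<kappa> Z e e' = (\<Sum>x\<in>E. \<Sum>m2\<in>M. \<Sum>c\<in>C. \<Sum>x'\<in>E. \<Sum>m2'\<in>M. \<Sum>c'\<in>C.
      if x' = e' then (if x = e then ?U m2 c * Z (x, m2, c) (x', m2', c') * cnj (?U m2' c') else 0) else 0)"
    unfolding tele_out_def sandwich_apply sum.cartesian_product'[of _ E] sum.cartesian_product'[of _ M C]
    by (intro sum.cong refl) auto
  also have "\<dots> = (\<Sum>x\<in>E. \<Sum>m2\<in>M. \<Sum>c\<in>C. \<Sum>x'\<in>E.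
      if x' = e' then (if x = e then \<Sum>m2'\<in>M. \<Sum>c'\<in>C. ?U m2 c * Z (x, m2, c) (x', m2', c') * cnj (?U m2' c') else 0) else 0)"
    by (intro sum.cong refl) auto
  also have "\<dots> = (\<Sum>x\<in>E. \<Sum>m2\<in>M. \<Sum>c\<in>C. if e' \<in> E then
      if x = e then \<Sum>m2'\<in>M. \<Sum>c'\<in>C. ?U m2 c * Z (x, m2, c) (e', m2', c') * cnj (?U m2' c') else 0 else 0)"
    using assms(1) by (intro sum.cong refl) simp
  also have "\<dots> = (\<Sum>x\<in>E. if x = e then \<Sum>m2\<in>M. \<Sum>c\<in>C. if e' \<in> E then
      \<Sum>m2'\<in>M. \<Sum>c'\<in>C. ?U m2 c * Z (x, m2, c) (e', m2', c') * cnj (?U m2' c') else 0 else 0)"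
    using assms(1) by (intro sum.cong refl) (auto cong: if_cong)
  also have "\<dots> = (if e \<in> E \<and> e' \<in> E then \<Sum>m2\<in>M. \<Sum>c\<in>C. \<Sum>m2'\<in>M. \<Sum>c'\<in>C.
      ?U m2 c * Z (e, m2, c) (e', m2', c') * cnj (?U m2' c') else 0)"
    using assms(1) by simp
  also have "\<dots> = (\<Sum>m2\<in>M. \<Sum>c\<in>C. \<Sum>m2'\<in>M. \<Sum>c'\<in>C. ?U m2 c * Z (e, m2, c) (e', m2', c') * cnj (?U m2' c'))"
    using opsD[OF assms(2)] by auto
  finally show ?thesis .
qed

lemma cp_tele_out: "finite E \<Longrightarrow> cp_map (E \<times> M \<times> C) E (tele_out E \<kappa>)"
  unfolding tele_out_def by (intro cp_sandwich) auto

text \<open>By \<open>enc_unitary_complete\<close> the outcome operators for a fixed code key sum to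
  \<open>D\<close> times the identity on \<open>M\<^sub>2 C'\<close>. With weight
  \<open>1 / D\<close> they form a complete measurement, though an overcomplete one when the tag is
  nonempty.\<close>

lemma trace_tele_out:
  assumes "finite E" "Z \<in> ops (E \<times> M \<times> C)" "k0 \<in> K0"
  shows "(\<Sum>k\<in>pads m t. trace E (tele_out E (k0, k) Z)) = complex_of_real D * trace (E \<times> M \<times> C) Z"
proof -
  let ?U = "\<lambda>k m2 c. enc_unitary m t V (k0, k) c (m2, zeros t)"
  have "(\<Sum>k\<in>pads m t. trace E (tele_out E (k0, k) Z)) = (\<Sum>k\<in>pads m t. \<Sum>e\<in>E.
      \<Sum>m2\<in>M. \<Sum>c\<in>C. \<Sum>m2'\<in>M. \<Sum>c'\<in>C. Z (e, m2, c) (e, m2', c') * (?U k m2 c * cnj (?U k m2' c')))"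
    using assms by (simp add: trace_def tele_out_apply mult_ac)
  also have "\<dots> = (\<Sum>e\<in>E. \<Sum>k\<in>pads m t.
      \<Sum>m2\<in>M. \<Sum>c\<in>C. \<Sum>m2'\<in>M. \<Sum>c'\<in>C. Z (e, m2, c) (e, m2', c') * (?U k m2 c * cnj (?U k m2' c')))"
    by (rule sum.swap)
  also have "\<dots> = (\<Sum>e\<in>E. \<Sum>m2\<in>M. \<Sum>k\<in>pads m t. \<Sum>c\<in>C. \<Sum>m2'\<in>M. \<Sum>c'\<in>C.
      Z (e, m2, c) (e, m2', c') * (?U k m2 c * cnj (?U k m2' c')))"
    by (intro sum.cong refl sum.swap)
  also have "\<dots> = (\<Sum>e\<in>E. \<Sum>m2\<in>M. \<Sum>c\<in>C. \<Sum>k\<in>pads m t. \<Sum>m2'\<in>M. \<Sum>c'\<in>C.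
      Z (e, m2, c) (e, m2', c') * (?U k m2 c * cnj (?U k m2' c')))"
    by (intro sum.cong refl sum.swap)
  also have "\<dots> = (\<Sum>e\<in>E. \<Sum>m2\<in>M. \<Sum>c\<in>C. \<Sum>m2'\<in>M. \<Sum>k\<in>pads m t. \<Sum>c'\<in>C.
      Z (e, m2, c) (e, m2', c') * (?U k m2 c * cnj (?U k m2' c')))"
    by (intro sum.cong refl sum.swap)
  also have "\<dots> = (\<Sum>e\<in>E. \<Sum>m2\<in>M. \<Sum>c\<in>C. \<Sum>m2'\<in>M. \<Sum>c'\<in>C. \<Sum>k\<in>pads m t.
      Z (e, m2, c) (e, m2', c') * (?U k m2 c * cnj (?U k m2' c')))"
    by (intro sum.cong refl sum.swap)
  also have "\<dots> = (\<Sum>e\<in>E. \<Sum>m2\<in>M. \<Sum>c\<in>C. \<Sum>m2'\<in>M. \<Sum>c'\<in>C.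
      if c' = c then (if m2' = m2 then D * Z (e, m2, c) (e, m2, c) else 0) else 0)"
    using assms(3) V by (intro sum.cong refl)
      (auto simp: enc_unitary_complete simp del: distrib_left_numeral simp flip: sum_distrib_left)
  also have "\<dots> = complex_of_real D * trace (E \<times> M \<times> C) Z"
    by (simp add: trace_def sum.cartesian_product'[of _ E] sum.cartesian_product'[of _ M C] sum_distrib_left)
  finally show ?thesis .
qed

text \<open>The pair has one diagonal term for each ciphertext label, and \<open>card C = D\<close>
  cancels the prefactor.\<close>

lemma cptp_tele_in:
  assumes "finite E" "finite R"
  shows "cptp (E \<times> M \<times> M \<times> R) ((E \<times> M \<times> C) \<times> M \<times> C \<times> R) (tele_in E R)"
  unfolding cptp_def
proof
  show "cp_map (E \<times> M \<times> M \<times> R) ((E \<times> M \<times> C) \<times> M \<times> C \<times> R) (tele_in E R)"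
    unfolding tele_in_def[abs_def] using assms by (intro cp_scale cp_pull) auto
  have "trace ((E \<times> M \<times> C) \<times> M \<times> C \<times> R) (tele_in E R X) = trace (E \<times> M \<times> M \<times> R) X" for X
  proof -
    have "trace ((E \<times> M \<times> C) \<times> M \<times> C \<times> R) (tele_in E R X)
      = (\<Sum>e\<in>E. \<Sum>m2\<in>M. \<Sum>c\<in>C. \<Sum>m1\<in>M. \<Sum>c'\<in>C. \<Sum>r\<in>R.
          if c' = c then complex_of_real (1 / D) * X (e, m2, m1, r) (e, m2, m1, r) else 0)"
      unfolding trace_def sum.cartesian_product'[of _ E] sum.cartesian_product'[of _ M]
        sum.cartesian_product'[of _ "E \<times> M \<times> C"] sum.cartesian_product'[of _ C R]
      by (intro sum.cong refl) (auto simp: tele_in_def scale_def pull_def)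
    also have "\<dots> = (\<Sum>e\<in>E. \<Sum>m2\<in>M. \<Sum>c\<in>C. \<Sum>m1\<in>M. \<Sum>c'\<in>C.
          if c' = c then \<Sum>r\<in>R. complex_of_real (1 / D) * X (e, m2, m1, r) (e, m2, m1, r) else 0)"
      by (intro sum.cong refl) auto
    also have "\<dots> = (\<Sum>e\<in>E. \<Sum>m2\<in>M. \<Sum>c\<in>C. \<Sum>m1\<in>M. \<Sum>r\<in>R. complex_of_real (1 / D) * X (e, m2, m1, r) (e, m2, m1, r))"
      by (intro sum.cong refl) simp
    also have "\<dots> = (\<Sum>e\<in>E. \<Sum>m2\<in>M. of_nat (card C) * (\<Sum>m1\<in>M. \<Sum>r\<in>R. complex_of_real (1 / D) * X (e, m2, m1, r) (e, m2, m1, r)))"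
      by (simp only: sum_constant)
    also have "\<dots> = trace (E \<times> M \<times> M \<times> R) X"
      unfolding trace_def sum.cartesian_product'[of _ E] sum.cartesian_product'[of _ M]
      by (simp add: card_cartesian_product card_bitstr power_add flip: sum_divide_distrib)
    finally show ?thesis .
  qed
  then show "trace_preserving (E \<times> M \<times> M \<times> R) ((E \<times> M \<times> C) \<times> M \<times> C \<times> R) (tele_in E R)"
    by (simp add: trace_preserving_def)
qed

lemma encrypt_apply:
  "encrypt m t V \<kappa> \<rho> c c' = (\<Sum>m2\<in>M. \<Sum>m2'\<in>M.
     enc_unitary m t V \<kappa> c (m2, zeros t) * \<rho> m2 m2' * cnj (enc_unitary m t V \<kappa> c' (m2', zeros t)))"
proof -
  have "encrypt m t V \<kappa> \<rho> c c' = (\<Sum>m2\<in>M. \<Sum>i\<in>bitstr t. \<Sum>m2'\<in>M. \<Sum>i'\<in>bitstr t. if i' = zeros t then if i = zeros t then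
     enc_unitary m t V \<kappa> c (m2, zeros t) * \<rho> m2 m2' * cnj (enc_unitary m t V \<kappa> c' (m2', zeros t)) else 0 else 0)"
    unfolding encrypt_def sandwich_apply sum.cartesian_product'
    by (intro sum.cong refl) (auto simp: tensor_def ketbra_def)
  also have "\<dots> = (\<Sum>m2\<in>M. \<Sum>i\<in>bitstr t. if i = zeros t then \<Sum>m2'\<in>M.
     enc_unitary m t V \<kappa> c (m2, zeros t) * \<rho> m2 m2' * cnj (enc_unitary m t V \<kappa> c' (m2', zeros t)) else 0)"
    by (intro sum.cong refl) auto
  also have "\<dots> = (\<Sum>m2\<in>M. \<Sum>m2'\<in>M.
     enc_unitary m t V \<kappa> c (m2, zeros t) * \<rho> m2 m2' * cnj (enc_unitary m t V \<kappa> c' (m2', zeros t)))"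
    by simp
  finally show ?thesis .
qed

text \<open>Contracting the row with entries \<open>U c (m2, 0)\<close> against the sum of all
  \<open>|c c>\<close> leaves the vector \<open>U |m2, 0>\<close> on \<open>C\<^sub>2\<close>. No
  correction follows, because the Pauli operator that teleportation would have to undo is the wanted
  pad.\<close>

lemma teleport:
  fixes E :: "'e set" and R :: "'r set"
  assumes fin: "finite E" "finite R" and \<rho>: "\<rho> \<in> ops (E \<times> M \<times> M \<times> R)" and \<kappa>: "fst \<kappa> \<in> K0"
  shows "on_fst (tele_out E \<kappa>) (tele_in E R \<rho>)
    = scale (complex_of_real (1 / D)) (on_snd (\<lambda>Y. swap_reg (on_fst (encrypt m t V \<kappa>) Y)) \<rho>)"
proof (intro ext)
  fix x y :: "'e \<times> bits \<times> (bits \<times> bits) \<times> 'r"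
  obtain e m1 c r e' m1' c' r' where [simp]: "x = (e, m1, c, r)" "y = (e', m1', c', r')"
    by (cases x rule: prod_cases4; cases y rule: prod_cases4)
  let ?U = "\<lambda>m2 c. enc_unitary m t V \<kappa> c (m2, zeros t)"
  let ?Z = "\<lambda>z z'. tele_in E R \<rho> (z, m1, c, r) (z', m1', c', r')"
  have \<sigma>: "tele_in E R \<rho> \<in> ops ((E \<times> M \<times> C) \<times> M \<times> C \<times> R)"
    by (rule linear_omapD(1)[OF cptp_linear[OF cptp_tele_in[OF fin]] \<rho>])
  have Z: "?Z \<in> ops (E \<times> M \<times> C)" by (rule fst_block_ops[OF \<sigma>])
  have U0: "?U m2 d = 0" if "d \<notin> C" for m2 d
    using opsD[OF unitary_ops[OF enc_unitary_unitary[of m t V \<kappa>, OF V[OF \<kappa>]]]] that by simp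
  have Ze: "?Z (e, m2, d) (e', m2', d') = (if d' = c' then if d = c \<and> c \<in> C \<and> c' \<in> C then
      complex_of_real (1 / D) * \<rho> (e, m2, m1, r) (e', m2', m1', r') else 0 else 0)"
    if "m2 \<in> M" "m2' \<in> M" for m2 m2' d d'
    using opsD[OF \<rho>, of "(e, m2, m1, r)" "(e', m2', m1', r')"] that
    by (auto simp: tele_in_def scale_def pull_def)
  have "on_fst (tele_out E \<kappa>) (tele_in E R \<rho>) x y = tele_out E \<kappa> ?Z e e'"
    by (simp add: on_fst_apply)
  also have "\<dots> = (\<Sum>m2\<in>M. \<Sum>d\<in>C. \<Sum>m2'\<in>M. \<Sum>d'\<in>C. if d' = c' then if d = c then
      complex_of_real (1 / D) * (?U m2 c * \<rho> (e, m2, m1, r) (e', m2', m1', r') * cnj (?U m2' c')) else 0 else 0)"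
    unfolding tele_out_apply[OF fin(1) Z] by (intro sum.cong refl) (auto simp: Ze)
  also have "\<dots> = (\<Sum>m2\<in>M. \<Sum>d\<in>C. \<Sum>m2'\<in>M. if d = c then
      complex_of_real (1 / D) * (?U m2 c * \<rho> (e, m2, m1, r) (e', m2', m1', r') * cnj (?U m2' c')) else 0)"
    by (intro sum.cong refl) (auto simp: U0)
  also have "\<dots> = (\<Sum>m2\<in>M. \<Sum>m2'\<in>M. \<Sum>d\<in>C. if d = c then
      complex_of_real (1 / D) * (?U m2 c * \<rho> (e, m2, m1, r) (e', m2', m1', r') * cnj (?U m2' c')) else 0)"
    by (intro sum.cong refl sum.swap)
  also have "\<dots> = (\<Sum>m2\<in>M. \<Sum>m2'\<in>M.
      complex_of_real (1 / D) * (?U m2 c * \<rho> (e, m2, m1, r) (e', m2', m1', r') * cnj (?U m2' c')))"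
    by (intro sum.cong refl) (auto simp: U0)
  also have "\<dots> = complex_of_real (1 / D) * encrypt m t V \<kappa> (\<lambda>m2 m2'. \<rho> (e, m2, m1, r) (e', m2', m1', r')) c c'"
    by (simp only: encrypt_apply sum_distrib_left)
  also have "\<dots> = scale (complex_of_real (1 / D)) (on_snd (\<lambda>Y. swap_reg (on_fst (encrypt m t V \<kappa>) Y)) \<rho>) x y"
    by (simp add: scale_def on_snd_def swap_reg_def on_fst_def)
  finally show "on_fst (tele_out E \<kappa>) (tele_in E R \<rho>) x y
      = scale (complex_of_real (1 / D)) (on_snd (\<lambda>Y. swap_reg (on_fst (encrypt m t V \<kappa>) Y)) \<rho>) x y" .
qed

section \<open>Everything after the first decryption as one channel\<close>

definition second_stage ::
    "((bits \<times> bits) \<times> bits option \<times> 'r, (bits \<times> bits) \<times> bits option \<times> 'r) omap \<Rightarrow> 'k key \<Rightarrow>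
     (bits option \<times> (bits \<times> bits) \<times> 'r, (bits option \<times> bits option \<times> 'r) \<times> ('k key + 'k)) omap" where
  "second_stage \<A> \<kappa> X = reveal_key m fst \<kappa> (on_fst (decrypt m t V \<kappa>) (\<A> (swap_reg X)))"

lemma cptp_second_stage:
  assumes "finite R" "cptp (C \<times> MB \<times> R) (C \<times> MB \<times> R) \<A>" "\<kappa> \<in> K"
  shows "cptp (MB \<times> C \<times> R) ((MB \<times> MB \<times> R) \<times> Q) (second_stage \<A> \<kappa>)"
proof -
  have "unitary_op C (V (fst \<kappa>))" using assms(3) V by auto
  from cptp_decrypt[of m t V \<kappa>, OF this]
  show ?thesis
    unfolding second_stage_def[abs_def] using assms(1,3)
    by (intro cptp_comp[OF cptp_comp[OF cptp_comp[OF cptp_swap_reg assms(2)] cptp_on_fst] cptp_reveal_key])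
      (auto simp: K0(1))
qed

text \<open>The code key found in the key register selects the measurement, and its outcome becomes
  the second pad. This channel does not refer to the first stage, so it can follow the real and the
  ideal one alike.\<close>

definition tele_post ::
    "'e set \<Rightarrow> ((bits \<times> bits) \<times> bits option \<times> 'r, (bits \<times> bits) \<times> bits option \<times> 'r) omap \<Rightarrow>
     (('e \<times> bits \<times> bits \<times> bits) \<times> (bits option \<times> (bits \<times> bits) \<times> 'r) \<times> ('k key + 'k),
      'e \<times> (bits option \<times> bits option \<times> 'r) \<times> ('k key + 'k)) omap" where
  "tele_post E \<A> X = (\<Sum>\<kappa>\<in>K. scale (complex_of_real (1 / D))
     (on_snd (second_stage \<A> \<kappa>) (on_fst (tele_out E \<kappa>) (on_snd (select_key (fst \<kappa>)) X))))"

lemma trace_on_fst_tele_out: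
  assumes "finite E" "Z \<in> ops ((E \<times> M \<times> C) \<times> O')" "k0 \<in> K0"
  shows "(\<Sum>k\<in>pads m t. trace (E \<times> O') (on_fst (tele_out E (k0, k)) Z))
    = complex_of_real D * trace ((E \<times> M \<times> C) \<times> O') Z"
proof -
  let ?Z = "\<lambda>y a a'. Z (a, y) (a', y)"
  have "trace (E \<times> O') (on_fst (tele_out E (k0, k)) Z) = (\<Sum>y\<in>O'. trace E (tele_out E (k0, k) (?Z y)))" for k
    unfolding trace_def sum.cartesian_product' on_fst_apply by (rule sum.swap)
  then have "(\<Sum>k\<in>pads m t. trace (E \<times> O') (on_fst (tele_out E (k0, k)) Z))
      = (\<Sum>k\<in>pads m t. \<Sum>y\<in>O'. trace E (tele_out E (k0, k) (?Z y)))" by simp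
  also have "\<dots> = (\<Sum>y\<in>O'. \<Sum>k\<in>pads m t. trace E (tele_out E (k0, k) (?Z y)))"
    by (rule sum.swap)
  also have "\<dots> = (\<Sum>y\<in>O'. complex_of_real D * trace (E \<times> M \<times> C) (?Z y))"
    by (intro sum.cong refl trace_tele_out[OF assms(1) fst_block_ops[OF assms(2)] assms(3)])
  also have "\<dots> = complex_of_real D * trace ((E \<times> M \<times> C) \<times> O') Z"
    unfolding trace_def sum.cartesian_product'[of _ "E \<times> M \<times> C"] sum_distrib_left by (rule sum.swap)
  finally show ?thesis .
qed

text \<open>For each code key the sum over pads gives a factor \<open>D\<close> that cancels the
  weight \<open>1 / D\<close>, and the sum over code keys exhausts the key register by
  \<open>trace_select_key\<close>.\<close>

lemma cptp_tele_post:
  assumes E: "finite E" and R: "finite R" and A: "cptp (C \<times> MB \<times> R) (C \<times> MB \<times> R) \<A>"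
  shows "cptp ((E \<times> M \<times> C) \<times> (MB \<times> C \<times> R) \<times> Q) (E \<times> (MB \<times> MB \<times> R) \<times> Q) (tele_post E \<A>)"
  unfolding cptp_def
proof
  let ?F = "E \<times> M \<times> C" and ?O = "MB \<times> C \<times> R"
  have fin: "finite ?F" "finite ?O" "finite Q" "finite ((MB \<times> MB \<times> R) \<times> Q)"
    using E R K0(1) by auto
  have s: "cp_map (?F \<times> ?O \<times> Q) (?F \<times> ?O) (on_snd (select_key k))" for k
    using fin by (intro cp_on_snd cp_select_key) auto
  have o: "cp_map (?F \<times> ?O) (E \<times> ?O) (on_fst (tele_out E \<kappa>))" for \<kappa>
    using fin E by (intro cp_on_fst cp_tele_out)
  have g: "cptp (E \<times> ?O) (E \<times> (MB \<times> MB \<times> R) \<times> Q) (on_snd (second_stage \<A> \<kappa>))" if "\<kappa> \<in> K" for \<kappa>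
    using fin E that by (intro cptp_on_snd cptp_second_stage[OF R A])
  show "cp_map (?F \<times> ?O \<times> Q) (E \<times> (MB \<times> MB \<times> R) \<times> Q) (tele_post E \<A>)"
    unfolding tele_post_def[abs_def]
    by (intro cp_sum cp_scale cp_comp[OF cp_comp[OF s o]]) (use g in \<open>auto simp: cptp_def\<close>)
  show "trace_preserving (?F \<times> ?O \<times> Q) (E \<times> (MB \<times> MB \<times> R) \<times> Q) (tele_post E \<A>)"
    unfolding trace_preserving_def
  proof
    fix X :: "(('a \<times> bits \<times> bits \<times> bits) \<times> (bits option \<times> (bits \<times> bits) \<times> 'b) \<times> ('k key + 'k)) oper"
    assume X: "X \<in> ops (?F \<times> ?O \<times> Q)"
    let ?Z = "\<lambda>k. on_snd (select_key k) X"
    have Z: "?Z k \<in> ops (?F \<times> ?O)" for k by (rule linear_omapD(1)[OF cp_linear[OF s] X])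
    have "trace (E \<times> (MB \<times> MB \<times> R) \<times> Q) (tele_post E \<A> X)
        = (\<Sum>\<kappa>\<in>K. complex_of_real (1 / D) * trace (E \<times> ?O) (on_fst (tele_out E \<kappa>) (?Z (fst \<kappa>))))"
      unfolding tele_post_def trace_sum trace_scale
    proof (intro sum.cong refl arg_cong[of _ _ "(*) _"])
      fix \<kappa> assume "\<kappa> \<in> K"
      then show "trace (E \<times> (MB \<times> MB \<times> R) \<times> Q) (on_snd (second_stage \<A> \<kappa>) (on_fst (tele_out E \<kappa>) (?Z (fst \<kappa>))))
          = trace (E \<times> ?O) (on_fst (tele_out E \<kappa>) (?Z (fst \<kappa>)))"
        using g[of \<kappa>] linear_omapD(1)[OF cp_linear[OF o] Z] by (simp add: cptp_def trace_preserving_def)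
    qed
    also have "\<dots> = (\<Sum>k0\<in>K0. complex_of_real (1 / D)
        * (\<Sum>k\<in>pads m t. trace (E \<times> ?O) (on_fst (tele_out E (k0, k)) (?Z k0))))"
      unfolding sum.cartesian_product'[of _ K0] sum_distrib_left by simp
    also have "\<dots> = (\<Sum>k0\<in>K0. complex_of_real (1 / D) * (complex_of_real D * trace (?F \<times> ?O) (?Z k0)))"
      by (intro sum.cong refl arg_cong[of _ _ "(*) _"] trace_on_fst_tele_out[OF E Z])
    also have "\<dots> = (\<Sum>k0\<in>K0. trace (?F \<times> ?O) (?Z k0))"
      by simp
    also have "\<dots> = (\<Sum>x\<in>?F. \<Sum>k0\<in>K0. trace ?O (select_key k0 (block x x X)))"
      unfolding trace_on_snd by (rule sum.swap)
    also have "\<dots> = (\<Sum>x\<in>?F. trace (?O \<times> Q) (block x x X))"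
      by (simp only: trace_select_key)
    also have "\<dots> = trace (?F \<times> ?O \<times> Q) X"
      unfolding trace_def sum.cartesian_product'[of _ ?F] by (simp add: block_def)
    finally show "trace (E \<times> (MB \<times> MB \<times> R) \<times> Q) (tele_post E \<A> X) = trace (?F \<times> ?O \<times> Q) X" .
  qed
qed

text \<open>Stated for an arbitrary first stage \<open>T\<close> whose output, conditioned on the
  code key, is \<open>\<Theta> k\<close> with uniform weight, so that one proof serves the real and
  the ideal first stage.\<close>

lemma tele_post_tele_in:
  assumes E: "finite E" and R: "finite R" and A: "cptp (C \<times> MB \<times> R) (C \<times> MB \<times> R) \<A>"
    and T: "\<And>k \<sigma>. k \<in> K0 \<Longrightarrow> \<sigma> \<in> ops (M \<times> C \<times> R) \<Longrightarrow>
      select_key k (T \<sigma>) = scale (1 / of_nat (card K0)) (\<Theta> k \<sigma>)"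
    and \<Theta>: "\<And>k. k \<in> K0 \<Longrightarrow> linear_omap (M \<times> C \<times> R) (MB \<times> C \<times> R) (\<Theta> k)"
    and \<rho>: "\<rho> \<in> ops (E \<times> M \<times> M \<times> R)"
  shows "tele_post E \<A> (on_snd T (tele_in E R \<rho>))
    = on_snd (\<lambda>Y. avg K (\<lambda>\<kappa>. second_stage \<A> \<kappa> (\<Theta> (fst \<kappa>) (swap_reg (on_fst (encrypt m t V \<kappa>) Y))))) \<rho>"
proof -
  let ?F = "E \<times> M \<times> C" and ?\<sigma> = "tele_in E R \<rho>"
  let ?e = "\<lambda>\<kappa> Y. swap_reg (on_fst (encrypt m t V \<kappa>) Y)"
  let ?G = "\<lambda>\<kappa> Y. second_stage \<A> \<kappa> (\<Theta> (fst \<kappa>) (?e \<kappa> Y))"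
  let ?d = "complex_of_real (1 / D)" and ?c = "1 / of_nat (card K0) :: complex"
  have \<sigma>: "?\<sigma> \<in> ops (?F \<times> M \<times> C \<times> R)"
    by (rule linear_omapD(1)[OF cptp_linear[OF cptp_tele_in[OF E R]] \<rho>])
  have 1: "scale ?d (on_snd (second_stage \<A> \<kappa>) (on_fst (tele_out E \<kappa>) (on_snd (select_key (fst \<kappa>)) (on_snd T ?\<sigma>))))
      = scale (?d * (?c * ?d)) (on_snd (?G \<kappa>) \<rho>)" if \<kappa>: "\<kappa> \<in> K" for \<kappa>
  proof -
    have k: "fst \<kappa> \<in> K0" using \<kappa> by auto
    have Lw: "linear_omap ?F E (tele_out E \<kappa>)" by (rule cp_linear[OF cp_tele_out[OF E]])
    have Ls: "linear_omap (E \<times> MB \<times> C \<times> R) (E \<times> (MB \<times> MB \<times> R) \<times> Q) (on_snd (second_stage \<A> \<kappa>))"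
      by (rule linear_on_snd[OF cptp_linear[OF cptp_second_stage[OF R A \<kappa>]]])
    have Lt: "linear_omap (E \<times> M \<times> C \<times> R) (E \<times> MB \<times> C \<times> R) (on_snd (\<Theta> (fst \<kappa>)))"
      by (rule linear_on_snd[OF \<Theta>[OF k]])
    have "unitary_op C (V (fst \<kappa>))" by (rule V[OF k])
    then have "cptp (M \<times> M \<times> R) (M \<times> C \<times> R) (?e \<kappa>)"
      using R by (intro cptp_comp[OF cptp_on_fst cptp_swap_reg] cptp_encrypt) auto
    then have e: "on_snd (?e \<kappa>) \<rho> \<in> ops (E \<times> M \<times> C \<times> R)"
      by (rule linear_omapD(1)[OF linear_on_snd[OF cptp_linear] \<rho>])
    have s1: "on_snd (select_key (fst \<kappa>)) (on_snd T ?\<sigma>) = scale ?c (on_snd (\<Theta> (fst \<kappa>)) ?\<sigma>)"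
      unfolding on_snd_comp on_snd_scale_fun[symmetric] by (rule on_snd_cong[OF \<sigma> T[OF k]])
    have s2: "on_fst (tele_out E \<kappa>) (scale ?c (on_snd (\<Theta> (fst \<kappa>)) ?\<sigma>))
        = scale ?c (on_fst (tele_out E \<kappa>) (on_snd (\<Theta> (fst \<kappa>)) ?\<sigma>))"
      by (rule linear_omapD(3)[OF linear_on_fst[OF Lw] on_snd_ops[OF \<Theta>[OF k] \<sigma>]])
    \<comment> \<open>The measurement on \<open>M\<^sub>2 C'\<close> and the first stage act on
      different registers, so the measurement can be moved ahead of it, where
      \<open>teleport\<close> applies.\<close>
    have s3: "on_fst (tele_out E \<kappa>) (on_snd (\<Theta> (fst \<kappa>)) ?\<sigma>) = on_snd (\<Theta> (fst \<kappa>)) (on_fst (tele_out E \<kappa>) ?\<sigma>)"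
      using E R by (intro on_fst_on_snd[OF _ _ Lw \<Theta>[OF k] \<sigma>]) auto
    have s4: "on_snd (\<Theta> (fst \<kappa>)) (scale ?d (on_snd (?e \<kappa>) \<rho>)) = scale ?d (on_snd (\<Theta> (fst \<kappa>)) (on_snd (?e \<kappa>) \<rho>))"
      by (rule linear_omapD(3)[OF Lt e])
    have s5: "on_snd (second_stage \<A> \<kappa>) (scale (?c * ?d) (on_snd (\<Theta> (fst \<kappa>)) (on_snd (?e \<kappa>) \<rho>)))
        = scale (?c * ?d) (on_snd (second_stage \<A> \<kappa>) (on_snd (\<Theta> (fst \<kappa>)) (on_snd (?e \<kappa>) \<rho>)))"
      by (rule linear_omapD(3)[OF Ls linear_omapD(1)[OF Lt e]])
    have "scale ?d (on_snd (second_stage \<A> \<kappa>) (on_fst (tele_out E \<kappa>) (on_snd (select_key (fst \<kappa>)) (on_snd T ?\<sigma>))))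
        = scale (?d * (?c * ?d)) (on_snd (second_stage \<A> \<kappa>) (on_snd (\<Theta> (fst \<kappa>)) (on_snd (?e \<kappa>) \<rho>)))"
      by (simp only: s1 s2 s3 teleport[OF E R \<rho> k] s4 s5 scale_scale)
    then show ?thesis by (simp only: on_snd_comp)
  qed
  \<comment> \<open>One factor \<open>1 / D\<close> comes from the pair and one from the
    measurement; together they are the uniform weight of a pad, as there are \<open>D * D\<close>
    pads.\<close>
  have "?d * (?c * ?d) = 1 / of_nat (card K)"
    by (simp only: card_cartesian_product card_pads) (simp add: field_simps)
  then have "tele_post E \<A> (on_snd T ?\<sigma>) = (\<Sum>\<kappa>\<in>K. scale (1 / of_nat (card K)) (on_snd (?G \<kappa>) \<rho>))"
    unfolding tele_post_def by (intro sum.cong refl) (simp only: 1)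
  also have "\<dots> = on_snd (\<lambda>Y. avg K (\<lambda>\<kappa>. ?G \<kappa> Y)) \<rho>"
    unfolding on_snd_avg_fun by (simp only: avg_def scale_sum)
  finally show ?thesis .
qed

section \<open>The hybrid argument for two messages\<close>

lemma two_real_stages:
  "two_real m t V \<A>\<^sub>1 \<A>\<^sub>2 k0 k1 k2 \<rho> = on_fst (decrypt m t V (k0, k2)) (\<A>\<^sub>2 (swap_reg
     (first_stage (\<lambda>X. swap_reg (\<A>\<^sub>1 (swap_reg X))) (k0, k1) (swap_reg (on_fst (encrypt m t V (k0, k2)) \<rho>)))))"
  by (simp add: two_real_def first_stage_def on_snd_on_fst_swap)

lemma two_real_channel_stages:
  assumes R: "finite R" and A1: "cptp (C \<times> C \<times> R) (C \<times> C \<times> R) \<A>\<^sub>1"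
    and A2: "cptp (C \<times> MB \<times> R) (C \<times> MB \<times> R) \<A>\<^sub>2" and \<rho>: "\<rho> \<in> ops (M \<times> M \<times> R)"
  defines "\<A> \<equiv> \<lambda>X. swap_reg (\<A>\<^sub>1 (swap_reg X))"
  shows "two_real_channel m t K0 V \<A>\<^sub>1 \<A>\<^sub>2 \<rho> = avg K (\<lambda>\<kappa>. second_stage \<A>\<^sub>2 \<kappa>
    (avg (pads m t) (\<lambda>k1. first_stage \<A> (fst \<kappa>, k1) (swap_reg (on_fst (encrypt m t V \<kappa>) \<rho>)))))"
proof -
  have cA: "cptp (C \<times> C \<times> R) (C \<times> C \<times> R) \<A>"
    unfolding \<A>_def using R by (intro cptp_comp[OF cptp_comp[OF cptp_swap_reg A1] cptp_swap_reg]) auto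
  let ?Y = "\<lambda>\<kappa> k1. first_stage \<A> (fst \<kappa>, k1) (swap_reg (on_fst (encrypt m t V \<kappa>) \<rho>))"
  have Y: "?Y \<kappa> k1 \<in> ops (MB \<times> C \<times> R)" if "\<kappa> \<in> K" for \<kappa> k1
  proof -
    have k: "fst \<kappa> \<in> K0" using that by auto
    have "cptp (M \<times> M \<times> R) (M \<times> C \<times> R) (\<lambda>Y. swap_reg (on_fst (encrypt m t V \<kappa>) Y))"
      using R V[OF k] by (intro cptp_comp[OF cptp_on_fst cptp_swap_reg] cptp_encrypt) auto
    moreover have "cptp (M \<times> C \<times> R) (MB \<times> C \<times> R) (first_stage \<A> (fst \<kappa>, k1))"
      using R k by (intro cptp_first_stage[OF _ _ cA]) auto
    ultimately show ?thesis by (rule linear_omapD(1)[OF cptp_linear[OF cptp_comp] \<rho>])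
  qed
  have "two_real_channel m t K0 V \<A>\<^sub>1 \<A>\<^sub>2 \<rho>
      = avg (K0 \<times> pads m t \<times> pads m t) (\<lambda>(k0, k1, k2). second_stage \<A>\<^sub>2 (k0, k2) (?Y (k0, k2) k1))"
    by (simp only: two_real_channel_def two_real_stages second_stage_def \<A>_def fst_conv)
  also have "\<dots> = avg K (\<lambda>\<kappa>. avg (pads m t) (\<lambda>k1. second_stage \<A>\<^sub>2 \<kappa> (?Y \<kappa> k1)))"
    unfolding avg_case_triple by simp
  also have "\<dots> = avg K (\<lambda>\<kappa>. second_stage \<A>\<^sub>2 \<kappa> (avg (pads m t) (?Y \<kappa>)))"
    unfolding avg_def[of K]
    by (intro arg_cong[of _ _ "scale _"] sum.cong refl
        linear_avg[OF cptp_linear[OF cptp_second_stage[OF R A2]], symmetric] Y)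
  finally show ?thesis .
qed

text \<open>Pads do not occur in a recycled key and average out; this reconciles the key register of
  \<open>qca_r\<close> with that of \<open>two_ideal_channel\<close>.\<close>

lemma avg_recycled: "avg K (\<lambda>\<kappa>. ketbra (Inr (fst \<kappa>))) = avg K0 (\<lambda>k. ketbra (Inr k))"
proof -
  have "card (pads m t) \<noteq> 0" by (simp add: card_bitstr)
  then show ?thesis
    by (simp add: fun_eq_iff avg_apply sum.cartesian_product' card_cartesian_product flip: sum_distrib_left)
qed

lemma Q_eq: "K <+> fst ` K = Q"
  by simp

lemma two_messages:
  fixes R :: "'r set"
    and \<A>\<^sub>1 :: "((bits \<times> bits) \<times> (bits \<times> bits) \<times> 'r, (bits \<times> bits) \<times> (bits \<times> bits) \<times> 'r) omap"
    and \<A>\<^sub>2 :: "((bits \<times> bits) \<times> bits option \<times> 'r, (bits \<times> bits) \<times> bits option \<times> 'r) omap"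
  assumes q: "qca_r m t K0 V \<epsilon> fst" and R: "finite R" "R \<noteq> {}"
    and A1: "cptp (C \<times> C \<times> R) (C \<times> C \<times> R) \<A>\<^sub>1"
    and A2: "cptp (C \<times> MB \<times> R) (C \<times> MB \<times> R) \<A>\<^sub>2"
  shows "\<exists>\<A> Sr. cptp (C \<times> M \<times> R) (C \<times> MB \<times> R) \<A> \<and> cp_map (M \<times> R) (MB \<times> R) Sr \<and>
    trace_preserving (M \<times> R) (MB \<times> R) (acc_sim m t K0 V \<A> + Sr) \<and>
    diamond_dist (M \<times> M \<times> R) ((MB \<times> MB \<times> R) \<times> Q) (two_real_channel m t K0 V \<A>\<^sub>1 \<A>\<^sub>2)
      (two_ideal_channel m t K0 (acc_sim m t K0 V \<A>) Sr) \<le> ereal (2 * \<epsilon>)"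
proof -
  let ?k1 = "avg K (\<lambda>\<kappa>. ketbra (Inl \<kappa>)) :: ('k key + 'k) oper"
    and ?k2 = "avg K (\<lambda>\<kappa>. ketbra (Inr (fst \<kappa>))) :: ('k key + 'k) oper"
  have CR: "finite (C \<times> R)" "C \<times> R \<noteq> {}" using R by auto
  have MR: "finite (M \<times> R)" "M \<times> R \<noteq> {}" "finite (MB \<times> R)" "MB \<times> R \<noteq> {}"
    using R by (auto simp: msg_bot_def)
  \<comment> \<open>The first adversary with \<open>C\<^sub>1\<close> in front and
    \<open>C\<^sub>2 R\<close> as its side information.\<close>
  define \<B> where "\<B> = (\<lambda>X. swap_reg (\<A>\<^sub>1 (swap_reg X)))"
  have cB: "cptp (C \<times> C \<times> R) (C \<times> C \<times> R) \<B>"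
    unfolding \<B>_def using R by (intro cptp_comp[OF cptp_comp[OF cptp_swap_reg A1] cptp_swap_reg]) auto
  let ?Sa1 = "acc_sim m t K0 V \<B>"
  \<comment> \<open>The ancilla here consists of the original reference, \<open>M\<^sub>2\<close>
    and \<open>C'\<close>, which fixes its label type.\<close>
  obtain Sr1 where Sr1: "cp_map (C \<times> R) (C \<times> R) Sr1" "trace_preserving (C \<times> R) (C \<times> R) (?Sa1 + Sr1)"
    and close1: "\<And>(E :: (nat \<times> bits \<times> bits \<times> bits) set) \<rho>. finite E \<Longrightarrow> density (E \<times> M \<times> C \<times> R) \<rho> \<Longrightarrow>
      trace_norm (E \<times> (MB \<times> C \<times> R) \<times> Q) (on_snd (gen_real m t K0 V fst \<B>) \<rho>
        - on_snd (ideal_channel m ?Sa1 Sr1 ?k1 ?k2) \<rho>) \<le> 2 * \<epsilon>"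
    using qca_r_general[where 'e = "nat \<times> bits \<times> bits \<times> bits", OF K0 V q CR CR cB] unfolding Q_eq by blast
  have cSa1: "cp_map (C \<times> R) (C \<times> R) ?Sa1"
    using cB by (intro cp_acc_sim CR V) (simp_all add: cptp_def)
  let ?P = "bot_or_pass m ?Sa1 Sr1"
  have cP: "cptp (M \<times> C \<times> R) (MB \<times> C \<times> R) ?P"
    by (rule cptp_bot_or_pass[OF CR(1) CR(1) cSa1 Sr1])
  \<comment> \<open>The adversary to be exhibited: the ideal first stage on \<open>M\<^sub>1\<close>
    with side information \<open>C\<^sub>2 R\<close>, then \<open>\<A>\<^sub>2\<close>. It does not
    depend on the key in use, so QCA-R applies to it.\<close>
  define \<A> where "\<A> = (\<lambda>X. \<A>\<^sub>2 (swap_reg (?P (swap_reg X))))"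
  have cA: "cptp (C \<times> M \<times> R) (C \<times> MB \<times> R) \<A>"
    unfolding \<A>_def using R
    by (intro cptp_comp[OF cptp_comp[OF cptp_comp[OF cptp_swap_reg cP] cptp_swap_reg] A2]) auto
  let ?Sa = "acc_sim m t K0 V \<A>"
  obtain Sr where Sr: "cp_map (M \<times> R) (MB \<times> R) Sr" "trace_preserving (M \<times> R) (MB \<times> R) (?Sa + Sr)"
    and close2: "\<And>(E :: nat set) \<rho>. finite E \<Longrightarrow> density (E \<times> M \<times> M \<times> R) \<rho> \<Longrightarrow>
      trace_norm (E \<times> (MB \<times> MB \<times> R) \<times> Q) (on_snd (gen_real m t K0 V fst \<A>) \<rho>
        - on_snd (ideal_channel m ?Sa Sr ?k1 ?k2) \<rho>) \<le> 2 * \<epsilon>"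
    using qca_r_general[where 'e = nat, OF K0 V q MR cA] unfolding Q_eq by blast
  have cSa: "cp_map (M \<times> R) (MB \<times> R) ?Sa"
    using cA by (intro cp_acc_sim MR V) (simp_all add: cptp_def)
  let ?two = "two_real_channel m t K0 V \<A>\<^sub>1 \<A>\<^sub>2" and ?mid = "gen_real m t K0 V fst \<A>"
    and ?ideal = "ideal_channel m ?Sa Sr ?k1 ?k2"
  let ?R1 = "gen_real m t K0 V fst \<B>" and ?D1 = "ideal_channel m ?Sa1 Sr1 ?k1 ?k2"
  have ideal: "two_ideal_channel m t K0 ?Sa Sr = ?ideal"
  proof -
    have "(\<lambda>(k\<^sub>0, k\<^sub>2). ketbra (Inl (k\<^sub>0, k\<^sub>2))) = (\<lambda>\<kappa> :: 'k key. ketbra (Inl \<kappa> :: 'k key + 'k))"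
      by (simp only: split_def prod.collapse)
    then show ?thesis unfolding two_ideal_channel_def avg_recycled by simp
  qed
  have cR1: "cptp (M \<times> C \<times> R) ((MB \<times> C \<times> R) \<times> Q) ?R1"
    using cptp_gen_real[where f = fst, OF CR(1) CR(1) K0 cB V] unfolding Q_eq .
  have cD1: "cp_map (M \<times> C \<times> R) ((MB \<times> C \<times> R) \<times> Q) ?D1"
    by (rule cp_ideal_channel[OF CR(1) CR(1) finite_K(2) cSa1 Sr1(1)]) auto
  have cmid: "cptp (M \<times> M \<times> R) ((MB \<times> MB \<times> R) \<times> Q) ?mid"
    using cptp_gen_real[where f = fst, OF MR(1) MR(3) K0 cA V] unfolding Q_eq .
  have cideal: "cp_map (M \<times> M \<times> R) ((MB \<times> MB \<times> R) \<times> Q) ?ideal"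
    by (rule cp_ideal_channel[OF MR(1) MR(3) finite_K(2) cSa Sr(1)]) auto
  have "trace_norm ({..<d} \<times> (MB \<times> MB \<times> R) \<times> Q) (on_snd ?two \<rho> - on_snd ?ideal \<rho>) \<le> 2 * (2 * \<epsilon>)"
    if \<rho>: "density ({..<d} \<times> M \<times> M \<times> R) \<rho>" for d :: nat and \<rho>
  proof -
    let ?E = "{..<d}"
    let ?F = "?E \<times> M \<times> C" and ?O = "(MB \<times> MB \<times> R) \<times> Q"
    have o: "\<rho> \<in> ops (?E \<times> M \<times> M \<times> R)" and p: "psd (?E \<times> M \<times> M \<times> R) \<rho>"
      using \<rho> by (simp_all add: density_def psd_ops)
    let ?\<sigma> = "tele_in ?E R \<rho>" and ?post = "tele_post ?E \<A>\<^sub>2"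
    have fin: "finite (M \<times> C \<times> R)" "finite ((MB \<times> C \<times> R) \<times> Q)" "finite ?F" "finite (?E \<times> ?O)"
      "finite (?E \<times> M \<times> M \<times> R)" "finite (?F \<times> M \<times> C \<times> R)" "finite (?F \<times> (MB \<times> C \<times> R) \<times> Q)" "finite ?O"
      "finite (M \<times> M \<times> R)"
      using R K0(1) by auto
    have \<sigma>: "density (?F \<times> M \<times> C \<times> R) ?\<sigma>"
      by (rule density_cptp[OF cptp_tele_in[OF finite_lessThan R(1)] fin(5) fin(6) \<rho>])
    have pR: "psd (?F \<times> (MB \<times> C \<times> R) \<times> Q) (on_snd ?R1 ?\<sigma>)" and pD: "psd (?F \<times> (MB \<times> C \<times> R) \<times> Q) (on_snd ?D1 ?\<sigma>)"
      using psd_on_snd[OF fin(1,2,3) _ ] cR1 cD1 \<sigma> by (auto simp: density_def cptp_def)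
    note post = cptp_tele_post[OF finite_lessThan R(1) A2, of d]
    \<comment> \<open>With \<Theta> the first stage averaged over its pad, the result is the actual
      two-message channel.\<close>
    have "?post (on_snd ?R1 ?\<sigma>) = on_snd (\<lambda>Y. avg K (\<lambda>\<kappa>. second_stage \<A>\<^sub>2 \<kappa>
        (avg (pads m t) (\<lambda>k1. first_stage \<B> (fst \<kappa>, k1) (swap_reg (on_fst (encrypt m t V \<kappa>) Y)))))) \<rho>"
    proof (rule tele_post_tele_in[OF finite_lessThan R(1) A2 _ _ o,
          where \<Theta> = "\<lambda>k \<sigma>. avg (pads m t) (\<lambda>k1. first_stage \<B> (k, k1) \<sigma>)"])
      show "linear_omap (M \<times> C \<times> R) (MB \<times> C \<times> R) (\<lambda>\<sigma>. avg (pads m t) (\<lambda>k1. first_stage \<B> (k, k1) \<sigma>))"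
        if "k \<in> K0" for k
        using that by (intro cptp_linear cptp_avg cptp_first_stage[OF CR(1) CR(1) cB]) auto
    qed (rule select_key_real[OF CR(1) CR(1) cB])
    also have "\<dots> = on_snd ?two \<rho>"
      by (rule on_snd_cong[OF o, symmetric]) (simp only: two_real_channel_stages[OF R(1) A1 A2] \<B>_def)
    finally have 1: "on_snd ?two \<rho> = ?post (on_snd ?R1 ?\<sigma>)" ..
    \<comment> \<open>The same post-processing after the key-independent ideal stage yields a
      single-message real channel, the middle hybrid.\<close>
    have "?post (on_snd ?D1 ?\<sigma>) = on_snd (\<lambda>Y. avg K (\<lambda>\<kappa>. second_stage \<A>\<^sub>2 \<kappa>
        (?P (swap_reg (on_fst (encrypt m t V \<kappa>) Y))))) \<rho>"
      by (rule tele_post_tele_in[OF finite_lessThan R(1) A2 select_key_ideal cptp_linear[OF cP] o])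
    also have "\<dots> = on_snd ?mid \<rho>"
      by (simp only: gen_real_def[abs_def] second_stage_def \<A>_def)
    finally have 2: "on_snd ?mid \<rho> = ?post (on_snd ?D1 ?\<sigma>)" ..
    \<comment> \<open>Both hybrids are images under the one channel \<open>?post\<close>, so their
      distance is at most the one before it.\<close>
    have "trace_norm (?E \<times> ?O) (on_snd ?two \<rho> - on_snd ?mid \<rho>)
        \<le> trace_norm (?F \<times> (MB \<times> C \<times> R) \<times> Q) (on_snd ?R1 ?\<sigma> - on_snd ?D1 ?\<sigma>)"
      unfolding 1 2 by (rule trace_norm_cptp[OF post fin(7) fin(4) pR pD])
    also have "\<dots> \<le> 2 * \<epsilon>" by (rule close1[OF fin(3) \<sigma>])
    finally have a: "trace_norm (?E \<times> ?O) (on_snd ?two \<rho> - on_snd ?mid \<rho>) \<le> 2 * \<epsilon>" .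
    have b: "trace_norm (?E \<times> ?O) (on_snd ?mid \<rho> - on_snd ?ideal \<rho>) \<le> 2 * \<epsilon>"
      by (rule close2[OF finite_lessThan \<rho>])
    have "psd (?E \<times> ?O) (on_snd ?two \<rho>)"
      unfolding 1 using post by (intro psd_cp_image[OF _ fin(7) fin(4) pR]) (simp add: cptp_def)
    moreover have "psd (?E \<times> ?O) (on_snd ?mid \<rho>)" "psd (?E \<times> ?O) (on_snd ?ideal \<rho>)"
      using psd_on_snd[OF fin(9) fin(8) finite_lessThan _ p] cmid cideal by (auto simp: cptp_def)
    ultimately show ?thesis using trace_norm_triangle[OF fin(4)] a b by fastforce
  qed
  then have "diamond_dist (M \<times> M \<times> R) ((MB \<times> MB \<times> R) \<times> Q) ?two ?ideal \<le> ereal (2 * \<epsilon>)"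
    by (rule diamond_distI)
  then show ?thesis using cA Sr ideal by metis
qed

end

theorem theorem14:
  fixes m t :: nat
    and K0 :: "'k set"
    and V :: "'k \<Rightarrow> (bits \<times> bits) oper"
    and R :: "'r set"
    and \<epsilon> \<eta> :: real
    and \<A>\<^sub>1 :: "((bits \<times> bits) \<times> (bits \<times> bits) \<times> 'r, (bits \<times> bits) \<times> (bits \<times> bits) \<times> 'r) omap"
    and \<A>\<^sub>2 :: "((bits \<times> bits) \<times> bits option \<times> 'r, (bits \<times> bits) \<times> bits option \<times> 'r) omap"
  assumes "finite K0" and "K0 \<noteq> {}"
    and "strong_purity_testing m t K0 V \<eta>"
    and "qca_r m t K0 V \<epsilon> fst"
    and "finite R" and "R \<noteq> {}"
    and "cptp (cipher m t \<times> cipher m t \<times> R) (cipher m t \<times> cipher m t \<times> R) \<A>\<^sub>1"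
    and "cptp (cipher m t \<times> msg_bot m \<times> R) (cipher m t \<times> msg_bot m \<times> R) \<A>\<^sub>2"
  shows "\<exists>\<A> S\<^sub>r\<^sub>e\<^sub>j.
    cptp (cipher m t \<times> bitstr m \<times> R) (cipher m t \<times> msg_bot m \<times> R) \<A> \<and>
    cp_map (bitstr m \<times> R) (msg_bot m \<times> R) S\<^sub>r\<^sub>e\<^sub>j \<and>
    trace_preserving (bitstr m \<times> R) (msg_bot m \<times> R) (acc_sim m t K0 V \<A> + S\<^sub>r\<^sub>e\<^sub>j) \<and>
    diamond_dist (bitstr m \<times> bitstr m \<times> R)
      ((msg_bot m \<times> msg_bot m \<times> R) \<times> ((K0 \<times> pads m t) <+> K0))
      (two_real_channel m t K0 V \<A>\<^sub>1 \<A>\<^sub>2)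
      (two_ideal_channel m t K0 (acc_sim m t K0 V \<A>) S\<^sub>r\<^sub>e\<^sub>j)
    \<le> ereal (2 * \<epsilon>)"
proof -
  interpret teleported_message m t K0 V
    using assms(1-3) by unfold_locales (auto simp: strong_purity_testing_def code_unitary_def)
  show ?thesis by (rule two_messages[OF assms(4-8)])
qed

end
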